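(* Let $G$ be a finite abelian group. (a) There exist an integer $n$ and a Bieberbach subgroup $\Gamma_G$ of $B_n/[P_n,P_n]$ of dimension $n(n-1)/2$ with holonomy group (isomorphic to) $G$. (b) $G$ is the holonomy group of a flat manifold $\mathcal{X}_{\Gamma_G}$ of dimension $n(n-1)/2$, where $n$ is an integer for which $G$ embeds in the symmetric group $S_n$, and the fundamental group of $\mathcal{X}_{\Gamma_G}$ is isomorphic to a subgroup $\Gamma_G$ of $B_n/[P_n,P_n]$.
   Context: $B_n$ is the Artin braid group on $n$ strings, with generators $\sigma_1,\ldots,\sigma_{n-1}$ and relations $\sigma_i\sigma_j=\sigma_j\sigma_i$ for $|i-j|\ge 2$ and $\sigma_i\sigma_{i+1}\sigma_i=\sigma_{i+1}\sigma_i\sigma_{i+1}$. $P_n$ is the pure braid group, i.e. the kernel of the homomorphism $\sigma\colon B_n\to S_n$, $\sigma(\sigma_i)=(i,\,i+1)$, and $[P_n,P_n]$ is its commutator subgroup. A crystallographic group of dimension $N$ is a discrete cocompact subgroup of $\mathbb{R}^N\rtimes O(N,\mathbb{R})$. Equivalently, it is a group $\Pi$ fitting in a short exact sequence $0\to\mathbb{Z}^N\to\Pi\to\Phi\to1$ with $\Phi$ finite and such that the representation $\Theta\colon\Phi\to\operatorname{Aut}(\mathbb{Z}^N)$ induced by conjugation is faithful. The finite group $\Phi$ is the holonomy group of $\Pi$ and $\Theta$ its holonomy representation. A Bieberbach group is a torsion-free crystallographic group. A flat manifold is a closed Riemannian manifold of zero curvature; its fundamental group is a Bieberbach group of the same dimension,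 and its holonomy group is the holonomy group of that Bieberbach group. *)

theory Defs
  imports
    "HOL-Analysis.Analysis"
    "HOL-Algebra.Sym_Groups"
    "HOL-Algebra.Product_Groups"
    "HOL-Algebra.Bij"
begin

section \<open>Groups given by generators and relations\<close>

text \<open>A letter \<open>(a, True)\<close> stands for the generator \<open>a\<close>, and \<open>(a, False)\<close> for its inverse.\<close>

type_synonym 'g word = "('g \<times> bool) list"

definition words :: "'g set \<Rightarrow> 'g word set"
  where "words S = lists (S \<times> UNIV)"

inductive word_eq :: "'g set \<Rightarrow> ('g word \<times> 'g word) set \<Rightarrow> 'g word \<Rightarrow> 'g word \<Rightarrow> bool"
  for S R where
  refl: "w \<in> words S \<Longrightarrow> word_eq S R w w"
| sym: "word_eq S R u v \<Longrightarrow> word_eq S R v u"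
| trans: "word_eq S R u v \<Longrightarrow> word_eq S R v w \<Longrightarrow> word_eq S R u w"
| cancel: "a \<in> S \<Longrightarrow> word_eq S R [(a, b), (a, \<not> b)] []"
| rel: "(u, v) \<in> R \<Longrightarrow> u \<in> words S \<Longrightarrow> v \<in> words S \<Longrightarrow> word_eq S R u v"
| append: "word_eq S R u u' \<Longrightarrow> word_eq S R v v' \<Longrightarrow> word_eq S R (u @ v) (u' @ v')"

definition presented_group :: "'g set \<Rightarrow> ('g word \<times> 'g word) set \<Rightarrow> 'g word set monoid"
  where "presented_group S R =
    (let E = {(u, v). word_eq S R u v} in
      \<lparr>carrier = words S // E,
       monoid.mult = (\<lambda>C D. \<Union>u\<in>C. \<Union>v\<in>D. E `` {u @ v}),
       one = E `` {[]}\<rparr>)"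


section \<open>Braid groups\<close>

definition braid_relations :: "nat \<Rightarrow> (nat word \<times> nat word) set"
  where "braid_relations n =
    {([(i, True), (j, True)], [(j, True), (i, True)]) | i j.
        i \<in> {1..<n} \<and> j \<in> {1..<n} \<and> (i + 2 \<le> j \<or> j + 2 \<le> i)} \<union>
    {([(i, True), (Suc i, True), (i, True)], [(Suc i, True), (i, True), (Suc i, True)]) | i.
        i \<in> {1..<n} \<and> Suc i \<in> {1..<n}}"

definition braid_group :: "nat \<Rightarrow> nat word set monoid"
  where "braid_group n = presented_group {1..<n} (braid_relations n)"

fun word_perm :: "nat word \<Rightarrow> nat \<Rightarrow> nat" where
  "word_perm [] = id"
| "word_perm ((i, b) # w) = Transposition.transpose i (Suc i) \<circ> word_perm w"

text \<open>All words in a class have the same permutation, so the image below is a singleton.\<close>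

definition braid_perm :: "nat word set \<Rightarrow> nat \<Rightarrow> nat"
  where "braid_perm C = the_elem (word_perm ` C)"

definition pure_braids :: "nat \<Rightarrow> nat word set set"
  where "pure_braids n = kernel (braid_group n) (sym_group n) braid_perm"

definition braid_quotient :: "nat \<Rightarrow> nat word set set monoid"
  where "braid_quotient n = braid_group n Mod derived (braid_group n) (pure_braids n)"


section \<open>Crystallographic and Bieberbach groups\<close>

abbreviation int_lattice :: "nat \<Rightarrow> (nat \<Rightarrow> int) monoid"
  where "int_lattice N \<equiv> product_group {..<N} (\<lambda>_. integer_group)"

text \<open>\<open>H\<close> is crystallographic of dimension \<open>N\<close> with holonomy group (isomorphic to) \<open>\<Phi>\<close>:
  there is an exact sequence \<open>0 \<rightarrow> \<int>\<^sup>N \<rightarrow> H \<rightarrow> \<Phi> \<rightarrow> 1\<close>, with maps \<open>\<iota>\<close> and \<open>p\<close>, such that \<open>\<Phi>\<close> is finite and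
  the holonomy representation \<open>\<Theta>\<close> induced by conjugation is faithful.\<close>

definition crystallographic ::
    "nat \<Rightarrow> ('a, 'c) monoid_scheme \<Rightarrow> ('b, 'd) monoid_scheme \<Rightarrow> bool"
  where "crystallographic N H \<Phi> \<longleftrightarrow>
    group H \<and> group \<Phi> \<and> finite (carrier \<Phi>) \<and>
    (\<exists>\<iota> p \<Theta>.
      \<iota> \<in> mon (int_lattice N) H \<and> p \<in> epi H \<Phi> \<and>
      \<iota> ` carrier (int_lattice N) = kernel H \<Phi> p \<and>
      \<Theta> \<in> mon \<Phi> (AutoGroup (int_lattice N)) \<and>
      (\<forall>x\<in>carrier H. \<forall>v\<in>carrier (int_lattice N).
        \<iota> (\<Theta> (p x) v) = x \<otimes>\<^bsub>H\<^esub> \<iota> v \<otimes>\<^bsub>H\<^esub> inv\<^bsub>H\<^esub> x))"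

definition torsion_free :: "('a, 'c) monoid_scheme \<Rightarrow> bool"
  where "torsion_free H \<longleftrightarrow>
    (\<forall>x\<in>carrier H. x \<noteq> \<one>\<^bsub>H\<^esub> \<longrightarrow> (\<forall>k::nat. k > 0 \<longrightarrow> x [^]\<^bsub>H\<^esub> k \<noteq> \<one>\<^bsub>H\<^esub>))"

definition bieberbach ::
    "nat \<Rightarrow> ('a, 'c) monoid_scheme \<Rightarrow> ('b, 'd) monoid_scheme \<Rightarrow> bool"
  where "bieberbach N H \<Phi> \<longleftrightarrow> crystallographic N H \<Phi> \<and> torsion_free H"


section \<open>Closed flat Riemannian manifolds\<close>

text \<open>\<open>\<real>\<^sup>N\<close> is \<^const>\<open>Euclidean_space\<close>: coordinates are indexed by \<open>i < N\<close>, and the others vanish.\<close>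

definition partial_deriv :: "nat \<Rightarrow> ((nat \<Rightarrow> real) \<Rightarrow> real) \<Rightarrow> (nat \<Rightarrow> real) \<Rightarrow> real"
  where "partial_deriv i f x = deriv (\<lambda>t. f (x(i := t))) (x i)"

fun C_k_on :: "nat \<Rightarrow> nat \<Rightarrow> (nat \<Rightarrow> real) set \<Rightarrow> ((nat \<Rightarrow> real) \<Rightarrow> real) \<Rightarrow> bool" where
  "C_k_on 0 N U f = continuous_map (subtopology (Euclidean_space N) U) euclideanreal f"
| "C_k_on (Suc k) N U f =
    (continuous_map (subtopology (Euclidean_space N) U) euclideanreal f \<and>
     (\<forall>i<N. (\<forall>x\<in>U. (\<lambda>t. f (x(i := t))) differentiable (at (x i))) \<and>
            C_k_on k N U (partial_deriv i f)))"

definition smooth_on :: "nat \<Rightarrow> (nat \<Rightarrow> real) set \<Rightarrow> ((nat \<Rightarrow> real) \<Rightarrow> real) \<Rightarrow> bool"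
  where "smooth_on N U f \<longleftrightarrow> (\<forall>k. C_k_on k N U f)"

text \<open>A chart is a pair of its domain and its coordinate map.\<close>

type_synonym 'a chart = "'a set \<times> ('a \<Rightarrow> nat \<Rightarrow> real)"

definition transition :: "'a chart \<Rightarrow> 'a chart \<Rightarrow> (nat \<Rightarrow> real) \<Rightarrow> nat \<Rightarrow> real"
  where "transition c d = snd d \<circ> inv_into (fst c) (snd c)"

definition smooth_atlas :: "nat \<Rightarrow> 'a topology \<Rightarrow> 'a chart set \<Rightarrow> bool"
  where "smooth_atlas N X \<A> \<longleftrightarrow>
    (\<Union>c\<in>\<A>. fst c) = topspace X \<and>
    (\<forall>(U, \<phi>)\<in>\<A>. openin X U \<and> openin (Euclidean_space N) (\<phi> ` U) \<and>
      homeomorphic_map (subtopology X U) (subtopology (Euclidean_space N) (\<phi> ` U)) \<phi>) \<and>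
    (\<forall>c\<in>\<A>. \<forall>d\<in>\<A>. \<forall>k<N.
      smooth_on N (snd c ` (fst c \<inter> fst d)) (\<lambda>x. transition c d x k))"

text \<open>A metric is given by its component functions in each chart, as functions of the coordinates.\<close>

type_synonym metric_components = "(nat \<Rightarrow> real) \<Rightarrow> nat \<Rightarrow> nat \<Rightarrow> real"

definition riemannian_metric :: "nat \<Rightarrow> 'a chart set \<Rightarrow> ('a chart \<Rightarrow> metric_components) \<Rightarrow> bool"
  where "riemannian_metric N \<A> g \<longleftrightarrow>
    (\<forall>c\<in>\<A>.
      (\<forall>i<N. \<forall>j<N. smooth_on N (snd c ` fst c) (\<lambda>x. g c x i j)) \<and>
      (\<forall>x\<in>snd c ` fst c.
        (\<forall>i<N. \<forall>j<N. g c x i j = g c x j i) \<and>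
        (\<forall>v. (\<exists>i<N. v i \<noteq> 0) \<longrightarrow> (\<Sum>i<N. \<Sum>j<N. g c x i j * v i * v j) > 0))) \<and>
    (\<forall>c\<in>\<A>. \<forall>d\<in>\<A>. \<forall>x\<in>snd c ` (fst c \<inter> fst d). \<forall>i<N. \<forall>j<N.
      g c x i j =
        (\<Sum>k<N. \<Sum>l<N. partial_deriv i (\<lambda>y. transition c d y k) x *
                       partial_deriv j (\<lambda>y. transition c d y l) x *
                       g d (transition c d x) k l))"

text \<open>The entries outside the \<open>N \<times> N\<close> block are set to \<open>0\<close> so that the inverse is unique.\<close>

definition matrix_inverse :: "nat \<Rightarrow> (nat \<Rightarrow> nat \<Rightarrow> real) \<Rightarrow> nat \<Rightarrow> nat \<Rightarrow> real"
  where "matrix_inverse N A =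
    (THE B. (\<forall>i j. i \<ge> N \<or> j \<ge> N \<longrightarrow> B i j = 0) \<and>
            (\<forall>i<N. \<forall>j<N. (\<Sum>k<N. A i k * B k j) = (if i = j then 1 else 0)))"

text \<open>The Christoffel symbol \<open>\<Gamma>\<^sup>k\<^sub>i\<^sub>j\<close>.\<close>

definition christoffel ::
    "nat \<Rightarrow> metric_components \<Rightarrow> nat \<Rightarrow> nat \<Rightarrow> nat \<Rightarrow> (nat \<Rightarrow> real) \<Rightarrow> real"
  where "christoffel N h k i j x =
    (\<Sum>l<N. matrix_inverse N (h x) k l *
      (partial_deriv i (\<lambda>y. h y j l) x + partial_deriv j (\<lambda>y. h y i l) x
        - partial_deriv l (\<lambda>y. h y i j) x)) / 2"

text \<open>The component \<open>R\<^sup>l\<^sub>k\<^sub>i\<^sub>j\<close> of the curvature tensor, i.e. the coefficient of \<open>\<partial>\<^sub>l\<close> in \<open>R(\<partial>\<^sub>i, \<partial>\<^sub>j) \<partial>\<^sub>k\<close>.\<close>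

definition riemann_curvature ::
    "nat \<Rightarrow> metric_components \<Rightarrow> nat \<Rightarrow> nat \<Rightarrow> nat \<Rightarrow> nat \<Rightarrow> (nat \<Rightarrow> real) \<Rightarrow> real"
  where "riemann_curvature N h l k i j x =
    partial_deriv i (christoffel N h l j k) x - partial_deriv j (christoffel N h l i k) x
    + (\<Sum>m<N. christoffel N h l i m x * christoffel N h m j k x
            - christoffel N h l j m x * christoffel N h m i k x)"

text \<open>Closed manifolds are understood to be connected and nonempty, so that the fundamental group
  is defined up to isomorphism.\<close>

definition flat_manifold ::
    "nat \<Rightarrow> 'a topology \<Rightarrow> 'a chart set \<Rightarrow> ('a chart \<Rightarrow> metric_components) \<Rightarrow> bool"
  where "flat_manifold N X \<A> g \<longleftrightarrow>
    Hausdorff_space X \<and> second_countable X \<and> compact_space X \<and>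
    connected_space X \<and> topspace X \<noteq> {} \<and>
    smooth_atlas N X \<A> \<and> riemannian_metric N \<A> g \<and>
    (\<forall>c\<in>\<A>. \<forall>x\<in>snd c ` fst c. \<forall>l<N. \<forall>k<N. \<forall>i<N. \<forall>j<N.
      riemann_curvature N (g c) l k i j x = 0)"


section \<open>Fundamental group\<close>

definition loops :: "'a topology \<Rightarrow> 'a \<Rightarrow> (real \<Rightarrow> 'a) set"
  where "loops X x = {p. pathin X p \<and> p 0 = x \<and> p 1 = x}"

definition loop_homotopy :: "'a topology \<Rightarrow> 'a \<Rightarrow> ((real \<Rightarrow> 'a) \<times> (real \<Rightarrow> 'a)) set"
  where "loop_homotopy X x =
    {(p, q). homotopic_with (\<lambda>r. r 0 = x \<and> r 1 = x) (top_of_set {0..1}) X p q}"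

text \<open>The library's \<^const>\<open>joinpaths\<close> is confined to types of class \<^class>\<open>topological_space\<close>.\<close>

definition loop_join :: "(real \<Rightarrow> 'a) \<Rightarrow> (real \<Rightarrow> 'a) \<Rightarrow> real \<Rightarrow> 'a"
  where "loop_join p q = (\<lambda>t. if t \<le> 1/2 then p (2 * t) else q (2 * t - 1))"

definition fundamental_group :: "'a topology \<Rightarrow> 'a \<Rightarrow> (real \<Rightarrow> 'a) set monoid"
  where "fundamental_group X x =
    \<lparr>carrier = loops X x // loop_homotopy X x,
     monoid.mult = (\<lambda>C D. \<Union>p\<in>C. \<Union>q\<in>D. loop_homotopy X x `` {loop_join p q}),
     one = loop_homotopy X x `` {\<lambda>_. x}\<rparr>"

text \<open>The holonomy group of a flat manifold is that of its fundamental group, a Bieberbach group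
  of the same dimension.\<close>

definition flat_manifold_holonomy :: "nat \<Rightarrow> 'a topology \<Rightarrow> ('b, 'd) monoid_scheme \<Rightarrow> bool"
  where "flat_manifold_holonomy N X \<Phi> \<longleftrightarrow>
    (\<forall>x\<in>topspace X. bieberbach N (fundamental_group X x) \<Phi>)"

end

theory Submission
  imports Defs "HOL-Algebra.FiniteProduct" "HOL-Algebra.Multiplicative_Group"
begin

text \<open>Counting signed crossings of pairs of strings maps \<open>B\<^sub>n\<close> to \<open>\<int>\<^bsup>n(n-1)/2\<^esup> \<rtimes> S\<^sub>n\<close>, where \<open>S\<^sub>n\<close> permutes the
  coordinates. The induced map on \<open>B\<^sub>n / [P\<^sub>n, P\<^sub>n]\<close> is injective: by the Coxeter normal form, \<open>P\<^sub>n / [P\<^sub>n, P\<^sub>n]\<close>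
  is generated by the full twists of the pairs, whose images \<open>2 e\<^bsub>ij\<^esub>\<close> are linearly independent.

  Let \<open>m = |G|\<close> and \<open>n = 2m + 1\<close>. Let \<open>G\<close> act on \<open>{1..m}\<close> by the regular representation and trivially on the
  other points. The subgroup \<open>\<Gamma>\<close> consists of the elements over \<open>G\<close> whose coordinates at the \<open>m\<close> fixed pairs
  \<open>{m + i, n}\<close> are prescribed modulo \<open>2m\<close> by characters \<open>G \<rightarrow> \<int>/m\<close>. A power of an element multiplies these
  coordinates, so a torsion element has coordinate \<open>0\<close> there; since characters separate the points of \<open>G\<close>, it lies
  in the lattice, which is torsion-free.

  The group \<open>\<Gamma>\<close> acts on \<open>\<real>\<^sup>N\<close> by translations and permutations of coordinates. The \<open>m\<close>-th power of a nontrivial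
  element is a nontrivial integral translation, so every nontrivial element moves every point by at least \<open>1/m\<close>.
  Hence the quotient metric is locally isometric to \<open>\<real>\<^sup>N\<close>, which gives the flat manifold, and lifting paths
  identifies its fundamental group with \<open>\<Gamma>\<close>.\<close>

section \<open>Presented groups\<close>

text \<open>The obstacle is torsion. The full preimage of \<open>G\<close> in the quotient need not
  be torsion-free: \<open>s 1 \<otimes> inv (s 2)\<close>, for example, has order 3, since its
  coordinates cancel along the 3-cycle lying under it. Coordinates at pairs that \<open>G\<close>
  fixes cannot cancel in this way, because they add up along powers; the strings beyond
  \<open>m\<close> are there to supply such pairs, one for each element of \<open>G\<close>, so that
  every element has room for a character that detects it. Prescribing these coordinates does not
  shrink the image in \<open>G\<close>: an element over \<open>g\<close> keeps the order of the
  fixed strings, so its coordinates there are even, and a pure element can correct them by arbitrary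
  even numbers. This parity is the reason why characters are doubled and the congruence is modulo
  \<open>2m\<close>. Congruences only pass to a sublattice of finite index, so the dimension remains
  the number of pairs. The holonomy representation is faithful because a permutation of at least
  three points that fixes every pair is trivial.\<close>

lemma words_Nil [simp]: "[] \<in> words S"
  by (simp add: words_def)

lemma words_Cons [simp]: "(a, b) # w \<in> words S \<longleftrightarrow> a \<in> S \<and> w \<in> words S"
  by (auto simp: words_def)

lemma words_append [simp]: "u @ v \<in> words S \<longleftrightarrow> u \<in> words S \<and> v \<in> words S"
  by (auto simp: words_def)

lemma word_eq_words: "word_eq S R u v \<Longrightarrow> u \<in> words S \<and> v \<in> words S"
  by (induction rule: word_eq.induct) auto

definition word_class :: "'g set \<Rightarrow> ('g word \<times> 'g word) set \<Rightarrow> 'g word \<Rightarrow> 'g word set"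
  where "word_class S R w = {(u, v). word_eq S R u v} `` {w}"

lemma equiv_word_eq: "equiv (words S) {(u, v). word_eq S R u v}"
  by (rule equivI) (use word_eq_words in \<open>auto simp: refl_on_def sym_on_def trans_on_def
        intro: word_eq.refl word_eq.sym elim: word_eq.trans\<close>)

lemma word_class_eq_iff:
  assumes "u \<in> words S" "v \<in> words S"
  shows "word_class S R u = word_class S R v \<longleftrightarrow> word_eq S R u v"
  using eq_equiv_class_iff[OF equiv_word_eq assms] by (simp add: word_class_def)

lemma carrier_presented_group: "carrier (presented_group S R) = word_class S R ` words S"
  by (auto simp: presented_group_def Let_def quotient_def word_class_def)

lemma one_presented_group: "\<one>\<^bsub>presented_group S R\<^esub> = word_class S R []"
  by (simp add: presented_group_def Let_def word_class_def)

lemma mult_presented_group: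
  assumes "u \<in> words S" "v \<in> words S"
  shows "word_class S R u \<otimes>\<^bsub>presented_group S R\<^esub> word_class S R v = word_class S R (u @ v)"
proof -
  have eq: "word_class S R (u' @ v') = word_class S R (u @ v)"
    if "u' \<in> word_class S R u" "v' \<in> word_class S R v" for u' v'
  proof -
    have "word_eq S R u u'" "word_eq S R v v'"
      using that by (simp_all add: word_class_def)
    then show ?thesis
      using word_eq_words[of S R u u'] word_eq_words[of S R v v'] word_eq.sym[OF word_eq.append]
      by (simp add: word_class_eq_iff)
  qed
  have "u \<in> word_class S R u" "v \<in> word_class S R v"
    using assms by (auto simp: word_class_def intro: word_eq.refl)
  \<comment> \<open>The union ranges over nonempty classes and is constant by \<open>eq\<close>, so
    it collapses to one class.\<close>
  then have "word_class S R u \<noteq> {}" "word_class S R v \<noteq> {}"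
    by blast+
  then have "(\<Union>u'\<in>word_class S R u. \<Union>v'\<in>word_class S R v. word_class S R (u' @ v')) =
      word_class S R (u @ v)"
    by (simp add: eq cong: SUP_cong)
  then show ?thesis
    by (simp add: presented_group_def Let_def word_class_def)
qed

definition word_inv :: "'g word \<Rightarrow> 'g word"
  where "word_inv w = rev (map (\<lambda>(a, b). (a, \<not> b)) w)"

lemma word_inv_words: "w \<in> words S \<Longrightarrow> word_inv w \<in> words S"
  by (induction w) (auto simp: word_inv_def)

lemma word_inv_cancel: "w \<in> words S \<Longrightarrow> word_eq S R (word_inv w @ w) []"
proof (induction w)
  case Nil
  then show ?case by (simp add: word_inv_def word_eq.refl)
next
  case (Cons x w)
  obtain a b where x: "x = (a, b)" by force
  have w: "w \<in> words S" "a \<in> S" "word_inv w \<in> words S"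
    using Cons.prems by (auto simp: x word_inv_words)
  have "word_eq S R [(a, \<not> b), (a, b)] []"
    using word_eq.cancel[of a S R "\<not> b"] w by simp
  note word_eq.append[OF this word_eq.refl[OF w(1)]]
  note word_eq.append[OF word_eq.refl[OF w(3)] this]
  also have "word_inv w @ ([(a, \<not> b), (a, b)] @ w) = word_inv (x # w) @ x # w"
    by (simp add: word_inv_def x)
  finally show ?case
    using word_eq.trans Cons.IH[OF w(1)] by fastforce
qed

lemma group_presented_group: "group (presented_group S R)"
proof (rule groupI)
  show "\<exists>y\<in>carrier (presented_group S R). y \<otimes>\<^bsub>presented_group S R\<^esub> x = \<one>\<^bsub>presented_group S R\<^esub>"
    if x: "x \<in> carrier (presented_group S R)" for x
  proof -
    obtain w where w: "w \<in> words S" "x = word_class S R w"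
      using x unfolding carrier_presented_group by blast
    then have "word_class S R (word_inv w) \<otimes>\<^bsub>presented_group S R\<^esub> x = \<one>\<^bsub>presented_group S R\<^esub>"
      using word_inv_cancel[OF w(1), of R]
      by (simp add: mult_presented_group one_presented_group word_inv_words word_class_eq_iff)
    then show ?thesis using w word_inv_words by (auto simp: carrier_presented_group)
  qed
qed (auto simp: carrier_presented_group mult_presented_group one_presented_group)

primrec word_eval :: "('a, 'c) monoid_scheme \<Rightarrow> ('g \<Rightarrow> 'a) \<Rightarrow> 'g word \<Rightarrow> 'a" where
  "word_eval H f [] = \<one>\<^bsub>H\<^esub>"
| "word_eval H f (x # w) =
    (if snd x then f (fst x) else inv\<^bsub>H\<^esub> f (fst x)) \<otimes>\<^bsub>H\<^esub> word_eval H f w"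

context group
begin

lemma word_eval_closed [simp]:
  "f \<in> S \<rightarrow> carrier G \<Longrightarrow> w \<in> words S \<Longrightarrow> word_eval G f w \<in> carrier G"
  by (induction w) (auto simp: Pi_iff)

lemma word_eval_append:
  "f \<in> S \<rightarrow> carrier G \<Longrightarrow> u \<in> words S \<Longrightarrow> v \<in> words S \<Longrightarrow>
    word_eval G f (u @ v) = word_eval G f u \<otimes> word_eval G f v"
  by (induction u) (auto simp: m_assoc Pi_iff)

lemma word_eval_eq:
  assumes f: "f \<in> S \<rightarrow> carrier G"
    and rel: "\<And>u v. (u, v) \<in> R \<Longrightarrow> word_eval G f u = word_eval G f v"
    and "word_eq S R u v"
  shows "word_eval G f u = word_eval G f v"
  using assms(3)
proof (induction rule: word_eq.induct)
  case (cancel a b)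
  then show ?case using f by (auto simp: Pi_iff)
next
  case (append u u' v v')
  then show ?case using f by (auto simp: word_eval_append dest!: word_eq_words)
qed (auto intro: rel)

lemma the_elem_word_eval:
  assumes f: "f \<in> S \<rightarrow> carrier G"
    and rel: "\<And>u v. (u, v) \<in> R \<Longrightarrow> word_eval G f u = word_eval G f v"
    and w: "w \<in> words S"
  shows "the_elem (word_eval G f ` word_class S R w) = word_eval G f w"
proof -
  have "word_eval G f ` word_class S R w = {word_eval G f w}"
    using word_eval_eq[OF f rel] w by (auto simp: word_class_def intro!: image_eqI[of _ _ w] word_eq.refl)
  then show ?thesis by simp
qed

text \<open>Von Dyck's theorem. Evaluation is constant on classes, so \<open>the_elem\<close> picks
  its only value.\<close>

lemma presented_group_hom:
  assumes f: "f \<in> S \<rightarrow> carrier G"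
    and rel: "\<And>u v. (u, v) \<in> R \<Longrightarrow> word_eval G f u = word_eval G f v"
  shows "(\<lambda>C. the_elem (word_eval G f ` C)) \<in> hom (presented_group S R) G"
  using f by (auto simp: hom_def carrier_presented_group mult_presented_group
      the_elem_word_eval[OF f rel] word_eval_append)

end

lemma generate_presented_group:
  "carrier (presented_group S R) =
    generate (presented_group S R) ((\<lambda>a. word_class S R [(a, True)]) ` S)" (is "_ = generate ?G ?s")
proof
  interpret group ?G by (rule group_presented_group)
  have gen: "word_class S R [(a, b)] \<in> generate ?G ?s" if "a \<in> S" for a b
  proof (cases b)
    case True
    then show ?thesis using that by (auto intro: generate.incl)
  next
    case False
    have "word_class S R [(a, False)] \<otimes>\<^bsub>?G\<^esub> word_class S R [(a, True)] = \<one>\<^bsub>?G\<^esub>"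
      using that word_eq.cancel[of a S R False]
      by (simp add: mult_presented_group one_presented_group word_class_eq_iff)
    then have "inv\<^bsub>?G\<^esub> (word_class S R [(a, True)]) = word_class S R [(a, False)]"
      using that by (intro inv_equality) (auto simp: carrier_presented_group)
    moreover have "inv\<^bsub>?G\<^esub> word_class S R [(a, True)] \<in> generate ?G ?s"
      using that by (intro generate.inv) auto
    ultimately show ?thesis using False by simp
  qed
  have "word_class S R w \<in> generate ?G ?s" if "w \<in> words S" for w
    using that
  proof (induction w)
    case Nil
    then show ?case using generate.one[of ?G ?s] by (simp add: one_presented_group)
  next
    case (Cons x w)
    obtain a b where x: "x = (a, b)" by force
    have "word_class S R [(a, b)] \<otimes>\<^bsub>?G\<^esub> word_class S R w \<in> generate ?G ?s"
      using Cons gen x by (intro generate.eng) auto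
    then show ?case using Cons.prems x by (simp add: mult_presented_group)
  qed
  then show "carrier ?G \<subseteq> generate ?G ?s" by (auto simp: carrier_presented_group)
  show "generate ?G ?s \<subseteq> carrier ?G"
    by (rule generate_incl) (auto simp: carrier_presented_group)
qed

section \<open>Linking numbers\<close>

definition pairs :: "nat \<Rightarrow> nat set set"
  where "pairs n = {P. P \<subseteq> {1..n} \<and> card P = 2}"

text \<open>The semidirect product \<open>\<int>\<^bsup>n(n-1)/2\<^esup> \<rtimes> S\<^sub>n\<close>; the preimage \<open>s -` P\<close> is \<open>s\<^sup>-\<^sup>1 P\<close>. Since a crossing counts \<open>1\<close>, a full
  twist of two strings counts \<open>2\<close>.\<close>

definition linking_group :: "nat \<Rightarrow> ((nat set \<Rightarrow> int) \<times> (nat \<Rightarrow> nat)) monoid"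
  where "linking_group n =
    \<lparr>carrier = {(v, s). s permutes {1..n} \<and> (\<forall>P. P \<notin> pairs n \<longrightarrow> v P = 0)},
     monoid.mult = (\<lambda>(v, s) (w, t). (\<lambda>P. v P + w (s -` P), s \<circ> t)),
     one = (\<lambda>_. 0, id)\<rparr>"

lemma finite_pairs [simp]: "finite (pairs n)"
  by (rule finite_subset[of _ "Pow {1..n}"]) (auto simp: pairs_def)

lemma card_pairs: "card (pairs n) = n * (n - 1) div 2"
  using n_subsets[of "{1..n}" 2] by (simp add: pairs_def choose_two)

text \<open>Permuting coordinates by preimages keeps vectors supported on \<open>pairs n\<close>,
  which is what closes the linking group under products and inverses.\<close>

lemma pairs_vimage:
  assumes "s permutes {1..n}"
  shows "s -` P \<in> pairs n \<longleftrightarrow> P \<in> pairs n"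
proof -
  have "card (s -` P) = card P"
    using card_vimage_inj[of s P] permutes_inj[OF assms] permutes_surj[OF assms] by auto
  moreover have "s -` P \<subseteq> {1..n} \<longleftrightarrow> P \<subseteq> {1..n}"
    using permutes_surj[OF assms] permutes_in_image[OF assms] unfolding subset_iff vimage_eq
    by (metis surjD)
  ultimately show ?thesis by (simp add: pairs_def)
qed

lemma carrier_linking_group:
  "(v, s) \<in> carrier (linking_group n) \<longleftrightarrow> s permutes {1..n} \<and> (\<forall>P. P \<notin> pairs n \<longrightarrow> v P = 0)"
  by (simp add: linking_group_def)

lemma mult_linking_group:
  "(v, s) \<otimes>\<^bsub>linking_group n\<^esub> (w, t) = (\<lambda>P. v P + w (s -` P), s \<circ> t)"
  by (simp add: linking_group_def)

lemma one_linking_group: "\<one>\<^bsub>linking_group n\<^esub> = (\<lambda>_. 0, id)"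
  by (simp add: linking_group_def)

lemma group_linking_group: "group (linking_group n)"
proof (rule groupI)
  fix x assume x: "x \<in> carrier (linking_group n)"
  obtain v s where vs: "x = (v, s)" by force
  have s: "s permutes {1..n}" using x vs by (simp add: carrier_linking_group)
  let ?y = "(\<lambda>P. - v (inv' s -` P), inv' s)"
  have "?y \<in> carrier (linking_group n)"
    using x vs s pairs_vimage[OF permutes_inv[OF s]] by (simp add: carrier_linking_group permutes_inv)
  moreover have "?y \<otimes>\<^bsub>linking_group n\<^esub> x = \<one>\<^bsub>linking_group n\<^esub>"
    using permutes_inv_o[OF s] by (simp add: mult_linking_group one_linking_group vs)
  ultimately show "\<exists>y\<in>carrier (linking_group n). y \<otimes>\<^bsub>linking_group n\<^esub> x = \<one>\<^bsub>linking_group n\<^esub>"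
    by blast
next
  fix x y assume "x \<in> carrier (linking_group n)" "y \<in> carrier (linking_group n)"
  then show "x \<otimes>\<^bsub>linking_group n\<^esub> y \<in> carrier (linking_group n)"
    by (cases x; cases y) (simp add: carrier_linking_group mult_linking_group permutes_compose pairs_vimage)
next
  fix x y z :: "(nat set \<Rightarrow> int) \<times> (nat \<Rightarrow> nat)"
  show "x \<otimes>\<^bsub>linking_group n\<^esub> y \<otimes>\<^bsub>linking_group n\<^esub> z =
      x \<otimes>\<^bsub>linking_group n\<^esub> (y \<otimes>\<^bsub>linking_group n\<^esub> z)"
    by (cases x; cases y; cases z) (simp add: mult_linking_group vimage_comp comp_assoc add.assoc)
next
  show "\<one>\<^bsub>linking_group n\<^esub> \<in> carrier (linking_group n)"
    by (simp add: one_linking_group carrier_linking_group permutes_id)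
next
  fix x :: "(nat set \<Rightarrow> int) \<times> (nat \<Rightarrow> nat)"
  show "\<one>\<^bsub>linking_group n\<^esub> \<otimes>\<^bsub>linking_group n\<^esub> x = x"
    by (cases x) (simp add: mult_linking_group one_linking_group)
qed

section \<open>Injectivity of the linking homomorphism\<close>

text \<open>The normal form argument uses only these properties of the quotient, which
  \<open>braid_quotient_linking\<close> establishes; words and cosets do not reappear. An element is
  pure when its image under \<open>\<Psi>\<close> has trivial permutation.\<close>

locale braid_linking = group Q for Q :: "('q, 'c) monoid_scheme" (structure) +
  fixes n :: nat and s :: "nat \<Rightarrow> 'q" and \<Psi> :: "'q \<Rightarrow> (nat set \<Rightarrow> int) \<times> (nat \<Rightarrow> nat)"
  assumes n: "2 \<le> n"
    and s_closed: "i \<in> {1..<n} \<Longrightarrow> s i \<in> carrier Q"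
    and far_commute: "i \<in> {1..<n} \<Longrightarrow> j \<in> {1..<n} \<Longrightarrow> i + 2 \<le> j \<Longrightarrow> s i \<otimes> s j = s j \<otimes> s i"
    and braid: "i \<in> {1..<n} \<Longrightarrow> Suc i \<in> {1..<n} \<Longrightarrow>
      s i \<otimes> s (Suc i) \<otimes> s i = s (Suc i) \<otimes> s i \<otimes> s (Suc i)"
    and generated: "carrier Q = generate Q (s ` {1..<n})"
    and Psi_hom: "\<Psi> \<in> hom Q (linking_group n)"
    and Psi_s: "i \<in> {1..<n} \<Longrightarrow>
      \<Psi> (s i) = (\<lambda>P. if P = {i, Suc i} then 1 else 0, Transposition.transpose i (Suc i))"
    and pure_commute: "x \<in> carrier Q \<Longrightarrow> y \<in> carrier Q \<Longrightarrow> snd (\<Psi> x) = id \<Longrightarrow> snd (\<Psi> y) = id \<Longrightarrow>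
      x \<otimes> y = y \<otimes> x"
begin

sublocale Psi: group_hom Q "linking_group n" \<Psi>
  by (simp add: group_hom_def group_hom_axioms_def group_linking_group Psi_hom)

lemma mult_inv_cancel [simp]:
  assumes "x \<in> carrier Q" "y \<in> carrier Q"
  shows "x \<otimes> (inv x \<otimes> y) = y" "inv x \<otimes> (x \<otimes> y) = y"
  using assms by (simp_all add: m_assoc[symmetric])

declare Psi.hom_mult [simp del]

definition perm :: "'q \<Rightarrow> nat \<Rightarrow> nat" where "perm x = snd (\<Psi> x)"

lemma Psi_eq: "\<Psi> x = (fst (\<Psi> x), perm x)"
  by (simp add: perm_def)

lemma perm_mult: "x \<in> carrier Q \<Longrightarrow> y \<in> carrier Q \<Longrightarrow> perm (x \<otimes> y) = perm x \<circ> perm y"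
  using Psi.hom_mult[of x y] mult_linking_group[of n "fst (\<Psi> x)" "perm x" "fst (\<Psi> y)" "perm y"]
  by (simp add: perm_def)

lemma fst_Psi_mult:
  assumes "x \<in> carrier Q" "y \<in> carrier Q"
  shows "fst (\<Psi> (x \<otimes> y)) P = fst (\<Psi> x) P + fst (\<Psi> y) (perm x -` P)"
  using Psi.hom_mult[of x y] assms mult_linking_group[of n "fst (\<Psi> x)" "perm x" "fst (\<Psi> y)" "perm y"]
  by (simp add: perm_def)

lemma fst_Psi_mult_pure:
  assumes "x \<in> carrier Q" "y \<in> carrier Q" "perm x = id"
  shows "fst (\<Psi> (x \<otimes> y)) P = fst (\<Psi> x) P + fst (\<Psi> y) P"
  using assms by (simp add: fst_Psi_mult)

lemma perm_one: "perm \<one> = id"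
  using Psi.hom_one by (simp add: perm_def one_linking_group)

lemma perm_permutes: "x \<in> carrier Q \<Longrightarrow> perm x permutes {1..n}"
  using Psi.hom_closed[of x] carrier_linking_group[of "fst (\<Psi> x)" "perm x" n] by (simp add: perm_def)

lemma perm_inv: "x \<in> carrier Q \<Longrightarrow> perm (inv x) = inv' (perm x)"
  by (metis perm_mult perm_one inv_closed l_inv r_inv inv_unique_comp)

lemma perm_s: "i \<in> {1..<n} \<Longrightarrow> perm (s i) = Transposition.transpose i (Suc i)"
  by (simp add: perm_def Psi_s)

text \<open>Adjacent transpositions generate the symmetric group of an interval. Using only the
  generators inside \<open>{a..b}\<close> matters for the stabiliser of \<open>{1, 2}\<close>, where
  \<open>a = 3\<close> yields a lift that commutes with \<open>s 1\<close>.\<close>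

lemma exists_perm:
  assumes p: "p permutes {a..b}" and ab: "1 \<le> a" "b \<le> n"
  shows "\<exists>x\<in>generate Q (s ` {a..<b}). perm x = p"
proof -
  let ?H = "generate Q (s ` {a..<b})"
  have sub: "s ` {a..<b} \<subseteq> carrier Q" using s_closed ab by auto
  have H: "?H \<subseteq> carrier Q" by (rule generate_incl[OF sub])
  have transp: "\<exists>x\<in>?H. perm x = Transposition.transpose i (i + Suc d)"
    if "a \<le> i" "i + Suc d \<le> b" for i d
    using that
  proof (induction d)
    case 0
    then have "s i \<in> ?H" "i \<in> {1..<n}" using ab by (auto intro: generate.incl)
    then show ?case using perm_s by (intro bexI[of _ "s i"]) auto
  next
    case (Suc d)
    let ?j = "i + Suc d"
    have j: "s ?j \<in> ?H" "?j \<in> {1..<n}" using ab Suc.prems by (auto intro: generate.incl)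
    obtain x where x: "x \<in> ?H" "perm x = Transposition.transpose i ?j"
      using Suc by auto
    \<comment> \<open>Conjugation by the next adjacent transposition moves the upper point one step
      further.\<close>
    have "perm (s ?j \<otimes> x \<otimes> s ?j) =
        Transposition.transpose ?j (Suc ?j) \<circ> Transposition.transpose i ?j \<circ> Transposition.transpose ?j (Suc ?j)"
      using x j H s_closed[OF j(2)] perm_s[OF j(2)] by (auto simp: perm_mult)
    also have "\<dots> = Transposition.transpose i (i + Suc (Suc d))"
      by (auto simp: fun_eq_iff Transposition.transpose_def)
    finally show ?case using x j by (intro bexI[of _ "s ?j \<otimes> x \<otimes> s ?j"] generate.eng) auto
  qed
  have transp': "\<exists>x\<in>?H. perm x = Transposition.transpose i j" if "i \<in> {a..b}" "j \<in> {a..b}" "i \<noteq> j" for i j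
  proof (cases "i < j")
    case True
    then obtain d where "j = i + Suc d" using less_imp_Suc_add by auto
    then show ?thesis using transp[of i d] that by auto
  next
    case False
    then have "j < i" using that by simp
    then obtain d where "i = j + Suc d" using less_imp_Suc_add by auto
    then show ?thesis using transp[of j d] that by (auto simp: transpose_commute)
  qed
  show ?thesis using p finite_atLeastAtMost
  proof (induction p rule: permutes_induct)
    case id
    then show ?case using perm_one by (intro bexI[of _ \<one>] generate.one) auto
  next
    case (swap i j p)
    then obtain x y where "x \<in> ?H" "perm x = p" "y \<in> ?H" "perm y = Transposition.transpose i j"
      using transp' by metis
    moreover from this have "perm (y \<otimes> x) = Transposition.transpose i j \<circ> p"
      using H by (subst perm_mult) auto
    ultimately show ?case by (blast intro: generate.eng)
  qed
qed

section \<open>Conjugates of the twist of the first two strings\<close>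

lemma pure_conj:
  assumes "x \<in> carrier Q" "perm x = id" "g \<in> carrier Q" 
  shows "perm (g \<otimes> x \<otimes> inv g) = id"
  using assms permutes_inv_o[OF perm_permutes[OF assms(3)]] by (simp add: perm_mult perm_inv)

text \<open>\<open>inv h \<otimes> g\<close> is pure and therefore commutes with \<open>x\<close>.
  Thus conjugation of pure elements depends on the permutation alone, and any convenient lift of it
  may be used.\<close>

lemma conj_eq:
  assumes x: "x \<in> carrier Q" "perm x = id" and g: "g \<in> carrier Q" "h \<in> carrier Q" "perm g = perm h"
  shows "g \<otimes> x \<otimes> inv g = h \<otimes> x \<otimes> inv h"
proof -
  have "perm (inv h \<otimes> g) = id"
    using g permutes_inv_o[OF perm_permutes[OF g(2)]] by (simp add: perm_mult perm_inv)
  then have "inv h \<otimes> g \<otimes> x = x \<otimes> (inv h \<otimes> g)"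
    using pure_commute[of "inv h \<otimes> g" x] g x by (simp add: perm_def)
  then have "h \<otimes> (inv h \<otimes> g \<otimes> x) \<otimes> inv g = h \<otimes> (x \<otimes> (inv h \<otimes> g)) \<otimes> inv g"
    by simp
  moreover have "h \<otimes> (inv h \<otimes> g \<otimes> x) \<otimes> inv g = g \<otimes> x \<otimes> inv g"
    using g x by (simp add: m_assoc)
  moreover have "h \<otimes> (x \<otimes> (inv h \<otimes> g)) \<otimes> inv g = h \<otimes> x \<otimes> inv h"
    using g x by (simp add: m_assoc)
  ultimately show ?thesis by simp
qed

abbreviation twist :: 'q where "twist \<equiv> s 1 \<otimes> s 1"

lemma s1_closed: "s 1 \<in> carrier Q" and twist_closed: "twist \<in> carrier Q" and perm_twist: "perm twist = id"
  using n s_closed[of 1] perm_s[of 1] by (auto simp: perm_mult)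

text \<open>The stabiliser of \<open>{1, 2}\<close> in \<open>S\<^sub>n\<close> is generated by \<open>s 1\<close> and \<open>s 3, \<dots>, s (n - 1)\<close>, which commute with the twist.\<close>

lemma stabiliser_commutes:
  assumes g: "g \<in> carrier Q" and st: "perm g ` {1, 2} = {1, 2}"
  shows "g \<otimes> twist \<otimes> inv g = twist"
proof -
  \<comment> \<open>By \<open>conj_eq\<close>, \<open>g\<close> may be replaced by a lift of the
    same permutation made from \<open>s 3, ..., s (n - 1)\<close>, each of which commutes with
    \<open>s 1\<close>.\<close>
  have fixing: "g \<otimes> twist \<otimes> inv g = twist"
    if g: "g \<in> carrier Q" and 12: "perm g 1 = 1" "perm g 2 = 2" for g
  proof -
    have "perm g permutes {3..n}"
    proof (rule permutes_superset[OF perm_permutes[OF g]])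
      fix x assume "x \<in> {1..n} - {3..n}"
      then have "x = 1 \<or> x = 2" by auto
      then show "perm g x = x" using 12 by auto
    qed
    then obtain y where y: "y \<in> generate Q (s ` {3..<n})" "perm y = perm g"
      using exists_perm[of "perm g" 3 n] by auto
    have "y \<in> carrier Q \<and> y \<otimes> s 1 = s 1 \<otimes> y"
      using y(1)
    proof (induction rule: generate.induct)
      case one
      then show ?case using s1_closed by simp
    next
      case (incl h)
      then obtain i where "i \<in> {3..<n}" "h = s i" by auto
      then show ?case using far_commute[of 1 i] s_closed[of i] by auto
    next
      case (inv h)
      then obtain i where "i \<in> {3..<n}" "h = s i" by auto
      then have h: "h \<in> carrier Q" "h \<otimes> s 1 = s 1 \<otimes> h" using far_commute[of 1 i] s_closed[of i] by auto
      then show ?case using s1_closed by (metis inv_closed inv_solve_left inv_solve_right m_assoc m_closed)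
    next
      case (eng h1 h2)
      then show ?case using s1_closed by (metis m_assoc m_closed)
    qed
    then have y': "y \<in> carrier Q" "y \<otimes> s 1 = s 1 \<otimes> y" by auto
    have "y \<otimes> twist = twist \<otimes> y"
      using y' s1_closed by (metis m_assoc)
    then have "y \<otimes> twist \<otimes> inv y = twist"
      using y' s1_closed by (simp add: m_assoc inv_solve_right')
    then show ?thesis using conj_eq[OF twist_closed perm_twist g y'(1)] y(2) by simp
  qed
  have ne: "perm g 1 \<noteq> perm g 2"
    using permutes_inj[OF perm_permutes[OF g]] by (metis injD one_eq_numeral_iff semiring_norm(85))
  show ?thesis
  proof (cases "perm g 1 = 1")
    case True
    then have "perm g 2 = 2" using st ne by auto
    then show ?thesis using True fixing[OF g] by blast
  next
    case False
    then have 12: "perm g 1 = 2" "perm g 2 = 1" using st ne by (auto simp: doubleton_eq_iff)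
    \<comment> \<open>When \<open>g\<close> swaps 1 and 2, splitting off a factor \<open>s 1\<close>
      reduces to the case above, and \<open>s 1\<close> commutes with its own square.\<close>
    let ?h = "inv s 1 \<otimes> g"
    have h: "?h \<in> carrier Q" using s1_closed g by simp
    have "perm ?h = Transposition.transpose 1 2 \<circ> perm g"
      using s1_closed g n perm_s[of 1] by (simp add: perm_mult perm_inv numeral_2_eq_2)
    then have "?h \<otimes> twist \<otimes> inv ?h = twist" using fixing[OF h] 12 by simp
    then have "s 1 \<otimes> (?h \<otimes> twist \<otimes> inv ?h) \<otimes> inv s 1 = s 1 \<otimes> twist \<otimes> inv s 1" by simp
    moreover have "s 1 \<otimes> (?h \<otimes> twist \<otimes> inv ?h) \<otimes> inv s 1 = g \<otimes> twist \<otimes> inv g"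
      using s1_closed g by (simp add: m_assoc inv_mult_group)
    moreover have "s 1 \<otimes> twist \<otimes> inv s 1 = twist"
      using s1_closed by (simp add: m_assoc)
    ultimately show ?thesis by simp
  qed
qed

text \<open>\<open>inv h \<otimes> g\<close> stabilises \<open>{1, 2}\<close>, so this is
  \<open>stabiliser_commutes\<close> conjugated by \<open>h\<close>. It makes the choice in
  \<open>full_twist\<close> immaterial.\<close>

lemma twist_conj_eq:
  assumes g: "g \<in> carrier Q" "h \<in> carrier Q" and eq: "perm g ` {1, 2} = perm h ` {1, 2}"
  shows "g \<otimes> twist \<otimes> inv g = h \<otimes> twist \<otimes> inv h"
proof -
  let ?k = "inv h \<otimes> g"
  have "perm ?k ` {1, 2} = inv' (perm h) ` (perm h ` {1, 2})"
    using g by (simp only: perm_mult perm_inv inv_closed image_comp[symmetric] eq)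
  also have "\<dots> = {1, 2}"
    using permutes_inv_o(2)[OF perm_permutes[OF g(2)]] unfolding image_comp by simp
  finally have "?k \<otimes> twist \<otimes> inv ?k = twist" using stabiliser_commutes g by simp
  then have "h \<otimes> (?k \<otimes> twist \<otimes> inv ?k) \<otimes> inv h = h \<otimes> twist \<otimes> inv h" by simp
  moreover have "h \<otimes> (?k \<otimes> twist \<otimes> inv ?k) \<otimes> inv h = g \<otimes> twist \<otimes> inv g"
    using s1_closed g by (simp add: m_assoc inv_mult_group)
  ultimately show ?thesis by simp
qed

text \<open>The class of Artin's pure braid generator for the pair \<open>P\<close>. In the braid
  group the conjugate depends on \<open>g\<close>; here pure elements commute and only
  \<open>P\<close> matters.\<close>

definition full_twist :: "nat set \<Rightarrow> 'q"
  where "full_twist P = (SOME x. \<exists>g\<in>carrier Q. perm g ` {1, 2} = P \<and> x = g \<otimes> twist \<otimes> inv g)"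

lemma full_twist_eq:
  assumes "g \<in> carrier Q"
  shows "full_twist (perm g ` {1, 2}) = g \<otimes> twist \<otimes> inv g"
  unfolding full_twist_def
  by (rule someI2[of _ "g \<otimes> twist \<otimes> inv g"]) (use assms twist_conj_eq in blast)+

lemma pairsE:
  assumes "P \<in> pairs n"
  obtains g where "g \<in> carrier Q" "perm g ` {1, 2} = P"
proof -
  obtain i j where ij: "P = {i, j}" "i \<noteq> j" using assms by (auto simp: pairs_def card_2_iff)
  have ij': "i \<in> {1..n}" "j \<in> {1..n}" using assms ij by (auto simp: pairs_def)
  let ?k = "Transposition.transpose 1 i j"
  \<comment> \<open>The right factor fixes 1, since \<open>?k\<close> differs from 1, and sends 2 to
    \<open>?k\<close>, which the left factor sends to \<open>j\<close>. This also covers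
    \<open>i\<close> or \<open>j\<close> in \<open>{1, 2}\<close>.\<close>
  let ?p = "Transposition.transpose 1 i \<circ> Transposition.transpose 2 ?k"
  have k: "?k \<in> {1..n}" "?k \<noteq> 1" using ij ij' n by (auto simp: Transposition.transpose_def)
  have "?p permutes {1..n}"
    using k ij' n by (intro permutes_compose permutes_swap_id) auto
  moreover have "?p 1 = i" "?p 2 = j" using k by (auto simp: Transposition.transpose_def split: if_splits)
  ultimately obtain g where "g \<in> carrier Q" "perm g = ?p" "perm g ` {1, 2} = P"
    using exists_perm[of ?p 1 n] generated ij(1) by auto
  then show ?thesis using that by blast
qed

lemma image_pairs: "g \<in> carrier Q \<Longrightarrow> perm g ` {1, 2} \<in> pairs n"
proof -
  assume g: "g \<in> carrier Q"
  have p: "perm g permutes {1..n}" by (rule perm_permutes[OF g])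
  have "card (perm g ` {1, 2}) = 2"
    using card_image[OF inj_on_subset[OF permutes_inj[OF p]], of "{1,2}"] by simp
  moreover have "perm g ` {1, 2} \<subseteq> {1..n}"
    using permutes_in_image[OF p] n by auto
  ultimately show ?thesis by (simp add: pairs_def)
qed

lemma full_twist_closed: "P \<in> pairs n \<Longrightarrow> full_twist P \<in> carrier Q"
  and perm_full_twist: "P \<in> pairs n \<Longrightarrow> perm (full_twist P) = id"
  using full_twist_eq pairsE twist_closed perm_twist pure_conj
  by (metis inv_closed m_closed)+

lemma full_twist_conj:
  assumes "P \<in> pairs n" "g \<in> carrier Q"
  shows "g \<otimes> full_twist P \<otimes> inv g = full_twist (perm g ` P)"
proof -
  obtain h where h: "h \<in> carrier Q" "perm h ` {1, 2} = P" using pairsE assms(1) by blast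
  have "perm g ` P = perm (g \<otimes> h) ` {1, 2}"
    using h assms by (simp only: perm_mult image_comp[symmetric])
  then have "full_twist (perm g ` P) = (g \<otimes> h) \<otimes> twist \<otimes> inv (g \<otimes> h)"
    using full_twist_eq[of "g \<otimes> h"] h assms by simp
  then show ?thesis
    using full_twist_eq[OF h(1)] h assms twist_closed s1_closed by (simp add: m_assoc inv_mult_group)
qed

text \<open>The braid relation makes neighbouring generators conjugate:
  \<open>s i \<otimes> s (Suc i)\<close> conjugates \<open>s i\<close> into
  \<open>s (Suc i)\<close>. So the claim spreads from \<open>s 1\<close>, where it is the definition
  of the twist.\<close>

lemma s_sq: "i \<in> {1..<n} \<Longrightarrow> s i \<otimes> s i = full_twist {i, Suc i}"
proof (induction i)
  case (Suc i)
  show ?case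
  proof (cases "i = 0")
    case True
    then show ?thesis using full_twist_eq[of \<one>] s1_closed by (simp add: perm_one numeral_2_eq_2)
  next
    case False
    have i: "i \<in> {1..<n}" using Suc.prems False by auto
    have c: "s i \<in> carrier Q" "s (Suc i) \<in> carrier Q" using s_closed i Suc.prems by auto
    let ?g = "s i \<otimes> s (Suc i)"
    have eq: "?g \<otimes> s i = s (Suc i) \<otimes> ?g"
      using braid[OF i Suc.prems] c by (simp add: m_assoc)
    have "?g \<otimes> (s i \<otimes> s i) = ?g \<otimes> s i \<otimes> s i" using c by (simp add: m_assoc)
    also have "\<dots> = s (Suc i) \<otimes> (?g \<otimes> s i)" using c eq by (metis m_assoc m_closed)
    also have "\<dots> = s (Suc i) \<otimes> s (Suc i) \<otimes> ?g" using c eq by (metis m_assoc m_closed)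
    finally have "?g \<otimes> (s i \<otimes> s i) \<otimes> inv ?g = s (Suc i) \<otimes> s (Suc i)"
      using c by (simp add: inv_solve_right')
    moreover have "{i, Suc i} \<in> pairs n" using i Suc.prems by (auto simp: pairs_def)
    moreover have "perm ?g ` {i, Suc i} = {Suc i, Suc (Suc i)}"
      using c perm_s[OF i] perm_s[OF Suc.prems] by (auto simp: perm_mult Transposition.transpose_def)
    ultimately show ?thesis using full_twist_conj[of "{i, Suc i}" ?g] Suc.IH[OF i] c by simp
  qed
qed simp


section \<open>The normal subgroup generated by the full twists\<close>

definition full_twists :: "'q set" where "full_twists = generate Q (full_twist ` pairs n)"

lemma full_twists_normal: "full_twists \<lhd> Q"
  unfolding full_twists_def
proof (rule normal_generateI)
  show "full_twist ` pairs n \<subseteq> carrier Q" using full_twist_closed by auto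
  fix h g assume h: "h \<in> full_twist ` pairs n" and g: "g \<in> carrier Q"
  then obtain P where P: "P \<in> pairs n" "h = full_twist P" by auto
  obtain k where k: "k \<in> carrier Q" "perm k ` {1, 2} = P" using pairsE P(1) by blast
  have "perm g ` P = perm (g \<otimes> k) ` {1, 2}"
    using k g by (simp only: perm_mult image_comp[symmetric])
  then have "perm g ` P \<in> pairs n" using image_pairs[of "g \<otimes> k"] g k by simp
  then show "g \<otimes> h \<otimes> inv g \<in> full_twist ` pairs n"
    using full_twist_conj[OF P(1) g] P(2) by auto
qed

lemma full_twists_subset: "full_twists \<subseteq> carrier Q"
  by (rule subgroup.subset[OF normal_imp_subgroup[OF full_twists_normal]])

lemma full_twists_conj: "a \<in> full_twists \<Longrightarrow> g \<in> carrier Q \<Longrightarrow> g \<otimes> a \<otimes> inv g \<in> full_twists"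
  by (rule normal.inv_op_closed2[OF full_twists_normal])

lemma full_twists_mult: "a \<in> full_twists \<Longrightarrow> b \<in> full_twists \<Longrightarrow> a \<otimes> b \<in> full_twists"
  unfolding full_twists_def by (rule generate.eng)

lemma perm_full_twists: "x \<in> full_twists \<Longrightarrow> perm x = id"
  unfolding full_twists_def
proof (induction rule: generate.induct)
  case one
  then show ?case by (rule perm_one)
next
  case (incl h)
  then show ?case using perm_full_twist by auto
next
  case (inv h)
  then show ?case using perm_full_twist full_twist_closed by (auto simp: perm_inv)
next
  case (eng h1 h2)
  then have "h1 \<in> carrier Q" "h2 \<in> carrier Q"
    using full_twists_subset by (auto simp: full_twists_def)
  then show ?case using eng by (simp add: perm_mult)
qed

text \<open>The run \<open>s k \<otimes> s (k - 1) \<otimes> ...\<close> with \<open>d\<close>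
  factors, the last one being \<open>s (k - d + 1)\<close>. The permutations of the runs with
  \<open>d \<le> k\<close> represent the cosets of the symmetric group of \<open>{1..k}\<close> in
  that of \<open>{1..k + 1}\<close>.\<close>

fun desc :: "nat \<Rightarrow> nat \<Rightarrow> 'q" where
  "desc k 0 = \<one>"
| "desc k (Suc d) = desc k d \<otimes> s (k - d)"

lemma desc_closed: "d \<le> k \<Longrightarrow> k < n \<Longrightarrow> desc k d \<in> carrier Q"
  by (induction d) (auto intro!: m_closed s_closed)

lemma desc_commute_low:
  "d \<le> k \<Longrightarrow> k < n \<Longrightarrow> i \<in> {1..<k - d} \<Longrightarrow> desc k d \<otimes> s i = s i \<otimes> desc k d"
proof (induction d)
  case 0
  then show ?case using s_closed[of i] by simp
next
  case (Suc d)
  have c: "desc k d \<in> carrier Q" "s i \<in> carrier Q" "s (k - d) \<in> carrier Q"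
    using Suc.prems by (auto intro!: desc_closed s_closed)
  have "s i \<otimes> s (k - d) = s (k - d) \<otimes> s i"
    using Suc.prems by (intro far_commute) auto
  moreover have "desc k d \<otimes> s i = s i \<otimes> desc k d"
    using Suc by auto
  ultimately show ?case using c by (simp) (metis m_assoc)
qed

text \<open>The letter commutes past the tail of the run, one braid relation at the neighbours
  \<open>s i\<close> and \<open>s (i - 1)\<close> lowers its index, and the lowered letter commutes
  past the rest.\<close>

lemma desc_shift:
  "d \<le> k \<Longrightarrow> k < n \<Longrightarrow> k + 1 < i + d \<Longrightarrow> i \<le> k \<Longrightarrow> desc k d \<otimes> s i = s (i - 1) \<otimes> desc k d"
proof (induction d)
  case (Suc d)
  have c: "desc k d \<in> carrier Q" "s i \<in> carrier Q" "s (k - d) \<in> carrier Q" "s (i - 1) \<in> carrier Q"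
    using Suc.prems by (auto intro!: desc_closed s_closed)
  show ?case
  proof (cases "i = k - d + 1")
    case False
    have "s (k - d) \<otimes> s i = s i \<otimes> s (k - d)"
      using Suc.prems False by (intro far_commute) auto
    moreover have "desc k d \<otimes> s i = s (i - 1) \<otimes> desc k d"
      using Suc False by auto
    ultimately show ?thesis using c by simp (metis m_assoc)
  next
    case True
    then obtain e where d: "d = Suc e" using Suc.prems by (cases d) auto
    let ?j = "k - d"
    have i: "i = Suc ?j" "k - e = Suc ?j" using True d Suc.prems by auto
    have j: "?j \<in> {1..<n}" "Suc ?j \<in> {1..<n}" using Suc.prems i by auto
    have ce: "desc k e \<in> carrier Q" using Suc.prems d by (intro desc_closed) auto
    have comm: "desc k e \<otimes> s ?j = s ?j \<otimes> desc k e"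
      using Suc.prems d i j by (intro desc_commute_low) auto
    have cj: "s ?j \<in> carrier Q" "s (Suc ?j) \<in> carrier Q" using s_closed j by auto
    have "desc k (Suc d) \<otimes> s i = desc k e \<otimes> (s (Suc ?j) \<otimes> s ?j \<otimes> s (Suc ?j))"
      using d i ce cj by (simp add: m_assoc)
    also have "\<dots> = desc k e \<otimes> s ?j \<otimes> (s (Suc ?j) \<otimes> s ?j)"
      using braid[OF j] ce cj by (simp add: m_assoc)
    also have "\<dots> = s (i - 1) \<otimes> desc k (Suc d)"
      unfolding comm using d i ce cj by (simp add: m_assoc)
    finally show ?thesis .
  qed
qed simp

lemma perm_desc: "d \<le> k \<Longrightarrow> k < n \<Longrightarrow> perm (desc k d) (k + 1 - d) = k + 1"
proof (induction d)
  case (Suc d)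
  then have "desc k d \<in> carrier Q" "s (k - d) \<in> carrier Q"
    by (auto intro!: desc_closed s_closed)
  moreover have "perm (s (k - d)) (k - d) = k + 1 - d"
    using Suc.prems by (subst perm_s) auto
  ultimately show ?case using Suc by (simp add: perm_mult)
qed (simp add: perm_one)

text \<open>The Coxeter normal form: every element of the subgroup generated by \<open>s 1, \<dots>, s k\<close> and the full
  twists is a product of the latter and of descending runs \<open>s j \<cdots> s (j - d + 1)\<close>, \<open>j = 1, \<dots>, k\<close>.\<close>

fun normal_forms :: "nat \<Rightarrow> 'q set" where
  "normal_forms 0 = full_twists"
| "normal_forms (Suc k) = {h \<otimes> desc (Suc k) d | h d. h \<in> normal_forms k \<and> d \<le> Suc k}"

lemma normal_forms_closed: "k < n \<Longrightarrow> normal_forms k \<subseteq> carrier Q"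
proof (induction k)
  case (Suc k)
  then show ?case using desc_closed by auto
qed (use full_twists_subset in auto)

lemma normal_forms_lmult:
  "k < n \<Longrightarrow> a \<in> full_twists \<Longrightarrow> x \<in> normal_forms k \<Longrightarrow> a \<otimes> x \<in> normal_forms k"
proof (induction k arbitrary: x)
  case (Suc k)
  then obtain h d where x: "x = h \<otimes> desc (Suc k) d" "h \<in> normal_forms k" "d \<le> Suc k" by auto
  then have "a \<otimes> x = (a \<otimes> h) \<otimes> desc (Suc k) d"
    using Suc.prems(1,2) normal_forms_closed[of k] full_twists_subset desc_closed[of d "Suc k"]
    by (simp add: m_assoc subset_iff)
  moreover have "a \<otimes> h \<in> normal_forms k" using Suc x by auto
  ultimately show ?case using x by auto
qed (auto intro: full_twists_mult)

text \<open>Normality carries a full twist from the right end to the left end, where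
  \<open>normal_forms_lmult\<close> absorbs it.\<close>

lemma normal_forms_rmult:
  assumes "k < n" "a \<in> full_twists" "x \<in> normal_forms k"
  shows "x \<otimes> a \<in> normal_forms k"
proof -
  have c: "x \<in> carrier Q" "a \<in> carrier Q"
    using assms normal_forms_closed full_twists_subset by auto
  have "x \<otimes> a = (x \<otimes> a \<otimes> inv x) \<otimes> x" using c by (simp add: m_assoc)
  then show ?thesis using normal_forms_lmult[OF assms(1) full_twists_conj[OF assms(2) c(1)] assms(3)] by simp
qed

lemma normal_forms_s:
  "k < n \<Longrightarrow> i \<in> {1..k} \<Longrightarrow> x \<in> normal_forms k \<Longrightarrow> x \<otimes> s i \<in> normal_forms k"
proof (induction k arbitrary: x i)
  case (Suc k)
  then obtain h d where x: "x = h \<otimes> desc (Suc k) d" "h \<in> normal_forms k" "d \<le> Suc k" by auto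
  have c: "h \<in> carrier Q" "s i \<in> carrier Q" "desc (Suc k) d \<in> carrier Q"
    using x Suc.prems normal_forms_closed[of k] s_closed[of i] desc_closed[of d "Suc k"] by auto
  \<comment> \<open>The new letter extends the run; or repeats its last letter, which leaves a
    square, that is, a full twist; or lies below the run and commutes with it; or lies inside and
    passes through with its index lowered. In the last two cases it joins \<open>h\<close>, where
    the induction hypothesis applies.\<close>
  consider "i = Suc k - d" "d \<le> k" | "i + d = Suc (Suc k)" | "i < Suc k - d" | "Suc k + 1 < i + d"
    using Suc.prems x(3) by fastforce
  then show ?case
  proof cases
    case 1
    then have "x \<otimes> s i = h \<otimes> desc (Suc k) (Suc d)"
      using c by (simp add: x(1) m_assoc)
    then show ?thesis using x(2) 1(2) unfolding normal_forms.simps by (intro CollectI) (metis Suc_le_mono)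
  next
    case 2
    then obtain e where e: "d = Suc e" using Suc.prems by (cases d) auto
    then have i: "Suc k - e = i" "e \<le> Suc k" using 2 by auto
    have ce: "desc (Suc k) e \<in> carrier Q" using i Suc.prems by (intro desc_closed) auto
    have "x \<otimes> s i = (h \<otimes> desc (Suc k) e) \<otimes> (s i \<otimes> s i)"
      using c ce i by (simp add: x(1) e m_assoc)
    moreover have "s i \<otimes> s i \<in> full_twists"
      using Suc.prems s_sq[of i] unfolding full_twists_def
      by (auto intro!: generate.incl simp: pairs_def)
    moreover have "h \<otimes> desc (Suc k) e \<in> normal_forms (Suc k)" using x i by auto
    ultimately show ?thesis using normal_forms_rmult Suc.prems(1) by metis
  next
    case 3
    then have "desc (Suc k) d \<otimes> s i = s i \<otimes> desc (Suc k) d"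
      using Suc.prems x(3) by (intro desc_commute_low) auto
    then have "x \<otimes> s i = (h \<otimes> s i) \<otimes> desc (Suc k) d" using c by (simp add: x(1) m_assoc)
    moreover have "h \<otimes> s i \<in> normal_forms k"
      using 3 Suc.prems x by (intro Suc.IH) auto
    ultimately show ?thesis using x by auto
  next
    case 4
    then have "desc (Suc k) d \<otimes> s i = s (i - 1) \<otimes> desc (Suc k) d"
      using Suc.prems x(3) by (intro desc_shift) auto
    moreover have "s (i - 1) \<in> carrier Q" using 4 x(3) Suc.prems by (intro s_closed) auto
    ultimately have "x \<otimes> s i = (h \<otimes> s (i - 1)) \<otimes> desc (Suc k) d" using c by (simp add: x(1) m_assoc)
    moreover have "h \<otimes> s (i - 1) \<in> normal_forms k"
      using 4 Suc.prems x by (intro Suc.IH) auto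
    ultimately show ?thesis using x by auto
  qed
qed simp

lemma one_normal_forms: "\<one> \<in> normal_forms k"
proof (induction k)
  case 0
  then show ?case by (simp add: full_twists_def generate.one)
next
  case (Suc k)
  then have "\<one> \<otimes> desc (Suc k) 0 \<in> normal_forms (Suc k)" unfolding normal_forms.simps by blast
  then show ?case by simp
qed

lemma in_normal_forms:
  assumes "x \<in> carrier Q"
  shows "x \<in> normal_forms (n - 1)"
proof -
  have k: "n - 1 < n" using n by simp
  \<comment> \<open>Closure under right multiplication is what survives induction over generated
    elements; membership is its instance at \<open>\<one>\<close>.\<close>
  have "\<forall>y\<in>normal_forms (n - 1). y \<otimes> x \<in> normal_forms (n - 1)"
    using assms unfolding generated
  proof (induction rule: generate.induct)
    case one
    then show ?case using normal_forms_closed[OF k] by auto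
  next
    case (incl h)
    then show ?case using normal_forms_s[OF k] by auto
  next
    case (inv h)
    then obtain i where "i \<in> {1..<n}" "h = s i" by auto
    then have i: "i \<in> {1..n - 1}" "h = s i" by auto
    have c: "s i \<in> carrier Q" using i by (intro s_closed) auto
    \<comment> \<open>An inverse generator equals the generator times an inverse full twist, so it
      needs no case analysis of its own.\<close>
    have sq: "inv (s i \<otimes> s i) \<in> full_twists"
      using i s_sq[of i] unfolding full_twists_def
      by (auto intro!: generate.inv simp: pairs_def)
    show ?case
    proof
      fix y assume y: "y \<in> normal_forms (n - 1)"
      then have "(y \<otimes> inv (s i \<otimes> s i)) \<otimes> s i \<in> normal_forms (n - 1)"
        using normal_forms_rmult[OF k sq] normal_forms_s[OF k i(1)] by blast
      moreover have "(y \<otimes> inv (s i \<otimes> s i)) \<otimes> s i = y \<otimes> inv s i"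
        using y c normal_forms_closed[OF k] by (auto simp: m_assoc inv_mult_group)
      ultimately show "y \<otimes> inv h \<in> normal_forms (n - 1)" using i by simp
    qed
  next
    case (eng h1 h2)
    then have "h1 \<in> carrier Q" "h2 \<in> carrier Q" by (simp_all add: generated)
    then show ?case using eng normal_forms_closed[OF k] by (auto simp: m_assoc[symmetric])
  qed
  then show ?thesis using one_normal_forms[of "n - 1"] assms by fastforce
qed

lemma normal_forms_fix: "k < n \<Longrightarrow> x \<in> normal_forms k \<Longrightarrow> k + 1 < i \<Longrightarrow> perm x i = i"
proof (induction k arbitrary: x)
  case 0
  then show ?case by (simp add: perm_full_twists)
next
  case (Suc k)
  then obtain h d where x: "x = h \<otimes> desc (Suc k) d" "h \<in> normal_forms k" "d \<le> Suc k" by auto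
  have desc_fix: "perm (desc (Suc k) e) i = i" if "e \<le> Suc k" for e
    using that
  proof (induction e)
    case 0
    then show ?case by (simp add: perm_one)
  next
    case (Suc e)
    have "Suc k - e \<in> {1..<n}" "Suc (Suc k - e) < i" using Suc.prems \<open>Suc k < n\<close> \<open>Suc k + 1 < i\<close> by auto
    then have "perm (s (Suc k - e)) i = i" using perm_s[of "Suc k - e"] by simp
    then show ?case using Suc desc_closed[of e "Suc k"] \<open>Suc k < n\<close> s_closed[OF \<open>Suc k - e \<in> {1..<n}\<close>]
      by (simp add: perm_mult)
  qed
  have "h \<in> carrier Q" "desc (Suc k) d \<in> carrier Q"
    using x Suc.prems normal_forms_closed[of k] desc_closed[of d "Suc k"] by auto
  then show ?case using x Suc desc_fix[of d] by (simp add: perm_mult)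
qed

text \<open>The last run carries the point \<open>Suc k + 1 - d\<close> to \<open>Suc k + 1\<close>,
  which \<open>h\<close> fixes. For a pure product this forces \<open>d = 0\<close>, so the runs
  disappear one after the other and only the full twists remain.\<close>

lemma pure_normal_forms: "k < n \<Longrightarrow> x \<in> normal_forms k \<Longrightarrow> perm x = id \<Longrightarrow> x \<in> full_twists"
proof (induction k arbitrary: x)
  case (Suc k)
  then obtain h d where x: "x = h \<otimes> desc (Suc k) d" "h \<in> normal_forms k" "d \<le> Suc k" by auto
  have c: "h \<in> carrier Q" "desc (Suc k) d \<in> carrier Q"
    using x Suc.prems normal_forms_closed[of k] desc_closed[of d "Suc k"] by auto
  have "perm x (Suc k + 1 - d) = perm h (Suc k + 1)"
    using perm_desc[OF x(3)] Suc.prems c x(1) by (simp add: perm_mult)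
  also have "\<dots> = Suc k + 1"
    using normal_forms_fix[OF _ x(2)] Suc.prems by simp
  finally have "d = 0" using Suc.prems x(3) by simp
  then have "x = h" using x c by simp
  then show ?case using Suc x by simp
qed simp

lemma pure_in_full_twists: "x \<in> carrier Q \<Longrightarrow> perm x = id \<Longrightarrow> x \<in> full_twists"
  using pure_normal_forms[of "n - 1" x] in_normal_forms[of x] n by simp

lemma fst_Psi_full_twist:
  assumes "P \<in> pairs n"
  shows "fst (\<Psi> (full_twist P)) R = (if R = P then 2 else 0)"
proof -
  obtain g where g: "g \<in> carrier Q" "perm g ` {1, 2} = P" using pairsE assms by blast
  \<comment> \<open>Comparing coordinates in this form cancels the contribution of \<open>g\<close>
    without evaluating \<open>\<Psi>\<close> at an inverse.\<close>
  have ft: "full_twist P \<otimes> g = g \<otimes> twist"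
    using full_twist_eq[OF g(1)] g s1_closed by (simp add: m_assoc)
  have "fst (\<Psi> (full_twist P)) R + fst (\<Psi> g) R = fst (\<Psi> (full_twist P \<otimes> g)) R"
    using assms g full_twist_closed perm_full_twist by (simp add: fst_Psi_mult_pure)
  also have "\<dots> = fst (\<Psi> g) R + fst (\<Psi> twist) (perm g -` R)"
    unfolding ft using g s1_closed by (simp add: fst_Psi_mult)
  also have "fst (\<Psi> twist) T = (if T = {1, 2} then 2 else 0)" for T
  proof -
    have 1: "1 \<in> {1..<n}" using n by simp
    have b: "bij (Transposition.transpose 1 (2 :: nat))" by simp
    have "Transposition.transpose 1 2 -` T = {1, 2} \<longleftrightarrow> T = {1, 2::nat}"
      using inj_vimage_image_eq[OF bij_is_inj[OF b], of "{1, 2}"] surj_image_vimage_eq[OF bij_is_surj[OF b], of T]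
      by (metis doubleton_eq_iff image_insert image_empty transpose_apply_first transpose_apply_second)
    then show ?thesis
      using fst_Psi_mult[OF s1_closed s1_closed, of T] perm_s[OF 1] Psi_s[OF 1]
      by (simp add: numeral_2_eq_2)
  qed
  also have "perm g -` R = {1, 2} \<longleftrightarrow> R = P"
    using permutes_bij[OF perm_permutes[OF g(1)]] g(2)
    by (metis bij_betw_def inj_vimage_image_eq surj_image_vimage_eq)
  finally show ?thesis by simp
qed

section \<open>Coordinates on the abelian group of pure elements\<close>

definition pure_group :: "('q, 'c) monoid_scheme"
  where "pure_group = Q\<lparr>carrier := {x \<in> carrier Q. perm x = id}\<rparr>"

lemma mem_pures: "x \<in> carrier pure_group \<longleftrightarrow> x \<in> carrier Q \<and> perm x = id"
  by (simp add: pure_group_def)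

lemma pure_group_simps [simp]: "monoid.mult pure_group = monoid.mult Q" "one pure_group = \<one>"
  by (simp_all add: pure_group_def)

lemma comm_group_pure: "comm_group pure_group"
proof -
  have "carrier pure_group \<noteq> {}" using perm_one mem_pures[of \<one>] by auto
  then have "subgroup (carrier pure_group) Q"
    by (intro subgroupI) (auto simp: mem_pures perm_mult perm_inv)
  then have "group (Q\<lparr>carrier := carrier pure_group\<rparr>)" by (rule subgroup_imp_group)
  then have "group pure_group" by (simp add: pure_group_def)
  then show ?thesis
    by (rule group.group_comm_groupI) (simp add: pure_commute perm_def mem_pures)
qed

lemma linking_hom: "(\<lambda>x. fst (\<Psi> x) R) \<in> hom pure_group integer_group"
  by (simp add: hom_def mem_pures fst_Psi_mult_pure)

text \<open>Everything is read off from the products \<open>T v\<close> of powers of full twists.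
  They exhaust the pure elements because the full twists generate, and their coordinates are
  \<open>2 * v\<close>, so \<open>v\<close> is determined on the pairs: this is the linear
  independence of the full twists.\<close>

lemma exists_pure:
  shows "(\<And>P. P \<notin> pairs n \<Longrightarrow> v P = 0) \<Longrightarrow> \<exists>x\<in>carrier Q. \<Psi> x = (\<lambda>P. 2 * v P, id)"
    and "x \<in> carrier Q \<Longrightarrow> perm x = id \<Longrightarrow> \<exists>v. (\<forall>P. P \<notin> pairs n \<longrightarrow> v P = 0) \<and> \<Psi> x = (\<lambda>P. 2 * v P, id)"
    and "x \<in> carrier Q \<Longrightarrow> \<Psi> x = \<one>\<^bsub>linking_group n\<^esub> \<Longrightarrow> x = \<one>"
proof -
  interpret C: comm_group pure_group by (rule comm_group_pure)
  define T where "T v = finprod pure_group (\<lambda>P. full_twist P [^]\<^bsub>pure_group\<^esub> (v P :: int)) (pairs n)" for v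
  have ft: "full_twist P \<in> carrier pure_group" if "P \<in> pairs n" for P
    using that full_twist_closed perm_full_twist by (simp add: mem_pures)
  have pow: "full_twist P [^]\<^bsub>pure_group\<^esub> (k :: int) \<in> carrier pure_group" if "P \<in> pairs n" for P k
    using ft[OF that] by (rule C.int_pow_closed)
  have T_closed: "T v \<in> carrier pure_group" for v
    unfolding T_def by (rule C.finprod_closed) (use pow in auto)
  have lk_pow: "fst (\<Psi> (x [^]\<^bsub>pure_group\<^esub> (k :: int))) R = k * fst (\<Psi> x) R" if "x \<in> carrier pure_group" for x k R
  proof -
    interpret h: group_hom pure_group integer_group "\<lambda>x. fst (\<Psi> x) R"
      by (simp add: group_hom_def group_hom_axioms_def linking_hom C.is_group)
    show ?thesis using h.hom_int_pow[OF that, of k] by simp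
  qed
  have lk_prod: "fst (\<Psi> (finprod pure_group f F)) R = (\<Sum>P\<in>F. fst (\<Psi> (f P)) R)"
    if "finite F" "f \<in> F \<rightarrow> carrier pure_group" for f F R
    using that
  proof (induction F rule: finite_induct)
    case empty
    then show ?case using Psi.hom_one by (simp add: one_linking_group)
  next
    case (insert P F)
    have c: "finprod pure_group f F \<in> carrier pure_group" "f P \<in> carrier pure_group"
      using insert.prems C.finprod_closed[of f F] by auto
    have "finprod pure_group f (insert P F) = f P \<otimes> finprod pure_group f F"
      using C.finprod_insert[OF insert.hyps, of f] insert.prems by simp
    then show ?case
      using c insert by (simp add: mem_pures fst_Psi_mult_pure)
  qed
  have lk_T: "fst (\<Psi> (T v)) R = (if R \<in> pairs n then 2 * v R else 0)" for v R
  proof -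
    have "fst (\<Psi> (T v)) R = (\<Sum>P\<in>pairs n. fst (\<Psi> (full_twist P [^]\<^bsub>pure_group\<^esub> v P)) R)"
      unfolding T_def by (rule lk_prod) (use pow in auto)
    also have "\<dots> = (\<Sum>P\<in>pairs n. if R = P then 2 * v R else 0)"
    proof (rule sum.cong)
      fix P assume P: "P \<in> pairs n"
      show "fst (\<Psi> (full_twist P [^]\<^bsub>pure_group\<^esub> v P)) R = (if R = P then 2 * v R else 0)"
        unfolding lk_pow[OF ft[OF P]] fst_Psi_full_twist[OF P] by simp
    qed simp
    finally show ?thesis by simp
  qed
  have single: "T (\<lambda>R. if P = R then k else 0) = full_twist P [^]\<^bsub>pure_group\<^esub> k" if "P \<in> pairs n" for P k
  proof -
    have "T (\<lambda>R. if P = R then k else 0) = finprod pure_group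
        (\<lambda>R. if P = R then full_twist R [^]\<^bsub>pure_group\<^esub> k else \<one>\<^bsub>pure_group\<^esub>) (pairs n)"
      unfolding T_def by (rule C.finprod_cong) (use pow in \<open>auto simp: simp_implies_def mem_pures perm_one\<close>)
    also have "\<dots> = full_twist P [^]\<^bsub>pure_group\<^esub> k"
      by (rule C.finprod_singleton) (use that pow in auto)
    finally show ?thesis .
  qed
  have T_surj: "\<exists>v. x = T v" if "x \<in> full_twists" for x
    using that unfolding full_twists_def
  proof (induction rule: generate.induct)
    case one
    have "T (\<lambda>_. 0) = \<one>\<^bsub>pure_group\<^esub>"
      unfolding T_def by (rule C.finprod_one_eqI) simp
    then have "\<one> = T (\<lambda>_. 0)" by simp
    then show ?case by blast
  next
    case (incl h)
    then obtain P where P: "P \<in> pairs n" "h = full_twist P" by auto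
    then have "h = T (\<lambda>R. if P = R then 1 else 0)"
      using single[OF P(1), of 1] C.int_pow_1[OF ft[OF P(1)]] by simp
    then show ?case by blast
  next
    case (inv h)
    then obtain P where P: "P \<in> pairs n" "h = full_twist P" by auto
    have "inv h = T (\<lambda>R. if P = R then - 1 else 0)"
    proof (rule inv_equality)
      have "T (\<lambda>R. if P = R then - 1 else 0) = inv\<^bsub>pure_group\<^esub> h"
        using single[OF P(1), of "- 1"] ft[OF P(1)] P(2) C.int_pow_neg[OF ft[OF P(1)], of 1]
          C.int_pow_1[OF ft[OF P(1)]] by simp
      then show "T (\<lambda>R. if P = R then - 1 else 0) \<otimes> h = \<one>"
        using C.l_inv[OF ft[OF P(1)]] P(2) by simp
    qed (use ft[OF P(1)] P(2) T_closed in \<open>auto simp: mem_pures\<close>)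
    then show ?case by blast
  next
    case (eng x y)
    then obtain v w where vw: "x = T v" "y = T w" by blast
    have "T (\<lambda>R. v R + w R) = finprod pure_group
        (\<lambda>P. full_twist P [^]\<^bsub>pure_group\<^esub> v P \<otimes>\<^bsub>pure_group\<^esub> full_twist P [^]\<^bsub>pure_group\<^esub> w P) (pairs n)"
      unfolding T_def
      by (rule C.finprod_cong) (use ft pow C.int_pow_mult in \<open>auto simp: simp_implies_def\<close>)
    also have "\<dots> = T v \<otimes>\<^bsub>pure_group\<^esub> T w"
      unfolding T_def by (rule C.finprod_multf) (use pow in auto)
    finally have "x \<otimes> y = T (\<lambda>R. v R + w R)" using vw by simp
    then show ?case by blast
  qed
  have Psi_T: "\<Psi> (T v) = (\<lambda>P. if P \<in> pairs n then 2 * v P else 0, id)" for v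
    using T_closed[of v] lk_T[of v] by (subst Psi_eq) (simp add: mem_pures fun_eq_iff)
  show "\<exists>x\<in>carrier Q. \<Psi> x = (\<lambda>P. 2 * v P, id)" if "\<And>P. P \<notin> pairs n \<Longrightarrow> v P = 0" for v
  proof
    show "\<Psi> (T v) = (\<lambda>P. 2 * v P, id)" using that by (simp add: Psi_T fun_eq_iff)
    show "T v \<in> carrier Q" using T_closed[of v] by (simp add: mem_pures)
  qed
  show "\<exists>v. (\<forall>P. P \<notin> pairs n \<longrightarrow> v P = 0) \<and> \<Psi> x = (\<lambda>P. 2 * v P, id)"
    if x: "x \<in> carrier Q" "perm x = id" for x
  proof -
    obtain v where "x = T v" using T_surj pure_in_full_twists x by blast
    \<comment> \<open>\<open>T\<close> reads \<open>v\<close> on the pairs only, so the witness is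
      \<open>v\<close> truncated to zero elsewhere.\<close>
    then show ?thesis
      by (intro exI[of _ "\<lambda>P. if P \<in> pairs n then v P else 0"]) (simp add: Psi_T fun_eq_iff)
  qed
  show "x = \<one>" if x: "x \<in> carrier Q" "\<Psi> x = \<one>\<^bsub>linking_group n\<^esub>" for x
  proof -
    have "perm x = id" using x(2) by (simp add: perm_def one_linking_group)
    then obtain v where v: "x = T v" using T_surj pure_in_full_twists x by blast
    then have "v P = 0" if "P \<in> pairs n" for P
      using x(2) that fun_cong[of _ _ P] by (fastforce simp: v Psi_T one_linking_group)
    then have "T v = \<one>\<^bsub>pure_group\<^esub>"
      unfolding T_def by (intro C.finprod_one_eqI) simp
    then show ?thesis using v by simp
  qed
qed

lemma Psi_inj: "inj_on \<Psi> (carrier Q)"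
proof (subst Psi.inj_iff_trivial_ker)
  show "kernel Q (linking_group n) \<Psi> = {\<one>}"
    using exists_pure(3) by (auto simp: kernel_def)
qed

text \<open>Two strings cross an odd number of times exactly when they exchange their order; both
  sides are additive modulo 2 along products. It yields even coordinates at pairs whose two points
  are fixed.\<close>

lemma odd_linking_iff:
  assumes "x \<in> carrier Q" "i \<noteq> j"
  shows "odd (fst (\<Psi> x) {i, j}) \<longleftrightarrow> (i < j) \<noteq> (inv' (perm x) i < inv' (perm x) j)"
  using assms unfolding generated
proof (induction arbitrary: i j rule: generate.induct)
  case one
  then show ?case using Psi.hom_one by (simp add: perm_one one_linking_group)
next
  case (incl h)
  then obtain k where k: "k \<in> {1..<n}" "h = s k" by auto
  have "inv' (perm h) = Transposition.transpose k (Suc k)" using k by (simp add: perm_s inv_swap_id)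
  then show ?case using incl(2) k
    by (auto simp: Psi_s doubleton_eq_iff Transposition.transpose_def)
next
  case (inv h)
  then obtain k where k: "k \<in> {1..<n}" "h = s k" by auto
  have c: "h \<in> carrier Q" using k s_closed by simp
  have p: "perm h permutes {1..n}" "perm h = Transposition.transpose k (Suc k)"
    using perm_permutes[OF c] perm_s k by auto
  \<comment> \<open>The coordinates of \<open>inv h\<close> follow from those of
    \<open>h \<otimes> inv h\<close>, which vanish.\<close>
  have "fst (\<Psi> (h \<otimes> inv h)) {i, j} = fst (\<Psi> h) {i, j} + fst (\<Psi> (inv h)) (perm h -` {i, j})" for i j
    using c by (simp only: fst_Psi_mult inv_closed)
  moreover have "fst (\<Psi> (h \<otimes> inv h)) {i, j} = 0" for i j
    using c Psi.hom_one by (simp add: one_linking_group)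
  ultimately have "fst (\<Psi> (inv h)) (perm h -` {i, j}) = - fst (\<Psi> h) {i, j}" for i j
    by (metis add_eq_0_iff)
  moreover have "perm h -` {perm h i, perm h j} = {i, j}"
    using inj_vimage_image_eq[OF permutes_inj[OF p(1)], of "{i, j}"] by simp
  ultimately have eq: "fst (\<Psi> (inv h)) {i, j} = - fst (\<Psi> h) {perm h i, perm h j}"
    by metis
  have "inv' (perm (inv h)) = Transposition.transpose k (Suc k)"
    using c p by (simp add: perm_inv inv_swap_id)
  then show ?case
    unfolding eq p(2) using inv(2) k
    by (auto simp: Psi_s doubleton_eq_iff Transposition.transpose_def)
next
  case (eng x y)
  have c: "x \<in> carrier Q" "y \<in> carrier Q" using eng by (simp_all add: generated)
  have p: "perm x permutes {1..n}" "perm y permutes {1..n}" using c perm_permutes by auto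
  have "perm x -` {i, j} = {inv' (perm x) i, inv' (perm x) j}"
    using bij_vimage_eq_inv_image[OF permutes_bij[OF p(1)], of "{i, j}"] by simp
  moreover have "inv' (perm x) i \<noteq> inv' (perm x) j"
    using permutes_inj[OF permutes_inv[OF p(1)]] eng.prems by (meson injD)
  moreover have "inv' (perm (x \<otimes> y)) = inv' (perm y) \<circ> inv' (perm x)"
    using c p by (simp add: perm_mult o_inv_distrib permutes_bij)
  ultimately show ?case
    using eng c by (auto simp: fst_Psi_mult)
qed

end

section \<open>The braid group modulo the commutators of pure braids\<close>

definition crossing :: "nat \<Rightarrow> (nat set \<Rightarrow> int) \<times> (nat \<Rightarrow> nat)"
  where "crossing i = (\<lambda>P. if P = {i, Suc i} then 1 else 0, Transposition.transpose i (Suc i))"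

lemma crossing_closed: "crossing \<in> {1..<n} \<rightarrow> carrier (linking_group n)"
  by (auto simp: crossing_def carrier_linking_group pairs_def intro!: permutes_swap_id split: if_splits)

lemma transpose_vimage_eq: "Transposition.transpose a b -` P = S \<longleftrightarrow> P = Transposition.transpose a b ` S"
proof -
  have b: "bij (Transposition.transpose a b)" by simp
  show ?thesis
    using inj_vimage_image_eq[OF bij_is_inj[OF b], of S] surj_image_vimage_eq[OF bij_is_surj[OF b], of P]
    by metis
qed

text \<open>Distant crossings count at disjoint pairs, each fixed by the other transposition. In the
  braid relation both sides count each of the three pairs among \<open>i\<close>,
  \<open>Suc i\<close>, \<open>Suc (Suc i)\<close> exactly once.\<close>

lemma crossing_relations:
  assumes "(u, v) \<in> braid_relations n"
  shows "word_eval (linking_group n) crossing u = word_eval (linking_group n) crossing v"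
  using assms unfolding braid_relations_def
proof (elim UnE CollectE exE conjE)
  fix i j assume "(u, v) = ([(i, True), (j, True)], [(j, True), (i, True)])"
    and ij: "i + 2 \<le> j \<or> j + 2 \<le> i"
  moreover have "Transposition.transpose i (Suc i) ` {j, Suc j} = {j, Suc j}"
    "Transposition.transpose j (Suc j) ` {i, Suc i} = {i, Suc i}"
    using ij by (auto simp: Transposition.transpose_def)
  moreover have "Transposition.transpose i (Suc i) \<circ> Transposition.transpose j (Suc j) =
      Transposition.transpose j (Suc j) \<circ> Transposition.transpose i (Suc i)"
    using ij by (auto simp: fun_eq_iff Transposition.transpose_def)
  ultimately show ?thesis
    by (simp add: crossing_def mult_linking_group one_linking_group transpose_vimage_eq add.commute)
next
  fix i assume uv: "(u, v) = ([(i, True), (Suc i, True), (i, True)], [(Suc i, True), (i, True), (Suc i, True)])"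
  let ?s = "Transposition.transpose i (Suc i)" and ?t = "Transposition.transpose (Suc i) (Suc (Suc i))"
  have "?s ` {Suc i, Suc (Suc i)} = {i, Suc (Suc i)}" "?t ` {i, Suc i} = {i, Suc (Suc i)}"
    "?s ` {i, Suc (Suc i)} = {Suc i, Suc (Suc i)}" "?t ` {i, Suc (Suc i)} = {i, Suc i}"
    by (auto simp: Transposition.transpose_def)
  moreover have "?s \<circ> (?t \<circ> ?s) = ?t \<circ> (?s \<circ> ?t)"
    by (auto simp: fun_eq_iff Transposition.transpose_def)
  ultimately show ?thesis
    using uv by (auto simp: crossing_def mult_linking_group one_linking_group transpose_vimage_eq
        fun_eq_iff simp del: image_insert)
qed

definition braid_link :: "nat \<Rightarrow> nat word set \<Rightarrow> (nat set \<Rightarrow> int) \<times> (nat \<Rightarrow> nat)"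
  where "braid_link n C = the_elem (word_eval (linking_group n) crossing ` C)"

lemma braid_link_hom: "braid_link n \<in> hom (braid_group n) (linking_group n)"
  unfolding braid_link_def[abs_def] braid_group_def
  by (rule group.presented_group_hom[OF group_linking_group crossing_closed crossing_relations])

lemma braid_link_class:
  "w \<in> words {1..<n} \<Longrightarrow>
    braid_link n (word_class {1..<n} (braid_relations n) w) = word_eval (linking_group n) crossing w"
  unfolding braid_link_def
  by (rule group.the_elem_word_eval[OF group_linking_group crossing_closed crossing_relations])

lemma snd_word_eval_crossing:
  "w \<in> words {1..<n} \<Longrightarrow> snd (word_eval (linking_group n) crossing w) = word_perm w"
proof (induction w)
  case Nil
  then show ?case by (simp add: one_linking_group)
next
  case (Cons x w)
  obtain i b where x: "x = (i, b)" by force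
  interpret group "linking_group n" by (rule group_linking_group)
  have i: "i \<in> {1..<n}" and w: "w \<in> words {1..<n}" using Cons.prems x by auto
  have c: "crossing i \<in> carrier (linking_group n)" using i crossing_closed by blast
  have mult: "snd (p \<otimes>\<^bsub>linking_group n\<^esub> q) = snd p \<circ> snd q" for p q
    by (cases p; cases q) (simp add: mult_linking_group)
  \<comment> \<open>\<open>word_perm\<close> ignores the sign of a letter; this agrees with
    evaluation because a transposition is its own inverse.\<close>
  have "snd (inv\<^bsub>linking_group n\<^esub> crossing i) \<circ> Transposition.transpose i (Suc i) = id"
    using mult[of "inv\<^bsub>linking_group n\<^esub> crossing i" "crossing i"] l_inv[OF c]
    by (simp add: one_linking_group crossing_def)
  then have "snd (inv\<^bsub>linking_group n\<^esub> crossing i) = Transposition.transpose i (Suc i)"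
    by (metis comp_assoc comp_id id_comp transpose_comp_involutory)
  then show ?case using Cons.IH[OF w] by (simp add: x mult crossing_def)
qed

lemma braid_perm_eq:
  assumes "C \<in> carrier (braid_group n)"
  shows "braid_perm C = snd (braid_link n C)"
proof -
  obtain w where w: "w \<in> words {1..<n}" "C = word_class {1..<n} (braid_relations n) w"
    using assms unfolding braid_group_def carrier_presented_group by blast
  have "word_perm ` C = {word_perm w}"
  proof -
    have "word_perm u = word_perm w" if "u \<in> C" for u
    proof -
      have eq: "word_eq {1..<n} (braid_relations n) w u" using that w by (simp add: word_class_def)
      then have "u \<in> words {1..<n}" using word_eq_words by blast
      then show ?thesis
        using snd_word_eval_crossing w(1)
          group.word_eval_eq[OF group_linking_group crossing_closed crossing_relations eq] by metis
    qed
    then have "word_perm ` C = (\<lambda>_. word_perm w) ` C" by (intro image_cong) blast+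
    moreover have "w \<in> C" using w by (simp add: word_class_def word_eq.refl)
    ultimately show ?thesis by (simp add: image_constant_conv) blast
  qed
  then show ?thesis
    unfolding braid_perm_def w(2) braid_link_class[OF w(1)] snd_word_eval_crossing[OF w(1)] by simp
qed

lemma group_braid_group: "group (braid_group n)"
  unfolding braid_group_def by (rule group_presented_group)

lemma linking_perm_hom: "snd \<in> hom (linking_group n) (sym_group n)"
  by (auto simp: hom_def linking_group_def sym_group_def)

lemma braid_perm_hom: "braid_perm \<in> hom (braid_group n) (sym_group n)"
proof -
  have "snd \<circ> braid_link n \<in> hom (braid_group n) (sym_group n)"
    by (rule hom_compose[OF braid_link_hom linking_perm_hom])
  moreover have "x \<otimes>\<^bsub>braid_group n\<^esub> y \<in> carrier (braid_group n)"
    if "x \<in> carrier (braid_group n)" "y \<in> carrier (braid_group n)" for x y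
    using that by (rule monoid.m_closed[OF group.is_monoid[OF group_braid_group]])
  ultimately show ?thesis
    by (intro homI) (auto simp: hom_def Pi_iff braid_perm_eq[where n=n])
qed

lemma pure_braids_iff: "C \<in> pure_braids n \<longleftrightarrow> C \<in> carrier (braid_group n) \<and> snd (braid_link n C) = id"
  by (auto simp: pure_braids_def kernel_def braid_perm_eq[where n=n] sym_group_one)

text \<open>The map to the linking group descends because pure braids go to vectors with trivial
  permutation, and these commute. Pure elements of the quotient commute because precisely the
  commutators of their representatives have been divided out.\<close>

theorem braid_quotient_linking:
  assumes n: "2 \<le> n"
  obtains s \<Psi> where "braid_linking (braid_quotient n) n s \<Psi>"
proof -
  let ?B = "braid_group n" and ?L = "linking_group n" and ?R = "braid_relations n" and ?S = "{1..<n}"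
  interpret B: group ?B by (rule group_braid_group)
  interpret link: group_hom ?B ?L "braid_link n"
    by (simp add: group_hom_def group_hom_axioms_def group_linking_group group_braid_group braid_link_hom)
  interpret perm: group_hom ?B "sym_group n" braid_perm
    by (simp add: group_hom_def group_hom_axioms_def sym_group_is_group group_braid_group braid_perm_hom)
  define D where "D = derived ?B (pure_braids n)"
  have P_normal: "pure_braids n \<lhd> ?B"
    unfolding pure_braids_def by (rule perm.normal_kernel)
  then have D_normal: "D \<lhd> ?B" unfolding D_def by (rule B.derived_is_normal)
  interpret D: normal D ?B by (rule D_normal)
  have P_sub: "pure_braids n \<subseteq> carrier ?B" by (auto simp: pure_braids_iff)
  have "derived_set ?B (pure_braids n) \<subseteq> kernel ?B ?L (braid_link n)"
  proof safe
    fix a b assume ab: "a \<in> pure_braids n" "b \<in> pure_braids n"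
    then have c: "a \<in> carrier ?B" "b \<in> carrier ?B" using P_sub by auto
    have cl: "braid_link n a \<in> carrier ?L" "braid_link n b \<in> carrier ?L" using c by auto
    have "braid_link n a \<otimes>\<^bsub>?L\<^esub> braid_link n b = braid_link n b \<otimes>\<^bsub>?L\<^esub> braid_link n a"
      using ab by (cases "braid_link n a"; cases "braid_link n b")
        (simp add: pure_braids_iff mult_linking_group add.commute)
    then have "braid_link n (a \<otimes>\<^bsub>?B\<^esub> b \<otimes>\<^bsub>?B\<^esub> inv\<^bsub>?B\<^esub> a \<otimes>\<^bsub>?B\<^esub> inv\<^bsub>?B\<^esub> b) = \<one>\<^bsub>?L\<^esub>"
      using c cl by (simp add: link.H.m_assoc link.H.inv_solve_right')
    then show "a \<otimes>\<^bsub>?B\<^esub> b \<otimes>\<^bsub>?B\<^esub> inv\<^bsub>?B\<^esub> a \<otimes>\<^bsub>?B\<^esub> inv\<^bsub>?B\<^esub> b \<in> kernel ?B ?L (braid_link n)"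
      using c by (simp add: kernel_def)
  qed
  then have "D \<subseteq> kernel ?B ?L (braid_link n)"
    unfolding D_def derived_def by (rule B.generate_subgroup_incl[OF _ link.subgroup_kernel])
  then obtain \<Psi> where \<Psi>: "\<Psi> \<in> hom (?B Mod D) ?L"
    "\<And>x. x \<in> carrier ?B \<Longrightarrow> \<Psi> (D #>\<^bsub>?B\<^esub> x) = braid_link n x"
    using link.FactGroup_universal_kernel[OF D_normal] by metis
  let ?Q = "?B Mod D"
  have Q: "braid_quotient n = ?Q" by (simp add: braid_quotient_def D_def)
  interpret Q: group ?Q by (rule D.factorgroup_is_group)
  interpret pr: group_hom ?B ?Q "(#>\<^bsub>?B\<^esub>) D"
    by (simp add: group_hom_def group_hom_axioms_def D.r_coset_hom_Mod B.is_group Q.is_group)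
  have pr_mult: "(D #>\<^bsub>?B\<^esub> x) \<otimes>\<^bsub>?Q\<^esub> (D #>\<^bsub>?B\<^esub> y) = D #>\<^bsub>?B\<^esub> (x \<otimes>\<^bsub>?B\<^esub> y)"
    if "x \<in> carrier ?B" "y \<in> carrier ?B" for x y
    using pr.hom_mult[OF that] by simp
  define g where "g i = word_class ?S ?R [(i, True)]" for i
  define s where "s i = D #>\<^bsub>?B\<^esub> g i" for i
  have g: "g i \<in> carrier ?B" if "i \<in> ?S" for i
    using that by (simp add: g_def braid_group_def carrier_presented_group)
  have carrier_Q: "carrier ?Q = (#>\<^bsub>?B\<^esub>) D ` carrier ?B"
    by (auto simp: carrier_FactGroup)
  have gen_B: "carrier ?B = generate ?B (g ` ?S)"
    unfolding braid_group_def g_def by (rule generate_presented_group)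
  have mult: "g i \<otimes>\<^bsub>?B\<^esub> g j = word_class ?S ?R [(i, True), (j, True)]" if "i \<in> ?S" "j \<in> ?S" for i j
    using that by (simp add: g_def braid_group_def mult_presented_group)
  have far: "g i \<otimes>\<^bsub>?B\<^esub> g j = g j \<otimes>\<^bsub>?B\<^esub> g i" if "i \<in> ?S" "j \<in> ?S" "i + 2 \<le> j" for i j
  proof -
    have "word_eq ?S ?R [(i, True), (j, True)] [(j, True), (i, True)]"
      using that by (intro word_eq.rel) (auto simp: braid_relations_def)
    then show ?thesis using that by (simp add: mult word_class_eq_iff)
  qed
  have braid: "g i \<otimes>\<^bsub>?B\<^esub> g (Suc i) \<otimes>\<^bsub>?B\<^esub> g i = g (Suc i) \<otimes>\<^bsub>?B\<^esub> g i \<otimes>\<^bsub>?B\<^esub> g (Suc i)"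
    if "i \<in> ?S" "Suc i \<in> ?S" for i
  proof -
    have "word_eq ?S ?R [(i, True), (Suc i, True), (i, True)] [(Suc i, True), (i, True), (Suc i, True)]"
      using that by (intro word_eq.rel) (auto simp: braid_relations_def)
    then show ?thesis
      using that by (simp add: g_def braid_group_def mult_presented_group word_class_eq_iff)
  qed
  have "braid_linking ?Q n s \<Psi>"
  proof (unfold_locales)
    show "2 \<le> n" by (rule n)
    show "s i \<in> carrier ?Q" if "i \<in> ?S" for i using g[OF that] by (simp add: s_def carrier_Q)
    show "s i \<otimes>\<^bsub>?Q\<^esub> s j = s j \<otimes>\<^bsub>?Q\<^esub> s i" if "i \<in> ?S" "j \<in> ?S" "i + 2 \<le> j" for i j
      using far[OF that] by (simp only: s_def pr_mult g that)
    show "s i \<otimes>\<^bsub>?Q\<^esub> s (Suc i) \<otimes>\<^bsub>?Q\<^esub> s i = s (Suc i) \<otimes>\<^bsub>?Q\<^esub> s i \<otimes>\<^bsub>?Q\<^esub> s (Suc i)"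
      if "i \<in> ?S" "Suc i \<in> ?S" for i
      using braid[OF that] by (simp only: s_def pr_mult g that B.m_closed)
    have "generate ?Q ((#>\<^bsub>?B\<^esub>) D ` (g ` ?S)) = (#>\<^bsub>?B\<^esub>) D ` generate ?B (g ` ?S)"
      using g by (intro pr.generate_img) auto
    then show "carrier ?Q = generate ?Q (s ` ?S)"
      unfolding carrier_Q gen_B[symmetric] by (simp add: image_image s_def)
    show "\<Psi> \<in> hom ?Q ?L" by (rule \<Psi>(1))
    show "\<Psi> (s i) = (\<lambda>P. if P = {i, Suc i} then 1 else 0, Transposition.transpose i (Suc i))" if "i \<in> ?S" for i
    proof -
      have "\<Psi> (s i) = word_eval ?L crossing [(i, True)]"
        using \<Psi>(2)[OF g[OF that]] braid_link_class[of "[(i, True)]" n] that by (simp add: s_def g_def)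
      moreover have "crossing i \<in> carrier ?L" using that crossing_closed by blast
      ultimately show ?thesis by (simp add: crossing_def)
    qed
    show "x \<otimes>\<^bsub>?Q\<^esub> y = y \<otimes>\<^bsub>?Q\<^esub> x"
      if xy: "x \<in> carrier ?Q" "y \<in> carrier ?Q" "snd (\<Psi> x) = id" "snd (\<Psi> y) = id" for x y
    proof -
      obtain a b where ab: "a \<in> carrier ?B" "b \<in> carrier ?B" "x = D #>\<^bsub>?B\<^esub> a" "y = D #>\<^bsub>?B\<^esub> b"
        using xy unfolding carrier_Q by blast
      then have "a \<in> pure_braids n" "b \<in> pure_braids n"
        using xy \<Psi>(2) by (auto simp: pure_braids_iff)
      then have "a \<otimes>\<^bsub>?B\<^esub> b \<otimes>\<^bsub>?B\<^esub> inv\<^bsub>?B\<^esub> a \<otimes>\<^bsub>?B\<^esub> inv\<^bsub>?B\<^esub> b \<in> D" (is "?c \<in> D")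
        unfolding D_def derived_def by (intro generate.incl) blast
      moreover have c: "?c \<in> carrier ?B" using ab by simp
      ultimately have "D #>\<^bsub>?B\<^esub> ?c = D"
        using B.coset_join2[OF _ D.subgroup_axioms] by blast
      moreover have "?c \<otimes>\<^bsub>?B\<^esub> (b \<otimes>\<^bsub>?B\<^esub> a) = a \<otimes>\<^bsub>?B\<^esub> b"
      proof -
        have "?c = (a \<otimes>\<^bsub>?B\<^esub> b) \<otimes>\<^bsub>?B\<^esub> inv\<^bsub>?B\<^esub> (b \<otimes>\<^bsub>?B\<^esub> a)"
          using ab by (simp add: B.inv_mult_group B.m_assoc)
        then show ?thesis
          using B.inv_solve_right[OF c B.m_closed[OF ab(1,2)] B.m_closed[OF ab(2,1)]] by metis
      qed
      ultimately have "D #>\<^bsub>?B\<^esub> (a \<otimes>\<^bsub>?B\<^esub> b) = D #>\<^bsub>?B\<^esub> (b \<otimes>\<^bsub>?B\<^esub> a)"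
        using B.coset_mult_assoc[OF D.subset c, of "b \<otimes>\<^bsub>?B\<^esub> a"] ab by (simp only: B.m_closed)
      then show ?thesis using ab by (simp only: pr_mult)
    qed
  qed
  then show ?thesis using that Q by simp
qed

section \<open>Characters of finite abelian groups\<close>

text \<open>Characters take values in \<open>\<real>/\<int>\<close>, represented by real numbers.\<close>

definition real_character :: "('a, 'b) monoid_scheme \<Rightarrow> 'a set \<Rightarrow> ('a \<Rightarrow> real) \<Rightarrow> bool"
  where "real_character G H \<xi> \<longleftrightarrow>
    subgroup H G \<and> (\<forall>a\<in>H. \<forall>b\<in>H. \<xi> (a \<otimes>\<^bsub>G\<^esub> b) - \<xi> a - \<xi> b \<in> \<int>)"

lemma (in group) real_character_pow:
  assumes \<xi>: "real_character G H \<xi>" and a: "a \<in> H"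
  shows "\<xi> (a [^] (k :: nat)) - k * \<xi> a \<in> \<int>"
proof (induction k)
  case 0
  have "\<one> \<in> H" using \<xi> subgroup.one_closed by (auto simp: real_character_def)
  then have "\<xi> (\<one> \<otimes> \<one>) - \<xi> \<one> - \<xi> \<one> \<in> \<int>" using \<xi> unfolding real_character_def by blast
  then show ?case using Ints_minus by fastforce
next
  case (Suc k)
  have H: "subgroup H G" using \<xi> by (simp add: real_character_def)
  have "a [^] k \<in> H" using subgroup_int_pow_closed[OF H a, of "int k"] by (simp add: int_pow_int)
  then have "\<xi> (a [^] k \<otimes> a) - \<xi> (a [^] k) - \<xi> a \<in> \<int>" using \<xi> a unfolding real_character_def by blast
  from Ints_add[OF this Suc] show ?case by (simp add: algebra_simps)
qed

text \<open>With \<open>d\<close> the order of \<open>x\<close> modulo \<open>H\<close>, each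
  element of the enlarged subgroup is uniquely \<open>h \<otimes> x [^] i\<close> with
  \<open>i < d\<close>, and \<open>z\<close> is an admissible value once \<open>d * z\<close> agrees
  with the given value at \<open>x [^] d\<close> modulo integers. The summand
  \<open>\<xi> \<one>\<close> occurs because a character is normalised only modulo integers.\<close>

lemma (in comm_group) real_character_extend:
  assumes fin: "finite (carrier G)" and \<xi>: "real_character G H \<xi>"
    and x: "x \<in> carrier G" and d: "d > 0" "x [^] d \<in> H" and least: "\<And>i. 0 < i \<Longrightarrow> i < d \<Longrightarrow> x [^] (i :: nat) \<notin> H"
    and z: "d * z - \<xi> (x [^] d) \<in> \<int>" and d1: "d \<noteq> 1"
  shows "\<exists>H' \<xi>'. real_character G H' \<xi>' \<and> H \<subseteq> H' \<and> x \<in> H' \<and> (\<forall>a\<in>H. \<xi>' a = \<xi> a) \<and> \<xi>' x = \<xi> \<one> + z"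
proof -
  interpret H: subgroup H G using \<xi> by (simp add: real_character_def)
  have add: "\<xi> (a \<otimes> b) - \<xi> a - \<xi> b \<in> \<int>" if "a \<in> H" "b \<in> H" for a b
    using \<xi> that by (simp add: real_character_def)
  have unique_le: "h = h' \<and> i = j"
    if "h \<in> H" "h' \<in> H" "i \<le> j" "j < d" "h \<otimes> x [^] i = h' \<otimes> x [^] j" for h h' and i j :: nat
  proof -
    have c: "h \<in> carrier G" "h' \<in> carrier G" using that H.subset by auto
    have "x [^] j = x [^] (j - i) \<otimes> x [^] i" using x that(3) by (simp add: nat_pow_mult)
    then have "h \<otimes> x [^] i = (h' \<otimes> x [^] (j - i)) \<otimes> x [^] i"
      using that(5) c x by (simp add: m_assoc)
    then have eq: "h = h' \<otimes> x [^] (j - i)" using c x by (subst (asm) right_cancel) auto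
    then have "x [^] (j - i) = inv h' \<otimes> h" using c x by (simp add: m_assoc[symmetric])
    then have "x [^] (j - i) \<in> H" using that by simp
    then have "j - i = 0" using least[of "j - i"] that by (cases "j - i = 0") auto
    then show ?thesis using eq that c by auto
  qed
  have unique: "h = h' \<and> i = j"
    if "h \<in> H" "h' \<in> H" "i < d" "j < d" "h \<otimes> x [^] i = h' \<otimes> x [^] j" for h h' and i j :: nat
    using unique_le[of h h' i j] unique_le[of h' h j i] that by (cases "i \<le> j") auto
  define H' where "H' = {h \<otimes> x [^] i | h i. h \<in> H \<and> i < d}"
  define \<xi>' where "\<xi>' a = (SOME r. \<exists>h\<in>H. \<exists>i<d. a = h \<otimes> x [^] i \<and> r = \<xi> h + i * z)" for a
  have \<xi>'_eq: "\<xi>' (h \<otimes> x [^] i) = \<xi> h + i * z" if "h \<in> H" "i < d" for h i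
    unfolding \<xi>'_def
  proof (rule some_equality)
    show "\<exists>h'\<in>H. \<exists>j<d. h \<otimes> x [^] i = h' \<otimes> x [^] j \<and> \<xi> h + i * z = \<xi> h' + j * z" using that by blast
    fix r assume "\<exists>h'\<in>H. \<exists>j<d. h \<otimes> x [^] i = h' \<otimes> x [^] j \<and> r = \<xi> h' + j * z"
    then show "r = \<xi> h + i * z" using unique that by blast
  qed
  have prod: "\<exists>h'' l. h'' \<in> H \<and> l < d \<and> (h \<otimes> x [^] i) \<otimes> (h' \<otimes> x [^] j) = h'' \<otimes> x [^] l \<and>
      (\<xi> h'' + l * z) - (\<xi> h + i * z) - (\<xi> h' + j * z) \<in> \<int>"
    if hh: "h \<in> H" "h' \<in> H" "i < d" "j < d" for h h' and i j :: nat
  proof -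
    have c: "h \<in> carrier G" "h' \<in> carrier G" using hh H.subset by auto
    have eq: "(h \<otimes> x [^] i) \<otimes> (h' \<otimes> x [^] j) = (h \<otimes> h') \<otimes> x [^] (i + j)"
      using c x by (simp add: nat_pow_mult[symmetric] m_ac)
    show ?thesis
    proof (cases "i + j < d")
      case True
      then show ?thesis using eq hh add[OF hh(1,2)]
        by (intro exI[of _ "h \<otimes> h'"] exI[of _ "i + j"]) (simp add: algebra_simps)
    next
      \<comment> \<open>The exponent overflows: a factor \<open>x [^] d\<close> moves into
        \<open>H\<close>, and the condition on \<open>z\<close> makes up for the lost
        \<open>d * z\<close>.\<close>
      case False
      have "x [^] (i + j) = x [^] d \<otimes> x [^] (i + j - d)" using x False by (simp add: nat_pow_mult)
      then have 1: "(h \<otimes> x [^] i) \<otimes> (h' \<otimes> x [^] j) = (h \<otimes> h' \<otimes> x [^] d) \<otimes> x [^] (i + j - d)"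
        unfolding eq using c x by (simp add: m_assoc)
      have "\<xi> (h \<otimes> h' \<otimes> x [^] d) - \<xi> (h \<otimes> h') - \<xi> (x [^] d) \<in> \<int>" using add hh d by simp
      from Ints_diff[OF Ints_add[OF this add[OF hh(1,2)]] z]
      moreover have "real (i + j - d) = real i + real j - real d" using False by simp
      ultimately have "\<xi> (h \<otimes> h' \<otimes> x [^] d) + (i + j - d) * z - (\<xi> h + i * z) - (\<xi> h' + j * z) \<in> \<int>"
        by (simp add: algebra_simps)
      then show ?thesis using 1 hh d False
        by (intro exI[of _ "h \<otimes> h' \<otimes> x [^] d"] exI[of _ "i + j - d"]) simp
    qed
  qed
  have H'_sub: "H' \<subseteq> carrier G" using x H.subset by (auto simp: H'_def)
  have closed: "a \<otimes> b \<in> H'" if "a \<in> H'" "b \<in> H'" for a b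
    using that prod unfolding H'_def by blast
  have HH': "H \<subseteq> H'"
  proof
    fix h assume "h \<in> H"
    then have "h = h \<otimes> x [^] (0 :: nat)" by simp
    then show "h \<in> H'" using \<open>h \<in> H\<close> d(1) unfolding H'_def by blast
  qed
  have xH': "x \<in> H'"
    unfolding H'_def using x d d1 by (intro CollectI exI[of _ \<one>] exI[of _ 1]) auto
  have pow: "a [^] k \<in> H'" if "a \<in> H'" for a and k :: nat
    using that HH' by (induction k) (auto intro: closed)
  have "subgroup H' G"
  proof (rule subgroupI[OF H'_sub])
    show "H' \<noteq> {}" using xH' by blast
    fix a assume a: "a \<in> H'"
    \<comment> \<open>In a finite group inverses are powers, so closure under products
      suffices.\<close>
    have "order G > 0" using fin by (simp add: order_gt_0_iff_finite)
    then have "a [^] (order G - 1) \<otimes> a = a [^] order G"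
      by (metis Suc_diff_1 nat_pow_Suc)
    also have "\<dots> = \<one>" using a H'_sub by (intro pow_order_eq_1) auto
    finally have "inv a = a [^] (order G - 1)"
      using a H'_sub by (intro inv_equality) auto
    then show "inv a \<in> H'" using pow[OF a] by simp
  qed (rule closed)
  moreover have "\<xi>' (a \<otimes> b) - \<xi>' a - \<xi>' b \<in> \<int>" if ab: "a \<in> H'" "b \<in> H'" for a b
  proof -
    obtain h i h' j where hh: "h \<in> H" "h' \<in> H" "i < d" "j < d" "a = h \<otimes> x [^] i" "b = h' \<otimes> x [^] j"
      using ab unfolding H'_def by blast
    obtain h'' l where l: "h'' \<in> H" "l < d" "(h \<otimes> x [^] i) \<otimes> (h' \<otimes> x [^] j) = h'' \<otimes> x [^] l"
      "(\<xi> h'' + l * z) - (\<xi> h + i * z) - (\<xi> h' + j * z) \<in> \<int>"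
      using prod[OF hh(1-4)] by blast
    show ?thesis
      unfolding hh(5,6) l(3) \<xi>'_eq[OF l(1,2)] \<xi>'_eq[OF hh(1,3)] \<xi>'_eq[OF hh(2,4)] by (rule l(4))
  qed
  moreover have "\<xi>' a = \<xi> a" if "a \<in> H" for a
    using \<xi>'_eq[OF that d(1)] that by simp
  moreover have "\<xi>' x = \<xi> \<one> + z"
    using \<xi>'_eq[of \<one> 1] x d d1 by simp
  ultimately show ?thesis
    using HH' xH' unfolding real_character_def by (intro exI[of _ H'] exI[of _ \<xi>']) blast
qed

lemma (in group) least_pow_in_subgroup:
  assumes fin: "finite (carrier G)" and H: "subgroup H G" and x: "x \<in> carrier G" "x \<notin> H"
  obtains d :: nat where "d > 1" "x [^] d \<in> H" "\<And>i. 0 < i \<Longrightarrow> i < d \<Longrightarrow> x [^] (i :: nat) \<notin> H"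
proof -
  define P where "P d \<longleftrightarrow> 0 < d \<and> x [^] d \<in> H" for d :: nat
  have "P (order G)"
    using fin H x subgroup.one_closed by (simp add: P_def order_gt_0_iff_finite pow_order_eq_1)
  then have "P (LEAST d. P d)" by (rule LeastI)
  moreover have "\<not> P i" if "i < (LEAST d. P d)" for i using that by (rule not_less_Least)
  moreover have "(LEAST d. P d) \<noteq> 1" using \<open>P (LEAST d. P d)\<close> x by (auto simp: P_def)
  ultimately show ?thesis using that[of "LEAST d. P d"] by (auto simp: P_def)
qed

text \<open>The character with value \<open>1 / d\<close> at \<open>g\<close>, where
  \<open>d\<close> is the order of \<open>g\<close>, extends to all of \<open>G\<close> because the
  reals modulo the integers are divisible. Its values are multiples of \<open>1 / order G\<close>,
  so scaling makes it integral and additive modulo \<open>order G\<close>.\<close>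

lemma (in comm_group) characters_separate:
  assumes fin: "finite (carrier G)" and g: "g \<in> carrier G" "g \<noteq> \<one>"
  shows "\<exists>f :: 'a \<Rightarrow> int.
    (\<forall>a\<in>carrier G. \<forall>b\<in>carrier G. int (order G) dvd f (a \<otimes> b) - f a - f b) \<and> \<not> int (order G) dvd f g"
proof -
  \<comment> \<open>Finiteness replaces Zorn's lemma: a subgroup of largest size carrying a
    character that is nontrivial at \<open>g\<close> turns out to be all of
    \<open>G\<close>.\<close>
  define P where "P m \<longleftrightarrow> (\<exists>H \<xi>. real_character G H \<xi> \<and> g \<in> H \<and> \<xi> g \<notin> \<int> \<and> card H = m)" for m
  have triv: "subgroup {\<one>} G" by (rule triv_subgroup)
  obtain d :: nat where d: "d > 1" "g [^] d \<in> {\<one>}" "\<And>i. 0 < i \<Longrightarrow> i < d \<Longrightarrow> g [^] (i :: nat) \<notin> {\<one>}"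
    using least_pow_in_subgroup[OF fin triv g(1)] g(2) by auto
  have "real_character G {\<one>} (\<lambda>_. 0)" using triv by (simp add: real_character_def)
  then obtain H \<xi> where "real_character G H \<xi>" "g \<in> H" "\<xi> g = 0 + 1 / real d"
    using real_character_extend[OF fin _ g(1), of "{\<one>}" "\<lambda>_. 0" d "1 / real d"] d by fastforce
  moreover have "1 / real d \<notin> \<int>"
  proof
    assume "1 / real d \<in> \<int>"
    then obtain i :: int where "1 / real d = i" by (auto elim: Ints_cases)
    then have "0 < real_of_int i" "real_of_int i < 1" using d(1) by (auto simp flip: \<open>1 / real d = i\<close>)
    then show False by simp
  qed
  ultimately have "P (card H)" unfolding P_def by (intro exI[of _ H] exI[of _ \<xi>]) simp
  moreover have "\<forall>m. P m \<longrightarrow> m \<le> card (carrier G)"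
    unfolding P_def real_character_def using fin by (auto intro: card_mono dest: subgroup.subset)
  ultimately obtain m where m: "P m" "\<And>m'. P m' \<Longrightarrow> m' \<le> m"
    using GreatestI_nat[of P] Greatest_le_nat[of P] by metis
  then obtain H \<xi> where \<xi>: "real_character G H \<xi>" "g \<in> H" "\<xi> g \<notin> \<int>" "card H = m" unfolding P_def by blast
  have H: "subgroup H G" using \<xi>(1) by (simp add: real_character_def)
  have "H = carrier G"
  proof (rule ccontr)
    assume "H \<noteq> carrier G"
    then obtain x where x: "x \<in> carrier G" "x \<notin> H" using subgroup.subset[OF H] by blast
    obtain d :: nat where d: "d > 1" "x [^] d \<in> H" "\<And>i. 0 < i \<Longrightarrow> i < d \<Longrightarrow> x [^] (i :: nat) \<notin> H"
      using least_pow_in_subgroup[OF fin H x] by blast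
    \<comment> \<open>Dividing the value at \<open>x [^] d\<close> by \<open>d\<close> solves the
      compatibility condition exactly.\<close>
    obtain H' \<xi>' where H': "real_character G H' \<xi>'" "H \<subseteq> H'" "x \<in> H'" "\<forall>a\<in>H. \<xi>' a = \<xi> a"
      using real_character_extend[OF fin \<xi>(1) x(1) _ d(2,3), of "\<xi> (x [^] d) / d"] d(1) by auto
    then have "H' \<subseteq> carrier G" by (auto simp: real_character_def dest: subgroup.subset)
    then have "card H < card H'" using H'(2,3) x(2) fin by (intro psubset_card_mono) (auto dest: finite_subset)
    moreover have "P (card H')" unfolding P_def using H' \<xi>(2,3) by (intro exI[of _ H'] exI[of _ \<xi>']) auto
    ultimately show False using m(2) \<xi>(4) by fastforce
  qed
  \<comment> \<open>The floor is taken of an integer for arguments in \<open>G\<close>, so it rounds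
    nothing there.\<close>
  define f where "f a = \<lfloor>real (order G) * \<xi> a\<rfloor>" for a
  have f: "real_of_int (f a) = real (order G) * \<xi> a" if a: "a \<in> carrier G" for a
  proof -
    have "\<xi> (a [^] order G) - order G * \<xi> a \<in> \<int>"
      using real_character_pow[OF \<xi>(1)] \<open>H = carrier G\<close> a by blast
    moreover have "\<xi> \<one> \<in> \<int>" using real_character_pow[OF \<xi>(1,2), of 0] by simp
    ultimately have "\<xi> \<one> - (\<xi> \<one> - order G * \<xi> a) \<in> \<int>" using a by (intro Ints_diff) (simp_all add: pow_order_eq_1)
    then have "order G * \<xi> a \<in> \<int>" by simp
    then show ?thesis by (simp add: f_def)
  qed
  have "int (order G) dvd f (a \<otimes> b) - f a - f b" if ab: "a \<in> carrier G" "b \<in> carrier G" for a b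
  proof -
    have "\<xi> (a \<otimes> b) - \<xi> a - \<xi> b \<in> \<int>"
      using \<xi>(1) \<open>H = carrier G\<close> ab by (simp add: real_character_def)
    then obtain i :: int where i: "\<xi> (a \<otimes> b) - \<xi> a - \<xi> b = i" by (elim Ints_cases)
    have "real_of_int (f (a \<otimes> b) - f a - f b) = real (order G) * (\<xi> (a \<otimes> b) - \<xi> a - \<xi> b)"
      using ab by (simp add: f algebra_simps)
    also have "\<dots> = real_of_int (int (order G) * i)" using i by simp
    finally show ?thesis by (simp only: of_int_eq_iff dvd_triv_left)
  qed
  moreover have "\<not> int (order G) dvd f g"
  proof
    assume "int (order G) dvd f g"
    then obtain i where "f g = int (order G) * i" by (elim dvdE)
    then have "real (order G) * \<xi> g = real (order G) * i" using f[OF g(1)] by (metis of_int_mult of_int_of_nat_eq)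
    moreover have "order G > 0" using fin by (simp add: order_gt_0_iff_finite)
    ultimately show False using \<xi>(3) by simp
  qed
  ultimately show ?thesis by blast
qed

lemma (in group) cayley:
  assumes fin: "finite (carrier G)"
  obtains \<rho> where "\<And>g. g \<in> carrier G \<Longrightarrow> \<rho> g permutes {1..order G}"
    "\<And>g h. g \<in> carrier G \<Longrightarrow> h \<in> carrier G \<Longrightarrow> \<rho> (g \<otimes> h) = \<rho> g \<circ> \<rho> h" "inj_on \<rho> (carrier G)"
proof -
  obtain e where e: "bij_betw e {1..order G} (carrier G)"
    using ex_bij_betw_nat_finite_1[OF fin] by (auto simp: order_def)
  let ?i = "inv_into {1..order G} e"
  define \<rho> where "\<rho> g j = (if j \<in> {1..order G} then ?i (g \<otimes> e j) else j)" for g j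
  have e_closed: "e j \<in> carrier G" if "j \<in> {1..order G}" for j using e that by (auto simp: bij_betw_def)
  have e_inv: "?i a \<in> {1..order G}" "e (?i a) = a" if "a \<in> carrier G" for a
    using bij_betw_imp_surj_on[OF e] inv_into_into[of a e "{1..order G}"] f_inv_into_f[of a e "{1..order G}"] that
    by blast+
  have inv_e: "?i (e j) = j" if "j \<in> {1..order G}" for j using e that by (auto simp: bij_betw_def)
  have mult: "\<rho> (g \<otimes> h) = \<rho> g \<circ> \<rho> h" if "g \<in> carrier G" "h \<in> carrier G" for g h
  proof
    fix j show "\<rho> (g \<otimes> h) j = (\<rho> g \<circ> \<rho> h) j"
    proof (cases "j \<in> {1..order G}")
      case True
      then have "e j \<in> carrier G" by (rule e_closed)
      then show ?thesis using True that e_inv[of "h \<otimes> e j"] by (simp add: \<rho>_def m_assoc)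
    next
      case False
      then show ?thesis unfolding \<rho>_def o_def by (simp only: if_False)
    qed
  qed
  have one: "\<rho> \<one> = id"
    using e_closed inv_e by (auto simp: \<rho>_def fun_eq_iff)
  show ?thesis
  proof (rule that[of \<rho>])
    show "\<rho> g permutes {1..order G}" if g: "g \<in> carrier G" for g
    proof -
      have "bij (\<rho> g)"
        using mult[OF g inv_closed[OF g]] mult[OF inv_closed[OF g] g] g one by (intro o_bij[of "\<rho> (inv g)"]) auto
      moreover have "\<rho> g j = j" if "j \<notin> {1..order G}" for j
        unfolding \<rho>_def using that by (simp only: if_False)
      ultimately show ?thesis unfolding permutes_def bij_iff by blast
    qed
    show "inj_on \<rho> (carrier G)"
    proof (rule inj_onI)
      fix g h assume gh: "g \<in> carrier G" "h \<in> carrier G" "\<rho> g = \<rho> h"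
      let ?j = "?i \<one>"
      have j: "?j \<in> {1..order G}" "e ?j = \<one>" using e_inv by auto
      have "e (\<rho> a ?j) = a" if "a \<in> carrier G" for a
        unfolding \<rho>_def using j that e_inv(2) by (simp only: if_True r_one)
      then show "g = h" using gh by metis
    qed
  qed (rule mult)
qed

section \<open>Holonomy representations\<close>

text \<open>Conjugation by \<open>H\<close> on the kernel factors through \<Phi> because the kernel
  is abelian; \<open>centraliser\<close> says that only lifts of the unit act trivially, which is
  faithfulness.\<close>

lemma holonomy_representation:
  fixes Z :: "('z, 'e) monoid_scheme" and H :: "('a, 'c) monoid_scheme" and \<Phi> :: "('b, 'd) monoid_scheme"
  assumes Z: "comm_group Z" and H: "group H" and \<Phi>: "group \<Phi>"
    and \<iota>: "\<iota> \<in> mon Z H" and p: "p \<in> epi H \<Phi>" and exact: "\<iota> ` carrier Z = kernel H \<Phi> p"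
    and centraliser: "\<And>x. x \<in> carrier H \<Longrightarrow> (\<And>v. v \<in> carrier Z \<Longrightarrow> x \<otimes>\<^bsub>H\<^esub> \<iota> v = \<iota> v \<otimes>\<^bsub>H\<^esub> x) \<Longrightarrow> p x = \<one>\<^bsub>\<Phi>\<^esub>"
  shows "\<exists>\<Theta>\<in>mon \<Phi> (AutoGroup Z). \<forall>x\<in>carrier H. \<forall>v\<in>carrier Z.
    \<iota> (\<Theta> (p x) v) = x \<otimes>\<^bsub>H\<^esub> \<iota> v \<otimes>\<^bsub>H\<^esub> inv\<^bsub>H\<^esub> x"
proof -
  interpret Z: comm_group Z by fact
  interpret H: group H by fact
  interpret \<Phi>: group \<Phi> by fact
  interpret \<iota>: group_hom Z H \<iota> using \<iota> by unfold_locales (simp add: mon_def)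
  interpret p: group_hom H \<Phi> p using p by unfold_locales (simp add: epi_def)
  have inj: "v = w" if "\<iota> v = \<iota> w" "v \<in> carrier Z" "w \<in> carrier Z" for v w
    using \<iota> that by (auto simp: mon_def dest: inj_onD)
  have ker: "\<iota> v \<in> carrier H" "p (\<iota> v) = \<one>\<^bsub>\<Phi>\<^esub>" if "v \<in> carrier Z" for v
    using exact that by (auto simp: kernel_def)
  have ker': "\<exists>v\<in>carrier Z. y = \<iota> v" if "y \<in> carrier H" "p y = \<one>\<^bsub>\<Phi>\<^esub>" for y
    using exact that by (auto simp: kernel_def image_iff)
  have \<iota>_comm: "\<iota> v \<otimes>\<^bsub>H\<^esub> \<iota> w = \<iota> w \<otimes>\<^bsub>H\<^esub> \<iota> v" if "v \<in> carrier Z" "w \<in> carrier Z" for v w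
    using that by (metis \<iota>.hom_mult Z.m_comm)
  have cancel: "inv\<^bsub>H\<^esub> x \<otimes>\<^bsub>H\<^esub> (x \<otimes>\<^bsub>H\<^esub> y) = y" "x \<otimes>\<^bsub>H\<^esub> (inv\<^bsub>H\<^esub> x \<otimes>\<^bsub>H\<^esub> y) = y"
    if "x \<in> carrier H" "y \<in> carrier H" for x y
    using that by (simp_all add: H.m_assoc[symmetric])
  \<comment> \<open>One \<open>w\<close> serves all lifts of \<phi>: they differ by kernel elements,
    which act trivially on the kernel. The restriction to the carrier is there because elements of
    \<open>AutoGroup\<close> are extensional.\<close>
  define \<Theta> where "\<Theta> \<phi> = (\<lambda>v\<in>carrier Z. SOME w. w \<in> carrier Z \<and>
    (\<forall>x\<in>carrier H. p x = \<phi> \<longrightarrow> \<iota> w = x \<otimes>\<^bsub>H\<^esub> \<iota> v \<otimes>\<^bsub>H\<^esub> inv\<^bsub>H\<^esub> x))" for \<phi>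
  have \<Theta>: "\<Theta> (p x) v \<in> carrier Z \<and> \<iota> (\<Theta> (p x) v) = x \<otimes>\<^bsub>H\<^esub> \<iota> v \<otimes>\<^bsub>H\<^esub> inv\<^bsub>H\<^esub> x"
    if x: "x \<in> carrier H" and v: "v \<in> carrier Z" for x v
  proof -
    have "p (x \<otimes>\<^bsub>H\<^esub> \<iota> v \<otimes>\<^bsub>H\<^esub> inv\<^bsub>H\<^esub> x) = \<one>\<^bsub>\<Phi>\<^esub>"
      using x ker[OF v] by simp
    then obtain w where w: "w \<in> carrier Z" "\<iota> w = x \<otimes>\<^bsub>H\<^esub> \<iota> v \<otimes>\<^bsub>H\<^esub> inv\<^bsub>H\<^esub> x"
      using ker'[of "x \<otimes>\<^bsub>H\<^esub> \<iota> v \<otimes>\<^bsub>H\<^esub> inv\<^bsub>H\<^esub> x"] x ker[OF v] by auto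
    have "\<iota> w = y \<otimes>\<^bsub>H\<^esub> \<iota> v \<otimes>\<^bsub>H\<^esub> inv\<^bsub>H\<^esub> y" if y: "y \<in> carrier H" "p y = p x" for y
    proof -
      have "p (inv\<^bsub>H\<^esub> y \<otimes>\<^bsub>H\<^esub> x) = \<one>\<^bsub>\<Phi>\<^esub>" using x y by simp
      then obtain u where u: "u \<in> carrier Z" "inv\<^bsub>H\<^esub> y \<otimes>\<^bsub>H\<^esub> x = \<iota> u"
        using ker'[of "inv\<^bsub>H\<^esub> y \<otimes>\<^bsub>H\<^esub> x"] x y by auto
      have xy: "x = y \<otimes>\<^bsub>H\<^esub> \<iota> u" using cancel(2)[OF y(1) x] u by simp
      have "\<iota> u \<otimes>\<^bsub>H\<^esub> \<iota> v \<otimes>\<^bsub>H\<^esub> inv\<^bsub>H\<^esub> (\<iota> u) = \<iota> v"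
        using \<iota>_comm[OF u(1) v] u v ker by (simp add: H.m_assoc)
      then have "y \<otimes>\<^bsub>H\<^esub> (\<iota> u \<otimes>\<^bsub>H\<^esub> \<iota> v \<otimes>\<^bsub>H\<^esub> inv\<^bsub>H\<^esub> (\<iota> u)) \<otimes>\<^bsub>H\<^esub> inv\<^bsub>H\<^esub> y = y \<otimes>\<^bsub>H\<^esub> \<iota> v \<otimes>\<^bsub>H\<^esub> inv\<^bsub>H\<^esub> y"
        by (rule arg_cong)
      then show ?thesis
        unfolding w(2) xy using y(1) u(1) v ker by (simp add: H.m_assoc H.inv_mult_group del: \<iota>.hom_inv)
    qed
    then have "\<exists>w. w \<in> carrier Z \<and> (\<forall>y\<in>carrier H. p y = p x \<longrightarrow> \<iota> w = y \<otimes>\<^bsub>H\<^esub> \<iota> v \<otimes>\<^bsub>H\<^esub> inv\<^bsub>H\<^esub> y)"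
      using w(1) by blast
    from someI_ex[OF this] show ?thesis using x v unfolding \<Theta>_def by simp
  qed
  have surj: "\<exists>x\<in>carrier H. \<phi> = p x" if "\<phi> \<in> carrier \<Phi>" for \<phi>
    using p that by (auto simp: epi_def image_iff)
  have auto: "\<Theta> (p x) \<in> auto Z" if x: "x \<in> carrier H" for x
  proof -
    have "\<Theta> (p x) \<in> hom Z Z"
    proof (rule homI)
      fix v w assume vw: "v \<in> carrier Z" "w \<in> carrier Z"
      show "\<Theta> (p x) (v \<otimes>\<^bsub>Z\<^esub> w) = \<Theta> (p x) v \<otimes>\<^bsub>Z\<^esub> \<Theta> (p x) w"
      proof (rule inj)
        show "\<iota> (\<Theta> (p x) (v \<otimes>\<^bsub>Z\<^esub> w)) = \<iota> (\<Theta> (p x) v \<otimes>\<^bsub>Z\<^esub> \<Theta> (p x) w)"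
          using vw x \<Theta> ker by (simp add: H.m_assoc cancel)
      qed (use \<Theta> x vw in auto)
    qed (use \<Theta> x in auto)
    moreover have "bij_betw (\<Theta> (p x)) (carrier Z) (carrier Z)"
      unfolding bij_betw_def
    proof
      show "inj_on (\<Theta> (p x)) (carrier Z)"
      proof (rule inj_onI)
        fix v w assume vw: "v \<in> carrier Z" "w \<in> carrier Z" "\<Theta> (p x) v = \<Theta> (p x) w"
        then have "x \<otimes>\<^bsub>H\<^esub> \<iota> v \<otimes>\<^bsub>H\<^esub> inv\<^bsub>H\<^esub> x = x \<otimes>\<^bsub>H\<^esub> \<iota> w \<otimes>\<^bsub>H\<^esub> inv\<^bsub>H\<^esub> x"
          using \<Theta>[OF x vw(1)] \<Theta>[OF x vw(2)] by simp
        then show "v = w" using x vw ker inj by simp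
      qed
      have "w \<in> \<Theta> (p x) ` carrier Z" if w: "w \<in> carrier Z" for w
      proof -
        have "\<iota> (\<Theta> (p x) (\<Theta> (p (inv\<^bsub>H\<^esub> x)) w)) = \<iota> w"
          using \<Theta>[OF x] \<Theta>[of "inv\<^bsub>H\<^esub> x" w] x w ker by (simp add: H.m_assoc cancel del: p.hom_inv)
        then have "\<Theta> (p x) (\<Theta> (p (inv\<^bsub>H\<^esub> x)) w) = w"
          using \<Theta> x w by (intro inj) (auto simp del: p.hom_inv)
        then show ?thesis using \<Theta>[of "inv\<^bsub>H\<^esub> x" w] x w by (metis H.inv_closed image_eqI)
      qed
      then show "\<Theta> (p x) ` carrier Z = carrier Z" using \<Theta>[OF x] by blast
    qed
    moreover have "\<Theta> (p x) \<in> extensional (carrier Z)" by (simp add: \<Theta>_def)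
    ultimately show ?thesis by (simp add: auto_def Bij_def)
  qed
  have "\<Theta> \<in> hom \<Phi> (AutoGroup Z)"
  proof (rule homI)
    show "\<Theta> \<phi> \<in> carrier (AutoGroup Z)" if "\<phi> \<in> carrier \<Phi>" for \<phi>
      using surj[OF that] auto by (auto simp: AutoGroup_def)
    fix \<phi> \<psi> assume "\<phi> \<in> carrier \<Phi>" "\<psi> \<in> carrier \<Phi>"
    then obtain x y where xy: "x \<in> carrier H" "\<phi> = p x" "y \<in> carrier H" "\<psi> = p y" using surj by blast
    have "\<Theta> (\<phi> \<otimes>\<^bsub>\<Phi>\<^esub> \<psi>) = compose (carrier Z) (\<Theta> \<phi>) (\<Theta> \<psi>)"
    proof (rule extensionalityI[of _ "carrier Z"])
      fix v assume v: "v \<in> carrier Z"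
      have "\<iota> (\<Theta> (p (x \<otimes>\<^bsub>H\<^esub> y)) v) = \<iota> (\<Theta> (p x) (\<Theta> (p y) v))"
        using \<Theta>[of "x \<otimes>\<^bsub>H\<^esub> y" v] \<Theta>[OF xy(1)] \<Theta>[OF xy(3) v] xy v ker
        by (simp add: H.m_assoc H.inv_mult_group del: p.hom_mult)
      then have "\<Theta> (p (x \<otimes>\<^bsub>H\<^esub> y)) v = \<Theta> (p x) (\<Theta> (p y) v)"
        using \<Theta> xy v by (intro inj) (auto simp del: p.hom_mult)
      then show "\<Theta> (\<phi> \<otimes>\<^bsub>\<Phi>\<^esub> \<psi>) v = compose (carrier Z) (\<Theta> \<phi>) (\<Theta> \<psi>) v"
        using xy v by (simp add: compose_def)
    qed (simp_all add: \<Theta>_def compose_def)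
    then show "\<Theta> (\<phi> \<otimes>\<^bsub>\<Phi>\<^esub> \<psi>) = \<Theta> \<phi> \<otimes>\<^bsub>AutoGroup Z\<^esub> \<Theta> \<psi>"
      using auto[OF xy(1)] auto[OF xy(3)] xy by (simp add: AutoGroup_def BijGroup_def auto_def)
  qed
  moreover have "inj_on \<Theta> (carrier \<Phi>)"
  proof (rule inj_onI)
    fix \<phi> \<psi> assume "\<phi> \<in> carrier \<Phi>" "\<psi> \<in> carrier \<Phi>" and eq: "\<Theta> \<phi> = \<Theta> \<psi>"
    then obtain x y where xy: "x \<in> carrier H" "\<phi> = p x" "y \<in> carrier H" "\<psi> = p y" using surj by blast
    let ?z = "inv\<^bsub>H\<^esub> y \<otimes>\<^bsub>H\<^esub> x"
    have "p ?z = \<one>\<^bsub>\<Phi>\<^esub>"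
    proof (rule centraliser)
      show "?z \<in> carrier H" using xy by simp
      fix v assume v: "v \<in> carrier Z"
      have "x \<otimes>\<^bsub>H\<^esub> \<iota> v \<otimes>\<^bsub>H\<^esub> inv\<^bsub>H\<^esub> x = y \<otimes>\<^bsub>H\<^esub> \<iota> v \<otimes>\<^bsub>H\<^esub> inv\<^bsub>H\<^esub> y"
        using \<Theta>[OF xy(1) v] \<Theta>[OF xy(3) v] eq xy by simp
      then have "inv\<^bsub>H\<^esub> y \<otimes>\<^bsub>H\<^esub> (x \<otimes>\<^bsub>H\<^esub> \<iota> v \<otimes>\<^bsub>H\<^esub> inv\<^bsub>H\<^esub> x) \<otimes>\<^bsub>H\<^esub> x = inv\<^bsub>H\<^esub> y \<otimes>\<^bsub>H\<^esub> (y \<otimes>\<^bsub>H\<^esub> \<iota> v \<otimes>\<^bsub>H\<^esub> inv\<^bsub>H\<^esub> y) \<otimes>\<^bsub>H\<^esub> x"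
        by simp
      then show "?z \<otimes>\<^bsub>H\<^esub> \<iota> v = \<iota> v \<otimes>\<^bsub>H\<^esub> ?z"
        using xy v ker by (simp add: H.m_assoc cancel)
    qed
    then have "inv\<^bsub>\<Phi>\<^esub> \<psi> \<otimes>\<^bsub>\<Phi>\<^esub> \<phi> = \<one>\<^bsub>\<Phi>\<^esub>" using xy by simp
    then show "\<phi> = \<psi>" using xy by (metis \<Phi>.inv_equality \<Phi>.inv_inv \<Phi>.inv_closed \<Phi>.r_inv \<Phi>.inv_solve_left' p.hom_closed \<Phi>.r_one \<Phi>.one_closed)
  qed
  ultimately show ?thesis
    using \<Theta> by (intro bexI[of _ \<Theta>]) (auto simp: mon_def)
qed

lemma bieberbach_iso:
  assumes H: "bieberbach N H \<Phi>" and K: "group K" and f: "f \<in> iso H K"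
  shows "bieberbach N K \<Phi>"
proof -
  have gH: "group H" and \<Phi>: "group \<Phi>" "finite (carrier \<Phi>)" and tf: "torsion_free H"
    using H by (auto simp: bieberbach_def crystallographic_def)
  obtain \<iota> p \<Theta> where c: "\<iota> \<in> mon (int_lattice N) H" "p \<in> epi H \<Phi>" "\<iota> ` carrier (int_lattice N) = kernel H \<Phi> p"
    "\<Theta> \<in> mon \<Phi> (AutoGroup (int_lattice N))"
    "\<And>x v. x \<in> carrier H \<Longrightarrow> v \<in> carrier (int_lattice N) \<Longrightarrow> \<iota> (\<Theta> (p x) v) = x \<otimes>\<^bsub>H\<^esub> \<iota> v \<otimes>\<^bsub>H\<^esub> inv\<^bsub>H\<^esub> x"
    using H unfolding bieberbach_def crystallographic_def by blast
  interpret H: group H by fact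
  interpret K: group K by fact
  interpret f: group_hom H K f using f by unfold_locales (simp add: iso_def)
  have bij: "bij_betw f (carrier H) (carrier K)" using f by (simp add: iso_def)
  define g where "g = inv_into (carrier H) f"
  have g_iso: "g \<in> iso K H" unfolding g_def by (rule H.iso_set_sym[OF f])
  interpret g: group_hom K H g using g_iso by unfold_locales (simp add: iso_def)
  have fg: "f (g y) = y" if "y \<in> carrier K" for y
    using bij_betw_imp_surj_on[OF bij] that by (auto simp: g_def f_inv_into_f)
  have gf: "g (f x) = x" if "x \<in> carrier H" for x
    using bij_betw_inv_into_left[OF bij that] by (simp add: g_def)
  have \<iota>_closed: "\<iota> v \<in> carrier H" if "v \<in> carrier (int_lattice N)" for v
    using c(1) that by (auto simp: mon_def hom_def)
  have "f \<circ> \<iota> \<in> mon (int_lattice N) K"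
    using c(1) f.homh bij \<iota>_closed
    by (auto simp: mon_def bij_betw_def simp del: carrier_product_group intro!: hom_compose comp_inj_on intro: inj_on_subset)
  moreover have "p \<circ> g \<in> epi K \<Phi>"
  proof -
    have "g ` carrier K = carrier H" "p ` carrier H = carrier \<Phi>"
      using c(2) g_iso by (auto simp: epi_def iso_def bij_betw_def)
    then have "(p \<circ> g) ` carrier K = carrier \<Phi>" by (simp only: image_comp[symmetric])
    moreover have "p \<circ> g \<in> hom K \<Phi>" using hom_compose[OF g.homh, of p \<Phi>] c(2) by (simp add: epi_def)
    ultimately show ?thesis by (simp add: epi_def)
  qed
  moreover have "(f \<circ> \<iota>) ` carrier (int_lattice N) = kernel K \<Phi> (p \<circ> g)"
  proof -
    have "f ` kernel H \<Phi> p = kernel K \<Phi> (p \<circ> g)"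
    proof (intro equalityI subsetI)
      fix y assume "y \<in> kernel K \<Phi> (p \<circ> g)"
      then show "y \<in> f ` kernel H \<Phi> p" using fg by (intro image_eqI[of _ _ "g y"]) (auto simp: kernel_def)
    qed (auto simp: kernel_def gf)
    then show ?thesis using c(3) by (simp only: image_comp[symmetric])
  qed
  moreover have "(f \<circ> \<iota>) (\<Theta> ((p \<circ> g) y) v) = y \<otimes>\<^bsub>K\<^esub> (f \<circ> \<iota>) v \<otimes>\<^bsub>K\<^esub> inv\<^bsub>K\<^esub> y"
    if "y \<in> carrier K" "v \<in> carrier (int_lattice N)" for y v
    using c(5)[OF g.hom_closed[OF that(1)] that(2)] that(1) \<iota>_closed[OF that(2)] fg
    by (simp del: carrier_product_group g.hom_inv)
  ultimately have "crystallographic N K \<Phi>"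
    unfolding crystallographic_def using K \<Phi> c(4) by blast
  moreover have "torsion_free K"
    unfolding torsion_free_def
  proof (intro ballI impI allI notI)
    fix y and k :: nat assume y: "y \<in> carrier K" "y \<noteq> \<one>\<^bsub>K\<^esub>" and k: "k > 0" "y [^]\<^bsub>K\<^esub> k = \<one>\<^bsub>K\<^esub>"
    have "g y [^]\<^bsub>H\<^esub> k = \<one>\<^bsub>H\<^esub>" using g.hom_nat_pow[OF y(1), of k] k g.hom_one by simp
    then have "g y = \<one>\<^bsub>H\<^esub>" using tf k(1) y(1) unfolding torsion_free_def by (meson g.hom_closed)
    then show False using fg[OF y(1)] y(2) f.hom_one by simp
  qed
  ultimately show ?thesis by (simp add: bieberbach_def)
qed

section \<open>Locally affine functions\<close>

text \<open>Unlike the Euclidean norm, the \<open>\<ell>\<^sub>1\<close>-norm needs no square roots; it is invariant under permutations of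
  coordinates, which is all that the action below requires.\<close>

definition l1_dist :: "nat \<Rightarrow> (nat \<Rightarrow> real) \<Rightarrow> (nat \<Rightarrow> real) \<Rightarrow> real"
  where "l1_dist N x y = (\<Sum>i<N. \<bar>x i - y i\<bar>)"

lemma Metric_space_l1_dist: "Metric_space (topspace (Euclidean_space N)) (l1_dist N)"
proof
  show "l1_dist N x y = l1_dist N y x" for x y
    by (simp add: l1_dist_def abs_minus_commute)
  show "0 \<le> l1_dist N x y" for x y
    by (simp add: l1_dist_def sum_nonneg)
  show "l1_dist N x y = 0 \<longleftrightarrow> x = y" if "x \<in> topspace (Euclidean_space N)" "y \<in> topspace (Euclidean_space N)" for x y
  proof -
    have "x i = y i" if "\<forall>i<N. x i = y i" for i
      using that \<open>x \<in> _\<close> \<open>y \<in> _\<close> by (cases "i < N") (auto simp: topspace_Euclidean_space)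
    then show ?thesis
      by (auto simp: l1_dist_def sum_nonneg_eq_0_iff fun_eq_iff)
  qed
  show "l1_dist N x z \<le> l1_dist N x y + l1_dist N y z" for x y z
    unfolding l1_dist_def sum.distrib[symmetric] by (rule sum_mono) linarith
qed

lemma abs_le_l1_dist: "i < N \<Longrightarrow> \<bar>x i - y i\<bar> \<le> l1_dist N x y"
  unfolding l1_dist_def by (rule member_le_sum) auto

lemma Euclidean_space_eq_top_of_set: "Euclidean_space N = top_of_set (topspace (Euclidean_space N))"
  by (simp add: Euclidean_space_def euclidean_product_topology)

lemma continuous_map_coordinate: "continuous_map (Euclidean_space N) euclideanreal (\<lambda>x. x i)"
  unfolding Euclidean_space_def
  by (intro continuous_map_from_subtopology continuous_map_product_coordinates) simp

lemma continuous_map_l1_dist: "continuous_map (Euclidean_space N) euclideanreal (l1_dist N x)"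
  unfolding l1_dist_def[abs_def]
  by (intro continuous_map_sum continuous_map_real_abs continuous_map_diff continuous_map_coordinate) auto

lemma openin_l1_ball: "openin (Euclidean_space N) {y \<in> topspace (Euclidean_space N). l1_dist N x y < r}"
proof -
  have "openin (Euclidean_space N) {y \<in> topspace (Euclidean_space N). l1_dist N x y \<in> {..<r}}"
    by (rule openin_continuous_map_preimage[OF continuous_map_l1_dist]) simp
  then show ?thesis by simp
qed

text \<open>Coordinates are 1-Lipschitz for \<open>l1_dist\<close>, so its topology is at least as
  fine as the Euclidean one; conversely its balls are open because the distance from a point is
  continuous.\<close>

lemma openin_Euclidean_space_iff:
  "openin (Euclidean_space N) U \<longleftrightarrow> U \<subseteq> topspace (Euclidean_space N) \<and>
    (\<forall>x\<in>U. \<exists>r>0. \<forall>y\<in>topspace (Euclidean_space N). l1_dist N x y < r \<longrightarrow> y \<in> U)" (is "?L \<longleftrightarrow> ?R")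
proof
  interpret D: Metric_space "topspace (Euclidean_space N)" "l1_dist N" by (rule Metric_space_l1_dist)
  show ?R if ?L
  proof -
    have coord: "continuous_map D.mtopology euclideanreal (\<lambda>x. x i)" if "i < N" for i
      unfolding mtopology_is_euclidean[symmetric] D.metric_continuous_map[OF Met_TC.Metric_space_axioms]
    proof (intro conjI ballI allI impI)
      fix a and e :: real assume "e > 0"
      have "dist (a i) (x i) < e" if "l1_dist N a x < e" for x
        using that abs_le_l1_dist[OF \<open>i < N\<close>, of a x] by (simp add: dist_real_def)
      then show "\<exists>\<delta>>0. \<forall>x. x \<in> topspace (Euclidean_space N) \<and> l1_dist N a x < \<delta> \<longrightarrow> dist (a i) (x i) < e"
        using \<open>e > 0\<close> by blast
    qed simp
    \<comment> \<open>The identity of the space, written so that continuity is checked coordinate by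
      coordinate.\<close>
    then have "continuous_map D.mtopology (Euclidean_space N) (\<lambda>x i. if i < N then x i else 0)"
      by (simp add: continuous_map_componentwise_Euclidean_space)
    then have "openin D.mtopology {x \<in> topspace D.mtopology. (\<lambda>i. if i < N then x i else 0) \<in> U}"
      using that by (rule openin_continuous_map_preimage)
    moreover have "(\<lambda>i. if i < N then x i else 0) = x" if "x \<in> topspace (Euclidean_space N)" for x
      using that by (auto simp: topspace_Euclidean_space fun_eq_iff)
    then have "{x \<in> topspace D.mtopology. (\<lambda>i. if i < N then x i else 0) \<in> U} = U"
      using openin_subset[OF \<open>?L\<close>] by (force simp: subset_iff)
    ultimately have "openin D.mtopology U" by simp
    then have U: "U \<subseteq> topspace (Euclidean_space N)" "\<And>x. x \<in> U \<Longrightarrow> \<exists>r>0. D.mball x r \<subseteq> U"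
      unfolding D.openin_mtopology by blast+
    have "\<exists>r>0. \<forall>y\<in>topspace (Euclidean_space N). l1_dist N x y < r \<longrightarrow> y \<in> U" if x: "x \<in> U" for x
    proof -
      obtain r where "r > 0" "D.mball x r \<subseteq> U" using U(2)[OF x] by blast
      moreover have "x \<in> topspace (Euclidean_space N)" using U(1) x by blast
      ultimately show ?thesis unfolding D.mball_def by blast
    qed
    then show ?R using U(1) by blast
  qed
  show ?L if ?R
  proof (subst openin_subopen, intro ballI)
    fix x assume x: "x \<in> U"
    then obtain r where r: "r > 0" "\<forall>y\<in>topspace (Euclidean_space N). l1_dist N x y < r \<longrightarrow> y \<in> U"
      using \<open>?R\<close> by blast
    have xE: "x \<in> topspace (Euclidean_space N)" using \<open>?R\<close> x by blast
    show "\<exists>T. openin (Euclidean_space N) T \<and> x \<in> T \<and> T \<subseteq> U"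
    proof (intro exI conjI)
      show "x \<in> {y \<in> topspace (Euclidean_space N). l1_dist N x y < r}" using xE r(1) by simp
      show "{y \<in> topspace (Euclidean_space N). l1_dist N x y < r} \<subseteq> U" using r(2) by blast
    qed (rule openin_l1_ball)
  qed
qed

lemma second_countable_Euclidean_space: "second_countable (Euclidean_space N)"
proof -
  obtain \<B> :: "(nat \<Rightarrow> real) set set" where "countable \<B>" "\<And>C. C \<in> \<B> \<Longrightarrow> open C"
    "\<And>S. open S \<Longrightarrow> \<exists>U. U \<subseteq> \<B> \<and> S = \<Union>U"
    using univ_second_countable by metis
  then have "second_countable (euclidean :: (nat \<Rightarrow> real) topology)"
    unfolding second_countable_def by (intro exI[of _ \<B>]) (auto, blast)
  then show ?thesis
    by (subst Euclidean_space_eq_top_of_set) (rule second_countable_subtopology)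
qed

lemma compactin_Euclidean_box:
  "compactin (Euclidean_space N) {x \<in> topspace (Euclidean_space N). \<forall>i<N. \<bar>x i\<bar> \<le> R}"
proof -
  let ?B = "\<lambda>i. if i < N then {-R..R} else {0 :: real}"
  have "compactin (powertop_real UNIV) (PiE UNIV ?B)"
    by (subst compactin_PiE) auto
  moreover have "PiE UNIV ?B = {x \<in> topspace (Euclidean_space N). \<forall>i<N. \<bar>x i\<bar> \<le> R}"
    by (auto simp: topspace_Euclidean_space PiE_iff abs_le_iff split: if_splits) (metis minus_le_iff)
  ultimately show ?thesis
    unfolding Euclidean_space_def compactin_subtopology by (auto simp: topspace_subtopology)
qed

text \<open>A class of functions that contains the transition maps and the constants and is closed
  under partial derivatives, so that smoothness follows by induction on the order.\<close>

definition locally_affine :: "nat \<Rightarrow> (nat \<Rightarrow> real) set \<Rightarrow> ((nat \<Rightarrow> real) \<Rightarrow> real) \<Rightarrow> bool"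
  where "locally_affine N U f \<longleftrightarrow>
    (\<forall>x\<in>U. \<exists>r>0. \<exists>a b. \<forall>y\<in>U. l1_dist N x y < r \<longrightarrow> f y = (\<Sum>j<N. a j * y j) + b)"

lemma affine_along_coordinate:
  assumes U: "openin (Euclidean_space N) U" and x: "x \<in> U" and r: "r > 0" and i: "i < N"
    and f: "\<And>y. y \<in> U \<Longrightarrow> l1_dist N x y < r \<Longrightarrow> f y = (\<Sum>j<N. a j * y j) + b"
  shows "((\<lambda>t. f (x(i := t))) has_field_derivative a i) (at (x i))" "partial_deriv i f x = a i"
proof -
  have E: "x \<in> topspace (Euclidean_space N)" using openin_subset[OF U] x by blast
  obtain r' where r': "r' > 0" "\<And>y. y \<in> topspace (Euclidean_space N) \<Longrightarrow> l1_dist N x y < r' \<Longrightarrow> y \<in> U"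
    using U x unfolding openin_Euclidean_space_iff by blast
  have "l1_dist N x (x(i := t)) = \<bar>x i - t\<bar>" for t
  proof -
    have "l1_dist N x (x(i := t)) = (\<Sum>j<N. if j = i then \<bar>x i - t\<bar> else 0)"
      unfolding l1_dist_def by (intro sum.cong) auto
    then show ?thesis using i by simp
  qed
  moreover have "x(i := t) \<in> topspace (Euclidean_space N)" for t
    using E i by (auto simp: topspace_Euclidean_space)
  ultimately have eq: "f (x(i := t)) = (\<Sum>j<N. a j * (x(i := t)) j) + b" if "dist t (x i) < min r r'" for t
    using that f r' by (simp add: dist_real_def abs_minus_commute)
  have "((\<lambda>t. (\<Sum>j<N. a j * (x(i := t)) j) + b) has_field_derivative (\<Sum>j<N. a j * (if j = i then 1 else 0)) + 0) (at (x i))"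
    by (intro derivative_intros) (auto intro!: derivative_eq_intros)
  then have "((\<lambda>t. (\<Sum>j<N. a j * (x(i := t)) j) + b) has_field_derivative a i) (at (x i))"
    using i by (simp only: mult.right_neutral mult_zero_right if_distrib[of "(*) _"] sum.delta' finite_lessThan lessThan_iff if_True add_0_right sum.delta)
  then show "((\<lambda>t. f (x(i := t))) has_field_derivative a i) (at (x i))"
    by (rule has_field_derivative_transform_within[where d = "min r r'"]) (use r r' eq in auto)
  then show "partial_deriv i f x = a i"
    unfolding partial_deriv_def by (rule DERIV_imp_deriv)
qed

lemma locally_affine_continuous:
  assumes U: "U \<subseteq> topspace (Euclidean_space N)" and f: "locally_affine N U f"
  shows "continuous_map (subtopology (Euclidean_space N) U) euclideanreal f"
  unfolding mtopology_is_euclidean[symmetric] Met_TC.continuous_map_to_metric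
proof (intro ballI allI impI)
  fix x and e :: real
  assume "x \<in> topspace (subtopology (Euclidean_space N) U)" and e: "e > 0"
  then have x: "x \<in> U" "x \<in> topspace (Euclidean_space N)" by auto
  then obtain r a b where r: "r > 0" and ab: "\<And>y. y \<in> U \<Longrightarrow> l1_dist N x y < r \<Longrightarrow> f y = (\<Sum>j<N. a j * y j) + b"
    using f unfolding locally_affine_def by metis
  \<comment> \<open>The added 1 keeps \<open>A\<close> positive when all coefficients vanish, so
    that \<open>e / A\<close> is a valid radius.\<close>
  define A where "A = (\<Sum>j<N. \<bar>a j\<bar>) + 1"
  have A: "A > 0" unfolding A_def by (intro add_nonneg_pos sum_nonneg) auto
  interpret D: Metric_space "topspace (Euclidean_space N)" "l1_dist N" by (rule Metric_space_l1_dist)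
  let ?V = "U \<inter> {y \<in> topspace (Euclidean_space N). l1_dist N x y < min r (e / A)}"
  have "openin (subtopology (Euclidean_space N) U) ?V"
    using openin_l1_ball by (rule openin_subtopology_Int2)
  moreover have "x \<in> ?V" using x r e A by simp
  moreover have "f y \<in> Met_TC.mball (f x) e" if y: "y \<in> ?V" for y
  proof -
    have "f x - f y = (\<Sum>j<N. a j * (x j - y j))"
      using y ab[of x] ab[of y] x r by (simp add: right_diff_distrib sum_subtractf)
    then have "\<bar>f x - f y\<bar> \<le> (\<Sum>j<N. \<bar>a j\<bar> * \<bar>x j - y j\<bar>)"
      by (simp add: abs_mult[symmetric])
    also have "\<dots> \<le> (\<Sum>j<N. \<bar>a j\<bar> * l1_dist N x y)"
      using abs_le_l1_dist by (intro sum_mono mult_left_mono) auto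
    also have "\<dots> \<le> A * l1_dist N x y"
      unfolding A_def sum_distrib_right[symmetric] by (simp add: distrib_right)
    also have "\<dots> < e" using y A by (simp add: field_simps)
    finally show ?thesis by (simp add: Met_TC.in_mball dist_real_def)
  qed
  ultimately show "\<exists>V. openin (subtopology (Euclidean_space N) U) V \<and> x \<in> V \<and> (\<forall>y\<in>V. f y \<in> Met_TC.mball (f x) e)"
    by blast
qed

lemma locally_affine_partial_deriv:
  assumes U: "openin (Euclidean_space N) U" and f: "locally_affine N U f" and i: "i < N"
  shows "locally_affine N U (partial_deriv i f)"
  unfolding locally_affine_def
proof
  interpret D: Metric_space "topspace (Euclidean_space N)" "l1_dist N" by (rule Metric_space_l1_dist)
  fix x assume x: "x \<in> U"
  obtain r a b where r: "r > 0" and ab: "\<And>y. y \<in> U \<Longrightarrow> l1_dist N x y < r \<Longrightarrow> f y = (\<Sum>j<N. a j * y j) + b"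
    using f x unfolding locally_affine_def by metis
  have "partial_deriv i f y = a i" if y: "y \<in> U" "l1_dist N x y < r" for y
  proof (rule affine_along_coordinate(2)[OF U y(1) _ i])
    \<comment> \<open>The remaining radius: by the triangle inequality this ball around
      \<open>y\<close> stays where the affine formula holds.\<close>
    show "0 < r - l1_dist N x y" using y by simp
    fix z assume z: "z \<in> U" "l1_dist N y z < r - l1_dist N x y"
    moreover have "l1_dist N x z \<le> l1_dist N x y + l1_dist N y z"
      using D.triangle[of x y z] x y z openin_subset[OF U] by blast
    ultimately show "f z = (\<Sum>j<N. a j * z j) + b" using ab by simp
  qed
  then show "\<exists>r>0. \<exists>a' b'. \<forall>y\<in>U. l1_dist N x y < r \<longrightarrow> partial_deriv i f y = (\<Sum>j<N. a' j * y j) + b'"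
    using r by (intro exI[of _ r] conjI exI[of _ "\<lambda>_. 0"] exI[of _ "a i"]) auto
qed

lemma smooth_on_locally_affine:
  assumes U: "openin (Euclidean_space N) U" and f: "locally_affine N U f"
  shows "smooth_on N U f"
  unfolding smooth_on_def
proof
  fix k
  show "C_k_on k N U f" using f
  proof (induction k arbitrary: f)
    case 0
    then show ?case using locally_affine_continuous openin_subset[OF U] by simp
  next
    case (Suc k)
    have "(\<lambda>t. f (x(i := t))) differentiable (at (x i))" if x: "x \<in> U" and i: "i < N" for x i
    proof -
      obtain r a b where r: "r > 0" "\<And>y. y \<in> U \<Longrightarrow> l1_dist N x y < r \<Longrightarrow> f y = (\<Sum>j<N. a j * y j) + b"
        using Suc.prems x unfolding locally_affine_def by metis
      show ?thesis
        using affine_along_coordinate(1)[OF U x r(1) i r(2)] by (rule field_differentiable_imp_differentiable[unfolded field_differentiable_def, OF exI])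
    qed
    then show ?case
      using Suc.IH[OF locally_affine_partial_deriv[OF U Suc.prems]]
        locally_affine_continuous[OF openin_subset[OF U] Suc.prems] by simp
  qed
qed

lemma partial_deriv_const [simp]: "partial_deriv i (\<lambda>_. c) = (\<lambda>_. 0)"
  by (simp add: partial_deriv_def fun_eq_iff)

text \<open>The derivatives of a constant metric vanish, hence so do the Christoffel symbols,
  whatever \<open>matrix_inverse\<close> returns.\<close>

lemma riemann_curvature_const: "riemann_curvature N (\<lambda>_. h) l k i j x = 0"
proof -
  have "christoffel N (\<lambda>_. h) = (\<lambda>k i j x. 0)"
    by (simp add: christoffel_def fun_eq_iff)
  then show ?thesis by (simp add: riemann_curvature_def)
qed

section \<open>Quotients by flat actions\<close>

text \<open>Linear parts are permutations of coordinates. They preserve \<open>l1_dist\<close>, and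
  as Jacobians of transition maps they preserve the standard metric.\<close>

locale affine_action = group \<Gamma> for \<Gamma> :: "('a, 'b) monoid_scheme" (structure) +
  fixes N :: nat and act :: "'a \<Rightarrow> (nat \<Rightarrow> real) \<Rightarrow> nat \<Rightarrow> real"
  assumes act_closed: "\<gamma> \<in> carrier \<Gamma> \<Longrightarrow> x \<in> topspace (Euclidean_space N) \<Longrightarrow> act \<gamma> x \<in> topspace (Euclidean_space N)"
    and act_one: "x \<in> topspace (Euclidean_space N) \<Longrightarrow> act \<one> x = x"
    and act_mult: "\<gamma> \<in> carrier \<Gamma> \<Longrightarrow> \<delta> \<in> carrier \<Gamma> \<Longrightarrow> x \<in> topspace (Euclidean_space N) \<Longrightarrow>
      act (\<gamma> \<otimes> \<delta>) x = act \<gamma> (act \<delta> x)"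
    and act_affine: "\<gamma> \<in> carrier \<Gamma> \<Longrightarrow> \<exists>\<pi> b. \<pi> permutes {..<N} \<and>
      (\<forall>x\<in>topspace (Euclidean_space N). \<forall>i<N. act \<gamma> x i = x (\<pi> i) + b i)"
begin

abbreviation E :: "(nat \<Rightarrow> real) set" where "E \<equiv> topspace (Euclidean_space N)"

abbreviation D :: "(nat \<Rightarrow> real) \<Rightarrow> (nat \<Rightarrow> real) \<Rightarrow> real" where "D \<equiv> l1_dist N"

sublocale D: Metric_space E D by (rule Metric_space_l1_dist)

lemma act_isometry:
  assumes "\<gamma> \<in> carrier \<Gamma>" "x \<in> E" "y \<in> E"
  shows "D (act \<gamma> x) (act \<gamma> y) = D x y"
proof -
  obtain \<pi> b where \<pi>: "\<pi> permutes {..<N}" "\<And>x i. x \<in> E \<Longrightarrow> i < N \<Longrightarrow> act \<gamma> x i = x (\<pi> i) + b i"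
    using act_affine[OF assms(1)] by blast
  have "D (act \<gamma> x) (act \<gamma> y) = (\<Sum>i<N. \<bar>x (\<pi> i) - y (\<pi> i)\<bar>)"
    unfolding l1_dist_def using \<pi>(2) assms by (intro sum.cong) auto
  also have "\<dots> = (\<Sum>i<N. \<bar>x i - y i\<bar>)"
    using sum.permute[OF \<pi>(1), of "\<lambda>i. \<bar>x i - y i\<bar>"] by (simp add: o_def)
  finally show ?thesis by (simp add: l1_dist_def)
qed

lemma act_inv:
  assumes "\<gamma> \<in> carrier \<Gamma>" "x \<in> E"
  shows "act (inv \<gamma>) (act \<gamma> x) = x" "act \<gamma> (act (inv \<gamma>) x) = x"
  using assms by (simp_all add: act_mult[symmetric] act_one)

text \<open>By isometry each further application of \<gamma> moves the point by the same distance. A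
  lower bound for a power thus gives one for \<gamma>.\<close>

lemma displacement_pow:
  assumes "\<gamma> \<in> carrier \<Gamma>" "x \<in> E"
  shows "D x (act (\<gamma> [^] (j :: nat)) x) \<le> j * D x (act \<gamma> x)"
proof (induction j)
  case 0
  then show ?case using assms by (simp add: act_one)
next
  case (Suc j)
  have "D x (act (\<gamma> [^] Suc j) x) \<le> D x (act (\<gamma> [^] j) x) + D (act (\<gamma> [^] j) x) (act (\<gamma> [^] Suc j) x)"
    using assms by (intro D.triangle act_closed) auto
  also have "D (act (\<gamma> [^] j) x) (act (\<gamma> [^] Suc j) x) = D x (act \<gamma> x)"
    using assms by (simp add: act_mult act_isometry act_closed)
  finally show ?case using Suc by (simp add: algebra_simps)
qed

end

text \<open>The uniform bound \<epsilon> expresses freeness and proper discontinuity in one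
  condition; the box of radius \<open>R\<close> meets every orbit.\<close>

locale flat_action = affine_action +
  fixes \<epsilon> R :: real
  assumes eps_pos: "\<epsilon> > 0"
    and displacement: "\<gamma> \<in> carrier \<Gamma> \<Longrightarrow> \<gamma> \<noteq> \<one> \<Longrightarrow> x \<in> E \<Longrightarrow> \<epsilon> \<le> D x (act \<gamma> x)"
    and cocompact: "x \<in> E \<Longrightarrow> \<exists>\<gamma>\<in>carrier \<Gamma>. \<forall>i<N. \<bar>act \<gamma> x i\<bar> \<le> R"
begin

section \<open>The metric space of orbits\<close>

definition orb :: "(nat \<Rightarrow> real) \<Rightarrow> (nat \<Rightarrow> real) set"
  where "orb x = (\<lambda>\<gamma>. act \<gamma> x) ` carrier \<Gamma>"

lemma orb_mem: "x \<in> E \<Longrightarrow> x \<in> orb x"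
  unfolding orb_def by (rule image_eqI[of _ _ \<one>]) (simp_all add: act_one)

lemma orb_act:
  assumes "\<gamma> \<in> carrier \<Gamma>" "x \<in> E"
  shows "orb (act \<gamma> x) = orb x"
proof -
  have "orb (act \<gamma> x) \<subseteq> orb x" if "\<gamma> \<in> carrier \<Gamma>" "x \<in> E" for \<gamma> x
    unfolding orb_def
  proof clarify
    fix \<delta> assume "\<delta> \<in> carrier \<Gamma>"
    then show "act \<delta> (act \<gamma> x) \<in> (\<lambda>\<gamma>. act \<gamma> x) ` carrier \<Gamma>"
      using that by (intro image_eqI[of _ _ "\<delta> \<otimes> \<gamma>"]) (simp_all add: act_mult)
  qed
  from this[OF assms] this[of "inv \<gamma>" "act \<gamma> x"] show ?thesis
    using assms by (simp add: act_inv act_closed subset_antisym)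
qed

lemma orb_eq_iff:
  assumes "x \<in> E" "y \<in> E"
  shows "orb x = orb y \<longleftrightarrow> (\<exists>\<gamma>\<in>carrier \<Gamma>. y = act \<gamma> x)"
proof
  assume "orb x = orb y"
  then have "y \<in> orb x" using orb_mem[OF assms(2)] by simp
  then show "\<exists>\<gamma>\<in>carrier \<Gamma>. y = act \<gamma> x" by (auto simp: orb_def)
qed (use orb_act assms in auto)

definition orbits :: "(nat \<Rightarrow> real) set set" where "orbits = orb ` E"

text \<open>The absolute value only matters for empty sets, whose infimum is unspecified.\<close>

definition orb_dist :: "(nat \<Rightarrow> real) set \<Rightarrow> (nat \<Rightarrow> real) set \<Rightarrow> real"
  where "orb_dist A B = \<bar>Inf {D x y | x y. x \<in> A \<and> y \<in> B}\<bar>"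

text \<open>Since the action is isometric, a pair \<open>act \<alpha> x\<close>,
  \<open>act \<beta> y\<close> may be moved back so that its first point is \<open>x\<close>. Strict
  inequalities avoid asking whether the infimum is attained.\<close>

lemma orb_dist_less_iff:
  assumes xy: "x \<in> E" "y \<in> E"
  shows "orb_dist (orb x) (orb y) < r \<longleftrightarrow> (\<exists>\<gamma>\<in>carrier \<Gamma>. D x (act \<gamma> y) < r)"
proof -
  have ne: "{D x' y' | x' y'. x' \<in> orb x \<and> y' \<in> orb y} \<noteq> {}" using orb_mem xy by blast
  then have "Inf {D x' y' | x' y'. x' \<in> orb x \<and> y' \<in> orb y} \<ge> 0"
    by (rule cInf_greatest) auto
  then have "orb_dist (orb x) (orb y) = Inf {D x' y' | x' y'. x' \<in> orb x \<and> y' \<in> orb y}"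
    by (simp add: orb_dist_def)
  then have "orb_dist (orb x) (orb y) < r \<longleftrightarrow> Inf {D x' y' | x' y'. x' \<in> orb x \<and> y' \<in> orb y} < r"
    by simp
  also have "\<dots> \<longleftrightarrow> (\<exists>d\<in>{D x' y' | x' y'. x' \<in> orb x \<and> y' \<in> orb y}. d < r)"
  proof (rule cInf_less_iff[OF ne])
    show "bdd_below {D x' y' | x' y'. x' \<in> orb x \<and> y' \<in> orb y}"
      by (rule bdd_belowI[of _ 0]) auto
  qed
  also have "\<dots> \<longleftrightarrow> (\<exists>\<gamma>\<in>carrier \<Gamma>. D x (act \<gamma> y) < r)"
  proof
    assume "\<exists>d\<in>{D x' y' | x' y'. x' \<in> orb x \<and> y' \<in> orb y}. d < r"
    then obtain \<alpha> \<beta> where ab: "\<alpha> \<in> carrier \<Gamma>" "\<beta> \<in> carrier \<Gamma>" "D (act \<alpha> x) (act \<beta> y) < r"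
      unfolding orb_def by blast
    have "D x (act (inv \<alpha> \<otimes> \<beta>) y) = D (act \<alpha> x) (act \<alpha> (act (inv \<alpha>) (act \<beta> y)))"
      using ab xy by (simp add: act_isometry act_mult act_closed)
    also have "\<dots> < r" using ab xy by (simp add: act_inv act_closed)
    finally show "\<exists>\<gamma>\<in>carrier \<Gamma>. D x (act \<gamma> y) < r" using ab by blast
  next
    assume "\<exists>\<gamma>\<in>carrier \<Gamma>. D x (act \<gamma> y) < r"
    then show "\<exists>d\<in>{D x' y' | x' y'. x' \<in> orb x \<and> y' \<in> orb y}. d < r"
      using orb_mem[OF xy(1)] unfolding orb_def[of y] by blast
  qed
  finally show ?thesis .
qed

lemma orb_dist_le: "x \<in> E \<Longrightarrow> y \<in> E \<Longrightarrow> orb_dist (orb x) (orb y) \<le> D x y"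
proof (rule dense_ge)
  fix r assume "x \<in> E" "y \<in> E" "D x y < r"
  then have "orb_dist (orb x) (orb y) < r"
    unfolding orb_dist_less_iff[OF \<open>x \<in> E\<close> \<open>y \<in> E\<close>] by (intro bexI[of _ \<one>]) (simp_all add: act_one)
  then show "orb_dist (orb x) (orb y) \<le> r" by simp
qed

text \<open>A translate of \<open>y\<close> closer to \<open>x\<close> would lie at distance less
  than \<epsilon> from \<open>y\<close>, against the displacement bound. So \<open>orb\<close> is a
  local isometry.\<close>

lemma orb_dist_eq:
  assumes xy: "x \<in> E" "y \<in> E" and less: "D x y < \<epsilon> / 2"
  shows "orb_dist (orb x) (orb y) = D x y"
proof (rule antisym)
  show "orb_dist (orb x) (orb y) \<le> D x y" by (rule orb_dist_le[OF xy])
  show "D x y \<le> orb_dist (orb x) (orb y)"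
  proof (rule ccontr)
    assume "\<not> D x y \<le> orb_dist (orb x) (orb y)"
    then obtain \<gamma> where \<gamma>: "\<gamma> \<in> carrier \<Gamma>" "D x (act \<gamma> y) < D x y"
      using orb_dist_less_iff[OF xy] by (meson not_le)
    then have "\<gamma> \<noteq> \<one>" using xy act_one by auto
    then have "\<epsilon> \<le> D y (act \<gamma> y)" using displacement \<gamma> xy by blast
    also have "\<dots> \<le> D y x + D x (act \<gamma> y)" using D.triangle xy \<gamma> act_closed by blast
    also have "\<dots> < \<epsilon>" using \<gamma> less by (simp add: D.commute)
    finally show False by simp
  qed
qed

lemma orb_dist_lift:
  assumes "x \<in> E" "A \<in> orbits" "orb_dist (orb x) A < r"
  obtains y where "y \<in> E" "orb y = A" "D x y < r"
proof -
  obtain z where z: "z \<in> E" "A = orb z" using assms(2) by (auto simp: orbits_def)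
  then obtain \<gamma> where "\<gamma> \<in> carrier \<Gamma>" "D x (act \<gamma> z) < r"
    using orb_dist_less_iff[OF assms(1) z(1)] assms(3) by blast
  then show ?thesis using that[of "act \<gamma> z"] z act_closed orb_act by blast
qed

text \<open>For the triangle inequality, a point of the first orbit is followed by nearly nearest
  points of the second and then of the third. Definiteness comes from lifts within
  \<open>\<epsilon> / 2\<close>, where the orbit distance is the true one.\<close>

lemma Metric_space_orb_dist: "Metric_space orbits orb_dist"
proof
  show "0 \<le> orb_dist A B" for A B
    by (simp add: orb_dist_def)
  show "orb_dist A B = orb_dist B A" for A B
    unfolding orb_dist_def by (rule arg_cong[where f = "\<lambda>S. \<bar>Inf S\<bar>"]) (use D.commute in blast)
  show "orb_dist A B = 0 \<longleftrightarrow> A = B" if AB: "A \<in> orbits" "B \<in> orbits" for A B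
  proof -
    obtain x where x: "x \<in> E" "A = orb x" using AB by (auto simp: orbits_def)
    show ?thesis
    proof
      assume 0: "orb_dist A B = 0"
      then obtain y where y: "y \<in> E" "orb y = B" "D x y < \<epsilon> / 2"
        using orb_dist_lift[OF x(1) AB(2), of "\<epsilon> / 2"] x eps_pos by auto
      then have "D x y = 0" using orb_dist_eq[OF x(1) y(1,3)] x 0 by simp
      then show "A = B" using x y by simp
    next
      assume "A = B"
      then show "orb_dist A B = 0" using orb_dist_eq[OF x(1) x(1)] x eps_pos by simp
    qed
  qed
  show "orb_dist A C \<le> orb_dist A B + orb_dist B C" if ABC: "A \<in> orbits" "B \<in> orbits" "C \<in> orbits" for A B C
  proof (rule field_le_epsilon)
    fix e :: real assume e: "e > 0"
    obtain x where x: "x \<in> E" "A = orb x" using ABC by (auto simp: orbits_def)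
    obtain y where y: "y \<in> E" "orb y = B" "D x y < orb_dist A B + e / 2"
      using orb_dist_lift[OF x(1) ABC(2), of "orb_dist A B + e / 2"] x e by auto
    obtain z where z: "z \<in> E" "orb z = C" "D y z < orb_dist B C + e / 2"
      using orb_dist_lift[OF y(1) ABC(3), of "orb_dist B C + e / 2"] y e by auto
    have "orb_dist A C \<le> D x z" using orb_dist_le x z by blast
    also have "\<dots> \<le> D x y + D y z" using D.triangle x y z by blast
    finally show "orb_dist A C \<le> orb_dist A B + orb_dist B C + e" using y z by simp
  qed
qed

sublocale orb: Metric_space orbits orb_dist by (rule Metric_space_orb_dist)

abbreviation X :: "(nat \<Rightarrow> real) set topology" where "X \<equiv> orb.mtopology"

lemma orb_in_orbits: "x \<in> E \<Longrightarrow> orb x \<in> orbits"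
  by (simp add: orbits_def)

lemma continuous_orb: "continuous_map (Euclidean_space N) X orb"
  unfolding orb.continuous_map_to_metric
proof (intro ballI allI impI)
  fix x and e :: real assume x: "x \<in> E" and e: "e > 0"
  show "\<exists>U. openin (Euclidean_space N) U \<and> x \<in> U \<and> (\<forall>y\<in>U. orb y \<in> orb.mball (orb x) e)"
  proof (intro exI conjI ballI)
    show "openin (Euclidean_space N) {y \<in> E. D x y < e}" by (rule openin_l1_ball)
    show "x \<in> {y \<in> E. D x y < e}" using x e by simp
    fix y assume "y \<in> {y \<in> E. D x y < e}"
    then show "orb y \<in> orb.mball (orb x) e"
      using x orb_dist_le[OF x, of y] by (auto simp: orb_in_orbits)
  qed
qed

lemma open_orb: "open_map (Euclidean_space N) X orb"
  unfolding open_map_def orb.openin_mtopology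
proof (intro allI impI conjI)
  fix U assume U: "openin (Euclidean_space N) U"
  then show "orb ` U \<subseteq> orbits" using openin_subset orb_in_orbits by blast
  fix A assume "A \<in> orb ` U"
  then obtain x where x: "x \<in> U" "A = orb x" by blast
  then obtain r where r: "r > 0" "\<And>y. y \<in> E \<Longrightarrow> D x y < r \<Longrightarrow> y \<in> U"
    using U unfolding openin_Euclidean_space_iff by blast
  have xE: "x \<in> E" using U x openin_subset by blast
  have "orb.mball A r \<subseteq> orb ` U"
  proof
    fix B assume "B \<in> orb.mball A r"
    then obtain y where "y \<in> E" "orb y = B" "D x y < r"
      using orb_dist_lift[OF xE, of B r] x by auto
    then show "B \<in> orb ` U" using r by blast
  qed
  then show "\<exists>r>0. orb.mball A r \<subseteq> orb ` U" using r by blast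
qed

lemma orb_image_E: "orb ` E = topspace X"
  unfolding orb.topspace_mtopology by (simp add: orbits_def)

text \<open>With radius \<open>\<epsilon> / 4\<close> any two points of the ball are less than
  \<open>\<epsilon> / 2\<close> apart, so \<open>orb\<close> is isometric, hence injective, on
  it.\<close>

definition ball_at :: "(nat \<Rightarrow> real) \<Rightarrow> (nat \<Rightarrow> real) set"
  where "ball_at x = {y \<in> E. D x y < \<epsilon> / 4}"

lemma openin_ball_at: "openin (Euclidean_space N) (ball_at x)"
  unfolding ball_at_def by (rule openin_l1_ball)

lemma orb_dist_ball_at:
  assumes "x \<in> E" "y \<in> ball_at x" "z \<in> ball_at x"
  shows "orb_dist (orb y) (orb z) = D y z"
proof (rule orb_dist_eq)
  show "y \<in> E" "z \<in> E" using assms by (auto simp: ball_at_def)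
  then show "D y z < \<epsilon> / 2"
    using D.triangle[of y x z] assms by (auto simp: ball_at_def D.commute)
qed

lemma inj_on_ball_at: "x \<in> E \<Longrightarrow> inj_on orb (ball_at x)"
proof (rule inj_onI)
  fix y z assume x: "x \<in> E" and yz: "y \<in> ball_at x" "z \<in> ball_at x" "orb y = orb z"
  have E: "y \<in> E" "z \<in> E" using yz by (auto simp: ball_at_def)
  have "orb_dist (orb y) (orb z) = 0" using yz E orb_in_orbits by simp
  then show "y = z" using orb_dist_ball_at[OF x yz(1,2)] E by simp
qed

definition local_chart :: "(nat \<Rightarrow> real) \<Rightarrow> (nat \<Rightarrow> real) set chart"
  where "local_chart x = (orb ` ball_at x, inv_into (ball_at x) orb)"

lemma local_chart_image: "x \<in> E \<Longrightarrow> snd (local_chart x) ` fst (local_chart x) = ball_at x"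
  using inj_on_ball_at by (simp add: local_chart_def image_image)

lemma local_chart_homeomorphic:
  assumes x: "x \<in> E"
  shows "homeomorphic_map (subtopology X (fst (local_chart x))) (subtopology (Euclidean_space N) (ball_at x)) (snd (local_chart x))"
proof -
  have sub: "ball_at x \<subseteq> E" by (auto simp: ball_at_def)
  then have tops: "topspace (subtopology (Euclidean_space N) (ball_at x)) = ball_at x"
    "topspace (subtopology X (orb ` ball_at x)) = orb ` ball_at x"
    using orb_in_orbits by auto
  have "homeomorphic_map (subtopology (Euclidean_space N) (ball_at x)) (subtopology X (orb ` ball_at x)) orb"
  proof (rule bijective_open_imp_homeomorphic_map)
    show "continuous_map (subtopology (Euclidean_space N) (ball_at x)) (subtopology X (orb ` ball_at x)) orb"
      using continuous_orb by (auto simp: continuous_map_in_subtopology continuous_map_from_subtopology)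
    show "open_map (subtopology (Euclidean_space N) (ball_at x)) (subtopology X (orb ` ball_at x)) orb"
      using open_map_from_subtopology[OF open_orb openin_ball_at] tops
      by (intro open_map_into_subtopology) auto
  qed (use tops inj_on_ball_at[OF x] in simp_all)
  then obtain g where "homeomorphic_maps (subtopology (Euclidean_space N) (ball_at x)) (subtopology X (orb ` ball_at x)) orb g"
    unfolding homeomorphic_map_maps by blast
  then have g: "homeomorphic_map (subtopology X (orb ` ball_at x)) (subtopology (Euclidean_space N) (ball_at x)) g"
    "\<And>y. y \<in> ball_at x \<Longrightarrow> g (orb y) = y"
    unfolding homeomorphic_maps_map tops by blast+
  show ?thesis
    unfolding local_chart_def fst_conv snd_conv
  proof (rule homeomorphic_map_eq[OF g(1)])
    fix A assume "A \<in> topspace (subtopology X (orb ` ball_at x))"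
    then obtain y where "y \<in> ball_at x" "A = orb y" unfolding tops by blast
    then show "g A = inv_into (ball_at x) orb A" using g(2) inj_on_ball_at[OF x] by simp
  qed
qed

lemma chart_overlap:
  assumes x: "x \<in> E"
  shows "snd (local_chart x) ` (fst (local_chart x) \<inter> fst (local_chart y)) = {z \<in> ball_at x. orb z \<in> orb ` ball_at y}"
proof
  show "snd (local_chart x) ` (fst (local_chart x) \<inter> fst (local_chart y)) \<subseteq> {z \<in> ball_at x. orb z \<in> orb ` ball_at y}"
  proof
    fix z assume "z \<in> snd (local_chart x) ` (fst (local_chart x) \<inter> fst (local_chart y))"
    then obtain v where "v \<in> ball_at x" "orb v \<in> orb ` ball_at y" "z = inv_into (ball_at x) orb (orb v)"
      unfolding local_chart_def fst_conv snd_conv by blast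
    then show "z \<in> {z \<in> ball_at x. orb z \<in> orb ` ball_at y}" using inj_on_ball_at[OF x] by simp
  qed
  show "{z \<in> ball_at x. orb z \<in> orb ` ball_at y} \<subseteq> snd (local_chart x) ` (fst (local_chart x) \<inter> fst (local_chart y))"
  proof
    fix z assume z: "z \<in> {z \<in> ball_at x. orb z \<in> orb ` ball_at y}"
    then have "z = inv_into (ball_at x) orb (orb z)" using inj_on_ball_at[OF x] by simp
    then show "z \<in> snd (local_chart x) ` (fst (local_chart x) \<inter> fst (local_chart y))"
      using z unfolding local_chart_def fst_conv snd_conv by blast
  qed
qed

text \<open>Near \<open>z\<close> the transition map is the action of one group element, namely one
  that moves \<open>z\<close> into the other ball. The element may change over the overlap, so the
  formula is only local.\<close>

lemma transition_locally_affine: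
  assumes xy: "x \<in> E" "y \<in> E"
    and z: "z \<in> snd (local_chart x) ` (fst (local_chart x) \<inter> fst (local_chart y))"
  obtains \<pi> b r where "\<pi> permutes {..<N}" "r > 0"
    "\<And>w i. w \<in> snd (local_chart x) ` (fst (local_chart x) \<inter> fst (local_chart y)) \<Longrightarrow> D z w < r \<Longrightarrow> i < N \<Longrightarrow>
      transition (local_chart x) (local_chart y) w i = w (\<pi> i) + b i"
proof -
  have dom: "w \<in> ball_at x \<and> orb w \<in> orb ` ball_at y \<and>
      transition (local_chart x) (local_chart y) w = inv_into (ball_at y) orb (orb w)"
    if w: "w \<in> snd (local_chart x) ` (fst (local_chart x) \<inter> fst (local_chart y))" for w
  proof -
    have v: "w \<in> ball_at x" "orb w \<in> orb ` ball_at y" using w unfolding chart_overlap[OF xy(1)] by auto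
    have inj: "inj_on (inv_into (ball_at x) orb) (orb ` ball_at x)" by (rule inj_on_inv_into) simp
    have "inv_into (orb ` ball_at x) (inv_into (ball_at x) orb) w = orb w"
      using inv_into_f_f[OF inj, of "orb w"] inv_into_f_f[OF inj_on_ball_at[OF xy(1)] v(1)] v by simp
    then show ?thesis using v by (simp add: transition_def local_chart_def)
  qed
  obtain v where v: "v \<in> ball_at y" "orb z = orb v" using dom[OF z] by auto
  have zE: "z \<in> E" and vE: "v \<in> E" using dom[OF z] v by (auto simp: ball_at_def)
  obtain \<gamma> where \<gamma>: "\<gamma> \<in> carrier \<Gamma>" "v = act \<gamma> z" using v orb_eq_iff[OF zE vE] by blast
  obtain \<pi> b where \<pi>: "\<pi> permutes {..<N}" "\<And>x i. x \<in> E \<Longrightarrow> i < N \<Longrightarrow> act \<gamma> x i = x (\<pi> i) + b i"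
    using act_affine[OF \<gamma>(1)] by blast
  show ?thesis
  proof (rule that[OF \<pi>(1)])
    \<comment> \<open>Within this radius of \<open>z\<close> the translate
      \<open>act \<gamma> w\<close> remains in \<open>ball_at y\<close>, where the inverse of
      \<open>orb\<close> recovers it.\<close>
    show "\<epsilon> / 4 - D y v > 0" using v by (simp add: ball_at_def)
    fix w i assume w: "w \<in> snd (local_chart x) ` (fst (local_chart x) \<inter> fst (local_chart y))"
      and less: "D z w < \<epsilon> / 4 - D y v" and i: "i < N"
    have wE: "w \<in> E" using dom[OF w] by (auto simp: ball_at_def)
    have "D y (act \<gamma> w) \<le> D y v + D v (act \<gamma> w)"
      using D.triangle xy vE act_closed[OF \<gamma>(1) wE] by blast
    also have "D v (act \<gamma> w) = D z w" using \<gamma> act_isometry zE wE by simp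
    finally have "act \<gamma> w \<in> ball_at y" using less act_closed[OF \<gamma>(1) wE] by (simp add: ball_at_def)
    then have "inv_into (ball_at y) orb (orb w) = act \<gamma> w"
      using inv_into_f_f[OF inj_on_ball_at[OF xy(2)], of "act \<gamma> w"] orb_act[OF \<gamma>(1) wE] by simp
    then show "transition (local_chart x) (local_chart y) w i = w (\<pi> i) + b i"
      using dom[OF w] \<pi>(2)[OF wE i] by simp
  qed
qed

lemma openin_chart_overlap:
  assumes xy: "x \<in> E" "y \<in> E"
  shows "openin (Euclidean_space N) (snd (local_chart x) ` (fst (local_chart x) \<inter> fst (local_chart y)))"
proof -
  have "{z \<in> ball_at x. orb z \<in> orb ` ball_at y} = ball_at x \<inter> {z \<in> E. orb z \<in> orb ` ball_at y}"
    by (auto simp: ball_at_def)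
  moreover have "openin X (orb ` ball_at y)"
    using open_orb openin_ball_at by (simp add: open_map_def)
  then have "openin (Euclidean_space N) {z \<in> E. orb z \<in> orb ` ball_at y}"
    by (rule openin_continuous_map_preimage[OF continuous_orb])
  ultimately show ?thesis unfolding chart_overlap[OF xy(1)] using openin_ball_at[of x] by (simp only: openin_Int)
qed

section \<open>Smooth structure, metric and curvature of the quotient\<close>

definition charts :: "(nat \<Rightarrow> real) set chart set" where "charts = local_chart ` E"

lemma smooth_atlas_charts: "smooth_atlas N X charts"
  unfolding smooth_atlas_def
proof (intro conjI)
  have "fst (local_chart x) \<subseteq> orbits" for x
    using orb_in_orbits by (auto simp: local_chart_def ball_at_def)
  moreover have "orb x \<in> fst (local_chart x)" if "x \<in> E" for x
    using that eps_pos by (auto simp: local_chart_def ball_at_def)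
  ultimately have "(\<Union>x\<in>E. fst (local_chart x)) = orbits"
    unfolding orbits_def by blast
  then show "(\<Union>c\<in>charts. fst c) = topspace X"
    by (simp add: charts_def)
  have "openin X U \<and> openin (Euclidean_space N) (\<phi> ` U) \<and>
      homeomorphic_map (subtopology X U) (subtopology (Euclidean_space N) (\<phi> ` U)) \<phi>"
    if U\<phi>: "(U, \<phi>) \<in> charts" for U \<phi>
  proof -
    obtain x where x: "x \<in> E" "(U, \<phi>) = local_chart x" using U\<phi> unfolding charts_def by blast
    then have U: "U = fst (local_chart x)" "\<phi> = snd (local_chart x)" by (simp_all add: prod_eq_iff)
    show ?thesis
      unfolding U local_chart_image[OF x(1)]
      using local_chart_homeomorphic[OF x(1)] openin_ball_at open_orb by (simp add: local_chart_def open_map_def)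
  qed
  then show "\<forall>(U, \<phi>)\<in>charts. openin X U \<and> openin (Euclidean_space N) (\<phi> ` U) \<and>
      homeomorphic_map (subtopology X U) (subtopology (Euclidean_space N) (\<phi> ` U)) \<phi>"
    by blast
  show "\<forall>c\<in>charts. \<forall>d\<in>charts. \<forall>k<N. smooth_on N (snd c ` (fst c \<inter> fst d)) (\<lambda>x. transition c d x k)"
  proof (intro ballI allI impI)
    fix c d k assume "c \<in> charts" "d \<in> charts" and k: "k < N"
    then obtain x y where xy: "x \<in> E" "y \<in> E" and cd: "c = local_chart x" "d = local_chart y"
      by (auto simp: charts_def)
    let ?W = "snd (local_chart x) ` (fst (local_chart x) \<inter> fst (local_chart y))"
      and ?T = "\<lambda>z. transition (local_chart x) (local_chart y) z k"
    have "smooth_on N ?W ?T"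
    proof (rule smooth_on_locally_affine[OF openin_chart_overlap[OF xy]])
      show "locally_affine N ?W ?T"
        unfolding locally_affine_def
      proof
        fix z assume z: "z \<in> ?W"
        obtain \<pi> b r where \<pi>: "\<pi> permutes {..<N}" "r > 0"
          "\<And>w i. w \<in> ?W \<Longrightarrow> D z w < r \<Longrightarrow> i < N \<Longrightarrow> transition (local_chart x) (local_chart y) w i = w (\<pi> i) + b i"
          using transition_locally_affine[OF xy z] by metis
        have "\<pi> k < N" using permutes_in_image[OF \<pi>(1), of k] k by simp
        then have "(\<Sum>j<N. (if j = \<pi> k then 1 else 0) * w j) = w (\<pi> k)" for w :: "nat \<Rightarrow> real"
          by (simp add: if_distrib[of "\<lambda>x. x * _"] cong: if_cong)
        then show "\<exists>r>0. \<exists>a b. \<forall>w\<in>?W. D z w < r \<longrightarrow> ?T w = (\<Sum>j<N. a j * w j) + b"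
          using \<pi>(2,3) k by (intro exI[of _ r] conjI exI[of _ "\<lambda>j. if j = \<pi> k then 1 else 0"] exI[of _ "b k"]) auto
      qed
    qed
    then show "smooth_on N (snd c ` (fst c \<inter> fst d)) (\<lambda>z. transition c d z k)" unfolding cd .
  qed
qed

definition standard_metric :: metric_components
  where "standard_metric x i j = (if i = j then 1 else 0)"

lemma riemannian_metric_charts: "riemannian_metric N charts (\<lambda>_. standard_metric)"
  unfolding riemannian_metric_def
proof (intro conjI ballI allI impI)
  fix c i j assume "c \<in> charts"
  then obtain x where x: "x \<in> E" "c = local_chart x" by (auto simp: charts_def)
  show "smooth_on N (snd c ` fst c) (\<lambda>x. standard_metric x i j)"
    unfolding x(2) local_chart_image[OF x(1)]
  proof (rule smooth_on_locally_affine[OF openin_ball_at])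
    show "locally_affine N (ball_at x) (\<lambda>x. standard_metric x i j)"
      unfolding locally_affine_def standard_metric_def
      by (intro ballI exI[of _ 1] conjI exI[of _ "\<lambda>_. 0"] exI[of _ "if i = j then 1 else 0"]) auto
  qed
next
  fix x :: "nat \<Rightarrow> real" and i j show "standard_metric x i j = standard_metric x j i"
    by (simp add: standard_metric_def)
next
  fix x :: "nat \<Rightarrow> real" and v :: "nat \<Rightarrow> real" assume "\<exists>i<N. v i \<noteq> 0"
  then obtain i where i: "i < N" "v i \<noteq> 0" by blast
  have "(\<Sum>i<N. \<Sum>j<N. standard_metric x i j * v i * v j) = (\<Sum>i<N. v i * v i)"
    by (intro sum.cong) (simp_all add: standard_metric_def if_distrib[of "\<lambda>x. x * _"] cong: if_cong)
  also have "\<dots> > 0" using i by (intro sum_pos2[of _ i]) (auto simp: zero_less_mult_iff less_le)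
  finally show "(\<Sum>i<N. \<Sum>j<N. standard_metric x i j * v i * v j) > 0" .
next
  fix c d z i j assume "c \<in> charts" "d \<in> charts" and z: "z \<in> snd c ` (fst c \<inter> fst d)" and ij: "i < N" "j < N"
  then obtain x y where xy: "x \<in> E" "y \<in> E" and cd: "c = local_chart x" "d = local_chart y"
    by (auto simp: charts_def)
  let ?W = "snd c ` (fst c \<inter> fst d)"
  have W: "openin (Euclidean_space N) ?W" unfolding cd by (rule openin_chart_overlap[OF xy])
  obtain \<pi> b r where \<pi>: "\<pi> permutes {..<N}" "r > 0"
    "\<And>w i. w \<in> ?W \<Longrightarrow> D z w < r \<Longrightarrow> i < N \<Longrightarrow> transition c d w i = w (\<pi> i) + b i"
    using transition_locally_affine[OF xy] z unfolding cd by metis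
  have lt: "\<pi> k < N" if "k < N" for k using permutes_in_image[OF \<pi>(1), of k] that by simp
  \<comment> \<open>The Jacobian is a permutation matrix, so the transformation rule of the metric
    becomes a reindexing of the sum by \<open>\<pi>\<close>.\<close>
  have pd: "partial_deriv m (\<lambda>w. transition c d w k) z = (if m = \<pi> k then 1 else 0)" if "k < N" "m < N" for k m
  proof -
    have "(\<Sum>j<N. (if j = \<pi> k then 1 else 0) * w j) = w (\<pi> k)" for w :: "nat \<Rightarrow> real"
      using lt[OF that(1)] by (simp add: if_distrib[of "\<lambda>x. x * _"] cong: if_cong)
    then show ?thesis
      using affine_along_coordinate(2)[OF W z \<pi>(2) that(2), of "\<lambda>w. transition c d w k" "\<lambda>j. if j = \<pi> k then 1 else 0" "b k"]
        \<pi>(3) that(1) by simp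
  qed
  have "(\<Sum>k<N. \<Sum>l<N. partial_deriv i (\<lambda>y. transition c d y k) z * partial_deriv j (\<lambda>y. transition c d y l) z *
      standard_metric (transition c d z) k l) =
      (\<Sum>k<N. \<Sum>l<N. if k = l then (if i = \<pi> k then 1 else 0) * (if j = \<pi> k then 1 else 0) else 0)"
    using ij by (intro sum.cong[OF HOL.refl]) (simp add: pd standard_metric_def)
  also have "\<dots> = (\<Sum>k<N. (if i = \<pi> k then 1 else 0) * (if j = \<pi> k then 1 else 0))"
    by (intro sum.cong[OF HOL.refl]) simp
  also have "\<dots> = (\<Sum>k<N. (if i = k then 1 else 0) * (if j = k then 1 else 0))"
    using sum.permute[OF \<pi>(1), of "\<lambda>k. (if i = k then 1 else 0) * (if j = k then 1 else (0::real))"] by (simp add: o_def)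
  also have "\<dots> = (\<Sum>k<N. if i = k then (if j = i then 1 else 0) else 0)"
    by (intro sum.cong[OF HOL.refl]) auto
  also have "\<dots> = standard_metric z i j" using ij by (simp add: standard_metric_def)
  finally show "standard_metric z i j = (\<Sum>k<N. \<Sum>l<N. partial_deriv i (\<lambda>y. transition c d y k) z *
      partial_deriv j (\<lambda>y. transition c d y l) z * standard_metric (transition c d z) k l)" by simp
qed

lemma compact_X: "compact_space X"
proof -
  let ?K = "{x \<in> E. \<forall>i<N. \<bar>x i\<bar> \<le> R}"
  have "orbits \<subseteq> orb ` ?K"
  proof
    fix A assume "A \<in> orbits"
    then obtain x where x: "x \<in> E" "A = orb x" by (auto simp: orbits_def)
    then obtain \<gamma> where "\<gamma> \<in> carrier \<Gamma>" "\<forall>i<N. \<bar>act \<gamma> x i\<bar> \<le> R" using cocompact by blast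
    then show "A \<in> orb ` ?K"
      using x act_closed orb_act by (intro image_eqI[of _ _ "act \<gamma> x"]) auto
  qed
  then have "orb ` ?K = topspace X" using orb_in_orbits by auto
  then show ?thesis
    using image_compactin[OF compactin_Euclidean_box continuous_orb, of R] by (simp add: compact_space_def)
qed

lemma flat_manifold_X: "flat_manifold N X charts (\<lambda>_. standard_metric)"
  unfolding flat_manifold_def
proof (intro conjI ballI allI impI)
  show "Hausdorff_space X" by (rule orb.Hausdorff_space_mtopology)
  show "second_countable X"
    using second_countable_open_map_image[OF continuous_orb open_orb orb_image_E second_countable_Euclidean_space] .
  show "compact_space X" by (rule compact_X)
  show "connected_space X"
    using connectedin_continuous_map_image[OF continuous_orb, of E] connected_Euclidean_space[of N] orb_image_E
    by (simp add: connectedin_topspace connectedin_def)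
  show "topspace X \<noteq> {}" using nontrivial_Euclidean_space[of N] orb_image_E by auto
  show "smooth_atlas N X charts" by (rule smooth_atlas_charts)
  show "riemannian_metric N charts (\<lambda>_. standard_metric)" by (rule riemannian_metric_charts)
  \<comment> \<open>\<open>standard_metric\<close> ignores the point, so evaluating it anywhere
    exhibits it as a constant function.\<close>
  have "standard_metric = (\<lambda>_. standard_metric undefined)" by (simp add: standard_metric_def fun_eq_iff)
  then show "riemann_curvature N standard_metric l k i j x = 0" for l k i j x
    using riemann_curvature_const[of N "standard_metric undefined" l k i j x] by metis
qed

end

section \<open>The fundamental group of the quotient\<close>

lemma (in Metric_space) continuous_map_dist:
  assumes f: "continuous_map Y mtopology f" and g: "continuous_map Y mtopology g"
  shows "continuous_map Y euclideanreal (\<lambda>y. d (f y) (g y))"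
  unfolding mtopology_is_euclidean[symmetric] Met_TC.continuous_map_to_metric
proof (intro ballI allI impI)
  fix y and e :: real assume y: "y \<in> topspace Y" and e: "e > 0"
  then have e2: "e / 2 > 0" by simp
  obtain U where U: "openin Y U" "y \<in> U" "\<And>z. z \<in> U \<Longrightarrow> f z \<in> mball (f y) (e / 2)"
    using f[unfolded continuous_map_to_metric, rule_format, OF y e2] by blast
  obtain V where V: "openin Y V" "y \<in> V" "\<And>z. z \<in> V \<Longrightarrow> g z \<in> mball (g y) (e / 2)"
    using g[unfolded continuous_map_to_metric, rule_format, OF y e2] by blast
  have "d (f z) (g z) \<in> Met_TC.mball (d (f y) (g y)) e" if z: "z \<in> U \<inter> V" for z
  proof -
    have "f y \<in> M" "f z \<in> M" "d (f y) (f z) < e / 2" "g y \<in> M" "g z \<in> M" "d (g y) (g z) < e / 2"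
      using U(3)[of z] V(3)[of z] z by auto
    moreover from this have "d (f y) (g y) \<le> d (f y) (f z) + d (f z) (g z) + d (g y) (g z)"
      "d (f z) (g z) \<le> d (f y) (f z) + d (f y) (g y) + d (g y) (g z)"
      using triangle[of "f y" "f z" "g y"] triangle[of "f z" "g z" "g y"]
        triangle[of "f z" "f y" "g z"] triangle[of "f y" "g y" "g z"] commute[of "f y" "f z"] commute[of "g y" "g z"]
      by linarith+
    ultimately show ?thesis by (simp add: Met_TC.in_mball dist_real_def abs_less_iff)
  qed
  then show "\<exists>U. openin Y U \<and> y \<in> U \<and> (\<forall>z\<in>U. d (f z) (g z) \<in> Met_TC.mball (d (f y) (g y)) e)"
    using U V by (intro exI[of _ "U \<inter> V"]) (simp add: openin_Int)
qed

lemma continuous_map_into_Euclidean_space: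
  fixes g :: "'a::topological_space \<Rightarrow> nat \<Rightarrow> real"
  shows "continuous_map (top_of_set S) (Euclidean_space N) g \<longleftrightarrow> continuous_on S g \<and> g ` S \<subseteq> topspace (Euclidean_space N)"
  unfolding Euclidean_space_def euclidean_product_topology by (auto simp: continuous_map_in_subtopology topspace_subtopology)

context flat_action
begin

text \<open>Continuity is that of the type class topology on functions, which induces
  \<open>Euclidean_space N\<close> on \<open>E\<close>; this makes the calculus of
  \<open>continuous_on\<close> available for lifts.\<close>

definition is_lift :: "(real \<Rightarrow> (nat \<Rightarrow> real) set) \<Rightarrow> real \<Rightarrow> real \<Rightarrow> (real \<Rightarrow> nat \<Rightarrow> real) \<Rightarrow> bool"
  where "is_lift f a b g \<longleftrightarrow> continuous_on {a..b} g \<and> g ` {a..b} \<subseteq> E \<and> (\<forall>t\<in>{a..b}. orb (g t) = f t)"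

lemma is_lift_E: "is_lift f a b g \<Longrightarrow> t \<in> {a..b} \<Longrightarrow> g t \<in> E"
  by (auto simp: is_lift_def)

lemma is_lift_orb: "is_lift f a b g \<Longrightarrow> t \<in> {a..b} \<Longrightarrow> orb (g t) = f t"
  by (auto simp: is_lift_def)

lemma pathin_lift:
  assumes "is_lift f 0 1 g"
  shows "pathin X f"
proof -
  have "continuous_map (top_of_set {0..1}) X (orb \<circ> g)"
    using assms continuous_orb
    by (intro continuous_map_compose[of _ "Euclidean_space N"]) (auto simp: is_lift_def continuous_map_into_Euclidean_space)
  then show ?thesis
    unfolding pathin_def by (rule continuous_map_eq) (use assms in \<open>auto simp: is_lift_def\<close>)
qed

lemma fiber_eq:
  assumes "x \<in> E" "y \<in> E" "orb x = orb y" "D x y < \<epsilon> / 2"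
  shows "x = y"
proof -
  have "D x y = 0" using orb_dist_eq[OF assms(1,2,4)] assms orb_in_orbits by simp
  then show ?thesis using assms by simp
qed

lemma local_lift:
  assumes f: "continuous_map (top_of_set {a..b}) X f" and x: "x \<in> E" "orb x = f a"
    and near: "\<And>t. t \<in> {a..b} \<Longrightarrow> orb_dist (f a) (f t) < \<epsilon> / 4" and ab: "a \<le> b"
  shows "\<exists>g. is_lift f a b g \<and> g a = x"
proof -
  let ?g = "\<lambda>t. inv_into (ball_at x) orb (f t)"
  have ball: "f t \<in> orb ` ball_at x" if "t \<in> {a..b}" for t
  proof -
    have "f t \<in> orbits" using continuous_map_image_subset_topspace[OF f] that by auto
    then show ?thesis
      using orb_dist_lift[OF x(1), of "f t"] near[OF that] x(2) by (metis (mono_tags, lifting) ball_at_def image_eqI mem_Collect_eq)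
  qed
  have "continuous_map (top_of_set {a..b}) (subtopology X (orb ` ball_at x)) f"
    using f ball by (auto simp: continuous_map_in_subtopology)
  then have "continuous_map (top_of_set {a..b}) (subtopology (Euclidean_space N) (ball_at x)) (snd (local_chart x) \<circ> f)"
    using homeomorphic_imp_continuous_map[OF local_chart_homeomorphic[OF x(1)]]
    by (intro continuous_map_compose) (auto simp: local_chart_def)
  then have "continuous_map (top_of_set {a..b}) (Euclidean_space N) ?g"
    by (simp add: continuous_map_in_subtopology local_chart_def o_def)
  moreover have "orb (?g t) = f t" if "t \<in> {a..b}" for t
    using f_inv_into_f[OF ball[OF that]] .
  moreover have "?g a = x"
    using inv_into_f_f[OF inj_on_ball_at[OF x(1)], of x] x eps_pos by (simp add: ball_at_def)
  ultimately show ?thesis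
    by (intro exI[of _ ?g]) (auto simp: is_lift_def continuous_map_into_Euclidean_space)
qed

lemma glue_lifts:
  assumes g: "is_lift f a b g" and h: "is_lift f b c h" and eq: "g b = h b" and abc: "a \<le> b" "b \<le> c"
  shows "is_lift f a c (\<lambda>t. if t \<le> b then g t else h t)"
proof -
  have "{t \<in> {a..c}. t \<le> b} = {a..b}" "{t \<in> {a..c}. b \<le> t} = {b..c}" using abc by auto
  then have "continuous_on {a..c} (\<lambda>t. if t \<le> b then g t else h t)"
    using g h eq by (intro continuous_on_cases_le) (auto simp: is_lift_def)
  then show ?thesis using g h by (auto simp: is_lift_def)
qed

lemma path_near:
  assumes f: "continuous_map (top_of_set S) X f" and t: "t \<in> S" and e: "e > 0"
  obtains \<delta> where "\<delta> > 0" "\<And>s. s \<in> S \<Longrightarrow> dist s t < \<delta> \<Longrightarrow> orb_dist (f t) (f s) < e"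
proof -
  obtain U where U: "openin (top_of_set S) U" "t \<in> U" "\<And>s. s \<in> U \<Longrightarrow> f s \<in> orb.mball (f t) e"
    using f t e unfolding orb.continuous_map_to_metric by force
  then obtain \<delta> where "\<delta> > 0" "\<And>s. s \<in> S \<Longrightarrow> dist s t < \<delta> \<Longrightarrow> s \<in> U"
    unfolding openin_euclidean_subtopology_iff by blast
  then show ?thesis using U(3) that by auto
qed

text \<open>By bisection: lifts over adjacent intervals can be glued, and short intervals are
  handled by one chart. The property allows an arbitrary starting point in the fibre, as gluing
  starts the second lift where the first one ends.\<close>

lemma lift_exists:
  assumes f: "continuous_map (top_of_set {0..1}) X f" and x: "x \<in> E" "orb x = f 0"
  shows "\<exists>g. is_lift f 0 1 g \<and> g 0 = x"
proof -
  define P where "P a b \<longleftrightarrow> (0 \<le> a \<and> a \<le> b \<and> b \<le> 1 \<longrightarrow> (\<forall>x\<in>E. orb x = f a \<longrightarrow> (\<exists>g. is_lift f a b g \<and> g a = x)))" for a b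
  have "P 0 1"
  proof (rule Bolzano[of 0 1 P])
    fix a b c assume trans: "P a b" "P b c" "a \<le> b" "b \<le> c"
    show "P a c"
      unfolding P_def
    proof (intro impI ballI)
      fix x assume abc: "0 \<le> a \<and> a \<le> c \<and> c \<le> 1" and x: "x \<in> E" "orb x = f a"
      then obtain g where g: "is_lift f a b g" "g a = x"
        using trans unfolding P_def by force
      have gb: "g b \<in> E" "orb (g b) = f b"
        using is_lift_E[OF g(1), of b] is_lift_orb[OF g(1), of b] trans(3) by auto
      then obtain h where h: "is_lift f b c h" "h b = g b"
        using trans abc unfolding P_def by force
      show "\<exists>g. is_lift f a c g \<and> g a = x"
        using glue_lifts[OF g(1) h(1) h(2)[symmetric] trans(3,4)] g(2) trans(3)
        by (intro exI[of _ "\<lambda>t. if t \<le> b then g t else h t"] conjI) auto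
    qed
  next
    fix t :: real assume local: "0 \<le> t" "t \<le> 1"
    \<comment> \<open>Twice \<open>\<epsilon> / 8\<close> gives the bound
      \<open>\<epsilon> / 4\<close> between any two points of a short interval, as
      \<open>local_lift\<close> asks.\<close>
    obtain \<delta> where \<delta>: "\<delta> > 0" "\<And>s. s \<in> {0..1} \<Longrightarrow> dist s t < \<delta> \<Longrightarrow> orb_dist (f t) (f s) < \<epsilon> / 8"
      using path_near[OF f, of t "\<epsilon> / 8"] local eps_pos by auto
    have "P a b" if ab: "a \<le> t" "t \<le> b" "b - a < \<delta>" for a b
      unfolding P_def
    proof (intro impI ballI)
      fix x assume 01: "0 \<le> a \<and> a \<le> b \<and> b \<le> 1" and x: "x \<in> E" "orb x = f a"
      have orbits: "f s \<in> orbits" if "s \<in> {0..1}" for s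
        using continuous_map_image_subset_topspace[OF f] that by auto
      have "orb_dist (f a) (f s) < \<epsilon> / 4" if s: "s \<in> {a..b}" for s
      proof -
        have "orb_dist (f t) (f a) < \<epsilon> / 8" "orb_dist (f t) (f s) < \<epsilon> / 8"
          using \<delta>(2)[of a] \<delta>(2)[of s] 01 ab s by (auto simp: dist_real_def)
        then show ?thesis
          using orb.triangle[of "f a" "f t" "f s"] orbits[of a] orbits[of t] orbits[of s] 01 ab s
            orb.commute[of "f a" "f t"] by auto
      qed
      moreover have "continuous_map (top_of_set {a..b}) X f"
        using continuous_map_from_subtopology_mono[OF f, of "{a..b}"] 01 by simp
      ultimately show "\<exists>g. is_lift f a b g \<and> g a = x"
        using local_lift x 01 by blast
    qed
    then show "\<exists>d>0. \<forall>a b. a \<le> t \<and> t \<le> b \<and> b - a < d \<longrightarrow> P a b" using \<delta>(1) by blast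
  qed simp
  then show ?thesis using x unfolding P_def by simp
qed

section \<open>Endpoints of lifts and homotopy\<close>

lemma continuous_on_D:
  assumes "continuous_on S g" "continuous_on S h"
  shows "continuous_on S (\<lambda>t. D (g t) (h t))"
  unfolding l1_dist_def
  using assms[THEN continuous_on_product_then_coordinatewise] by (intro continuous_intros)

text \<open>Distances below \<open>\<epsilon> / 2\<close> between points agree with the distances of their orbits, so the distance of two
  lifts of uniformly close paths cannot cross the gap between \<open>\<epsilon> / 4\<close> and \<open>\<epsilon> / 2\<close>.\<close>

lemma close_lifts:
  assumes g: "is_lift f 0 1 g" and h: "is_lift f' 0 1 h" and start: "D (g 0) (h 0) < \<epsilon> / 4"
    and close: "\<And>t. t \<in> {0..1} \<Longrightarrow> orb_dist (f t) (f' t) < \<epsilon> / 4"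
  shows "D (g 1) (h 1) < \<epsilon> / 4"
proof (rule ccontr)
  assume "\<not> D (g 1) (h 1) < \<epsilon> / 4"
  moreover have "continuous_on {0..1} (\<lambda>t. D (g t) (h t))"
    using g h by (intro continuous_on_D) (auto simp: is_lift_def)
  ultimately obtain t where t: "t \<in> {0..1}" "D (g t) (h t) = \<epsilon> / 4"
    using IVT'[of "\<lambda>t. D (g t) (h t)" 0 "\<epsilon> / 4" 1] start by auto
  then have "orb_dist (f t) (f' t) = \<epsilon> / 4"
    using orb_dist_eq[of "g t" "h t"] is_lift_E[OF g] is_lift_E[OF h] is_lift_orb[OF g] is_lift_orb[OF h] eps_pos by auto
  then show False using close[OF t(1)] by simp
qed

text \<open>The endpoints lie in one fibre at distance below \<open>\<epsilon> / 4\<close>, while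
  distinct points of a fibre are at least \<open>\<epsilon> / 2\<close> apart. For
  \<open>f = f'\<close> this is uniqueness of the endpoint of a lift.\<close>

lemma close_lifts_endpoint:
  assumes g: "is_lift f 0 1 g" and h: "is_lift f' 0 1 h" and start: "g 0 = h 0" and "f 1 = f' 1"
    and close: "\<And>t. t \<in> {0..1} \<Longrightarrow> orb_dist (f t) (f' t) < \<epsilon> / 4"
  shows "g 1 = h 1"
proof -
  have E: "g 0 \<in> E" "g 1 \<in> E" "h 1 \<in> E" using is_lift_E[OF g] is_lift_E[OF h] by auto
  have "D (g 0) (h 0) < \<epsilon> / 4"
    unfolding start[symmetric] using E(1) eps_pos by simp
  then have "D (g 1) (h 1) < \<epsilon> / 4"
    by (rule close_lifts[OF g h _ close])
  then show ?thesis
    using fiber_eq[of "g 1" "h 1"] E \<open>f 1 = f' 1\<close> is_lift_orb[OF g, of 1] is_lift_orb[OF h, of 1] eps_pos by simp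
qed

text \<open>Bisection over the homotopy parameter: nearby slices are uniformly close, so
  \<open>close_lifts_endpoint\<close> applies to them. Intermediate slices are loops at
  \<open>A\<close> and have lifts from \<open>x\<close> by \<open>lift_exists\<close>.\<close>

lemma homotopic_lifts_endpoint:
  assumes hom: "(f, f') \<in> loop_homotopy X A"
    and g: "is_lift f 0 1 g" and g': "is_lift f' 0 1 g'" and start: "g 0 = x" "g' 0 = x"
  shows "g 1 = g' 1"
proof -
  let ?I = "top_of_set {0..1::real}"
  obtain h where h: "continuous_map (prod_topology ?I ?I) X h"
    "\<And>t. t \<in> {0..1} \<Longrightarrow> h (0, t) = f t" "\<And>t. t \<in> {0..1} \<Longrightarrow> h (1, t) = f' t"
    "\<And>s. s \<in> {0..1} \<Longrightarrow> h (s, 0) = A \<and> h (s, 1) = A"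
  proof -
    have "\<exists>h. continuous_map (prod_topology ?I ?I) X h \<and> (\<forall>x\<in>topspace ?I. h (0, x) = f x) \<and>
        (\<forall>x\<in>topspace ?I. h (1, x) = f' x) \<and> (\<forall>t\<in>{0..1}. h (t, 0) = A \<and> h (t, 1) = A)"
      using hom unfolding loop_homotopy_def mem_Collect_eq case_prod_conv
      by (subst (asm) homotopic_with) auto
    then show ?thesis using that by (auto)
  qed
  have xE: "x \<in> E" using is_lift_E[OF g, of 0] start by simp
  have xA: "orb x = A" using is_lift_orb[OF g, of 0] start h(2)[of 0] h(4)[of 0] by simp
  have slice: "continuous_map ?I X (\<lambda>t. h (s, t))" if "s \<in> {0..1}" for s
  proof -
    have "continuous_map ?I (prod_topology ?I ?I) (\<lambda>t. (s, t))"
      using that by (intro continuous_map_pairedI) auto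
    from continuous_map_compose[OF this h(1)] show ?thesis by (simp add: o_def)
  qed
  have orbits: "h (s, t) \<in> orbits" if "s \<in> {0..1}" "t \<in> {0..1}" for s t
    using continuous_map_image_subset_topspace[OF h(1)] that by auto
  define P where "P a b \<longleftrightarrow> (0 \<le> a \<and> a \<le> b \<and> b \<le> 1 \<longrightarrow> (\<forall>u v. is_lift (\<lambda>t. h (a, t)) 0 1 u \<longrightarrow> is_lift (\<lambda>t. h (b, t)) 0 1 v \<longrightarrow>
      u 0 = x \<longrightarrow> v 0 = x \<longrightarrow> u 1 = v 1))" for a b
  have "P 0 1"
  proof (rule Bolzano[of 0 1 P])
    fix a b c assume trans: "P a b" "P b c" "a \<le> b" "b \<le> c"
    show "P a c"
      unfolding P_def
    proof (intro impI allI)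
      fix u v assume ac: "0 \<le> a \<and> a \<le> c \<and> c \<le> 1"
        and uv: "is_lift (\<lambda>t. h (a, t)) 0 1 u" "is_lift (\<lambda>t. h (c, t)) 0 1 v" "u 0 = x" "v 0 = x"
      have b: "b \<in> {0..1}" using ac trans(3,4) by auto
      obtain w where w: "is_lift (\<lambda>t. h (b, t)) 0 1 w" "w 0 = x"
        using lift_exists[OF slice[OF b] xE] xA h(4)[OF b] by auto
      have "u 1 = w 1"
        using trans(1)[unfolded P_def, rule_format, OF _ uv(1) w(1) uv(3) w(2)] ac trans(3,4) by simp
      also have "w 1 = v 1"
        using trans(2)[unfolded P_def, rule_format, OF _ w(1) uv(2) w(2) uv(4)] ac trans(3,4) by simp
      finally show "u 1 = v 1" .
    qed
  next
    fix s :: real assume local: "0 \<le> s" "s \<le> 1"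
    then have s: "s \<in> {0..1}" by auto
    \<comment> \<open>Distance of a slice from the slice at \<open>s\<close>. It vanishes on the
      latter, and uniform continuity on the compact square gives one \<delta> for all times
      \<open>t\<close>.\<close>
    let ?F = "\<lambda>p. orb_dist (h (s, snd p)) (h p)"
    have "continuous_map (prod_topology ?I ?I) (prod_topology ?I ?I) (\<lambda>p. (s, snd p))"
      using s by (intro continuous_map_pairedI continuous_map_snd) auto
    from continuous_map_compose[OF this h(1)]
    have "continuous_map (prod_topology ?I ?I) X (\<lambda>p. h (s, snd p))" by (simp add: o_def)
    then have "continuous_map (prod_topology ?I ?I) euclideanreal ?F"
      using h(1) by (rule orb.continuous_map_dist)
    then have "continuous_on ({0..1} \<times> {0..1}) ?F"
      by (simp add: prod_topology_subtopology_eu)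
    then have "uniformly_continuous_on ({0..1} \<times> {0..1}) ?F"
      by (intro compact_uniformly_continuous compact_Times) auto
    then obtain \<delta> where \<delta>: "\<delta> > 0" "\<And>p q. p \<in> {0..1} \<times> {0..1} \<Longrightarrow> q \<in> {0..1} \<times> {0..1} \<Longrightarrow>
        dist q p < \<delta> \<Longrightarrow> dist (?F q) (?F p) < \<epsilon> / 8"
      unfolding uniformly_continuous_on_def using eps_pos by (metis divide_pos_pos zero_less_numeral)
    have near: "orb_dist (h (s, t)) (h (r, t)) < \<epsilon> / 8" if "r \<in> {0..1}" "t \<in> {0..1}" "dist r s < \<delta>" for r t
    proof -
      have "dist (r, t) (s, t) < \<delta>" using that by (simp add: dist_Pair_Pair)
      then have "dist (?F (r, t)) (?F (s, t)) < \<epsilon> / 8" using \<delta>(2)[of "(s, t)" "(r, t)"] that s by auto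
      then show ?thesis using orbits[OF s that(2)] by (simp add: dist_real_def)
    qed
    have "P a b" if ab: "a \<le> s" "s \<le> b" "b - a < \<delta>" for a b
      unfolding P_def
    proof (intro impI allI)
      fix u v assume 01: "0 \<le> a \<and> a \<le> b \<and> b \<le> 1"
        and uv: "is_lift (\<lambda>t. h (a, t)) 0 1 u" "is_lift (\<lambda>t. h (b, t)) 0 1 v" "u 0 = x" "v 0 = x"
      have ab': "a \<in> {0..1}" "b \<in> {0..1}" using 01 by auto
      show "u 1 = v 1"
      proof (rule close_lifts_endpoint[OF uv(1,2)])
        show "u 0 = v 0" using uv by simp
        show "h (a, 1) = h (b, 1)" using h(4) ab' by simp
        fix t :: real assume t: "t \<in> {0..1}"
        have "orb_dist (h (s, t)) (h (a, t)) < \<epsilon> / 8" "orb_dist (h (s, t)) (h (b, t)) < \<epsilon> / 8"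
          using near[OF ab'(1) t] near[OF ab'(2) t] ab by (auto simp: dist_real_def)
        then show "orb_dist (h (a, t)) (h (b, t)) < \<epsilon> / 4"
          using orb.triangle[of "h (a, t)" "h (s, t)" "h (b, t)"] orbits[OF _ t] ab' s
            orb.commute[of "h (a, t)" "h (s, t)"] by auto
      qed
    qed
    then show "\<exists>d>0. \<forall>a b. a \<le> s \<and> s \<le> b \<and> b - a < d \<longrightarrow> P a b" using \<delta>(1) by blast
  qed simp
  moreover have "is_lift (\<lambda>t. h (0, t)) 0 1 g" "is_lift (\<lambda>t. h (1, t)) 0 1 g'"
    using g g' h(2,3) by (auto simp: is_lift_def)
  ultimately show ?thesis using start unfolding P_def by simp
qed

text \<open>\<open>E\<close> is convex, so the lifts are joined by a straight-line homotopy, which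
  keeps the common endpoints fixed; it is then projected to the orbits.\<close>

lemma lifts_homotopic:
  assumes g: "is_lift f 0 1 g" and g': "is_lift f' 0 1 g'" and ends: "g 0 = g' 0" "g 1 = g' 1"
    and A: "orb (g 0) = A" "orb (g 1) = A"
  shows "(f, f') \<in> loop_homotopy X A"
proof -
  let ?I = "top_of_set {0..1::real}"
  define k where "k p = (\<lambda>i. (1 - fst p) * g (snd p) i + fst p * g' (snd p) i)" for p :: "real \<times> real"
  have "continuous_on ({0..1} \<times> {0..1}) (\<lambda>p. g (snd p))" "continuous_on ({0..1} \<times> {0..1}) (\<lambda>p. g' (snd p))"
    using g g' unfolding is_lift_def
    by (auto intro: continuous_on_compose2[OF _ continuous_on_snd[OF continuous_on_id]])
  note this[THEN continuous_on_product_then_coordinatewise]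
  then have "continuous_on ({0..1} \<times> {0..1}) k"
    unfolding k_def by (intro continuous_on_coordinatewise_then_product continuous_intros)
  moreover have "k ` ({0..1} \<times> {0..1}) \<subseteq> E"
    using is_lift_E[OF g] is_lift_E[OF g'] by (auto simp: k_def topspace_Euclidean_space)
  ultimately have "continuous_map (prod_topology ?I ?I) (Euclidean_space N) k"
    by (simp add: prod_topology_subtopology_eu continuous_map_into_Euclidean_space)
  then have "continuous_map (prod_topology ?I ?I) X (orb \<circ> k)"
    by (rule continuous_map_compose[OF _ continuous_orb])
  moreover have "k (0, t) = g t" "k (1, t) = g' t" "k (s, 0) = g 0" "k (s, 1) = g 1" for s t
    unfolding k_def using ends by (simp_all add: algebra_simps fun_eq_iff)
  ultimately have "homotopic_with (\<lambda>r. r 0 = A \<and> r 1 = A) ?I X f f'"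
    using A is_lift_orb[OF g] is_lift_orb[OF g']
    by (subst homotopic_with) (auto intro!: exI[of _ "orb \<circ> k"])
  then show ?thesis by (simp add: loop_homotopy_def)
qed

text \<open>The loops at \<open>orb x\<close> with monodromy \<gamma>. By
  \<open>loop_homotopy_lift_class\<close> these are exactly the homotopy classes.\<close>

definition lift_class :: "(nat \<Rightarrow> real) \<Rightarrow> 'a \<Rightarrow> (real \<Rightarrow> (nat \<Rightarrow> real) set) set"
  where "lift_class x \<gamma> = {f. \<exists>g. is_lift f 0 1 g \<and> g 0 = x \<and> g 1 = act \<gamma> x}"

lemma lift_class_loops:
  assumes x: "x \<in> E" and \<gamma>: "\<gamma> \<in> carrier \<Gamma>"
  shows "lift_class x \<gamma> \<subseteq> loops X (orb x)"
proof
  fix f assume "f \<in> lift_class x \<gamma>"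
  then obtain g where g: "is_lift f 0 1 g" "g 0 = x" "g 1 = act \<gamma> x" by (auto simp: lift_class_def)
  have "f 0 = orb x" "f 1 = orb x"
    using is_lift_orb[OF g(1), of 0] is_lift_orb[OF g(1), of 1] g orb_act[OF \<gamma> x] by auto
  then show "f \<in> loops X (orb x)" using pathin_lift[OF g(1)] by (simp add: loops_def)
qed

lemma loops_lift_class:
  assumes x: "x \<in> E" and f: "f \<in> loops X (orb x)"
  obtains \<gamma> where "\<gamma> \<in> carrier \<Gamma>" "f \<in> lift_class x \<gamma>"
proof -
  have "continuous_map (top_of_set {0..1}) X f" "orb x = f 0" "f 1 = orb x"
    using f by (auto simp: loops_def pathin_def)
  then obtain g where g: "is_lift f 0 1 g" "g 0 = x" using lift_exists[OF _ x] by blast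
  have "g 1 \<in> E" "orb x = orb (g 1)" using is_lift_E[OF g(1)] is_lift_orb[OF g(1)] \<open>f 1 = orb x\<close> by auto
  then obtain \<gamma> where "\<gamma> \<in> carrier \<Gamma>" "g 1 = act \<gamma> x" using orb_eq_iff[OF x] by blast
  then show ?thesis using that g by (auto simp: lift_class_def)
qed

lemma loop_homotopy_lift_class:
  assumes x: "x \<in> E" and \<gamma>: "\<gamma> \<in> carrier \<Gamma>" and f: "f \<in> lift_class x \<gamma>"
  shows "loop_homotopy X (orb x) `` {f} = lift_class x \<gamma>"
proof -
  obtain g where g: "is_lift f 0 1 g" "g 0 = x" "g 1 = act \<gamma> x" using f by (auto simp: lift_class_def)
  show ?thesis
  proof (intro equalityI subsetI)
    fix f' assume "f' \<in> loop_homotopy X (orb x) `` {f}"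
    then have hom: "(f, f') \<in> loop_homotopy X (orb x)" by simp
    then have "homotopic_with (\<lambda>r. r 0 = orb x \<and> r 1 = orb x) (top_of_set {0..1}) X f f'"
      by (simp add: loop_homotopy_def)
    note homotopic_with_imp_continuous_maps[OF this] homotopic_with_imp_property[OF this]
    then have "f' \<in> loops X (orb x)" by (simp add: loops_def pathin_def)
    then obtain \<delta> where "f' \<in> lift_class x \<delta>" by (rule loops_lift_class[OF x])
    then obtain g' where g': "is_lift f' 0 1 g'" "g' 0 = x" unfolding lift_class_def by blast
    then have "g' 1 = act \<gamma> x" using homotopic_lifts_endpoint[OF hom g(1) g'(1) g(2) g'(2)] g(3) by simp
    then show "f' \<in> lift_class x \<gamma>" using g' by (auto simp: lift_class_def)
  next
    fix f' assume "f' \<in> lift_class x \<gamma>"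
    then obtain g' where g': "is_lift f' 0 1 g'" "g' 0 = x" "g' 1 = act \<gamma> x" by (auto simp: lift_class_def)
    have "(f, f') \<in> loop_homotopy X (orb x)"
      using g g' orb_act[OF \<gamma> x] by (intro lifts_homotopic[OF g(1) g'(1)]) auto
    then show "f' \<in> loop_homotopy X (orb x) `` {f}" by simp
  qed
qed

lemma lift_class_nonempty:
  assumes x: "x \<in> E" and \<gamma>: "\<gamma> \<in> carrier \<Gamma>"
  shows "lift_class x \<gamma> \<noteq> {}"
proof -
  define g where "g t = (\<lambda>i. (1 - t) * x i + t * act \<gamma> x i)" for t
  have "continuous_on {0..1} g"
    unfolding g_def by (intro continuous_on_coordinatewise_then_product continuous_intros)
  moreover have "g t \<in> E" for t
    using x act_closed[OF \<gamma> x] by (auto simp: g_def topspace_Euclidean_space)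
  ultimately have "is_lift (orb \<circ> g) 0 1 g" by (auto simp: is_lift_def)
  moreover have "g 0 = x" "g 1 = act \<gamma> x" by (simp_all add: g_def)
  ultimately show ?thesis unfolding lift_class_def by blast
qed

lemma lift_class_inj:
  assumes x: "x \<in> E" and gd: "\<gamma> \<in> carrier \<Gamma>" "\<delta> \<in> carrier \<Gamma>" and eq: "lift_class x \<gamma> = lift_class x \<delta>"
  shows "\<gamma> = \<delta>"
proof -
  obtain f where "f \<in> lift_class x \<gamma>" "f \<in> lift_class x \<delta>" using lift_class_nonempty[OF x gd(1)] eq by blast
  then obtain g g' where g: "is_lift f 0 1 g" "g 0 = x" "g 1 = act \<gamma> x"
    and g': "is_lift f 0 1 g'" "g' 0 = x" "g' 1 = act \<delta> x"
    unfolding lift_class_def by blast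
  \<comment> \<open>The loop is close to itself, so two lifts of it from \<open>x\<close> have the
    same endpoint; freeness then separates the group elements.\<close>
  have "orb_dist (f t) (f t) < \<epsilon> / 4" if "t \<in> {0..1}" for t
    using orb_in_orbits[OF is_lift_E[OF g(1) that]] is_lift_orb[OF g(1) that] eps_pos by simp
  then have "act \<gamma> x = act \<delta> x"
    using close_lifts_endpoint[OF g(1) g'(1)] g g' by simp
  then have "act (inv \<gamma> \<otimes> \<delta>) x = x" using gd x by (simp add: act_mult) (metis act_inv(1))
  then have "inv \<gamma> \<otimes> \<delta> = \<one>"
    using displacement[of "inv \<gamma> \<otimes> \<delta>" x] gd x eps_pos by (cases "inv \<gamma> \<otimes> \<delta> = \<one>") auto
  then show ?thesis using gd by (metis inv_equality inv_inv inv_closed)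
qed

lemma act_continuous:
  assumes \<gamma>: "\<gamma> \<in> carrier \<Gamma>" and g: "continuous_on S g" "g ` S \<subseteq> E"
  shows "continuous_on S (\<lambda>t. act \<gamma> (g t))"
proof (rule continuous_on_coordinatewise_then_product)
  fix i
  obtain \<pi> b where \<pi>: "\<And>x i. x \<in> E \<Longrightarrow> i < N \<Longrightarrow> act \<gamma> x i = x (\<pi> i) + b i"
    using act_affine[OF \<gamma>] by blast
  show "continuous_on S (\<lambda>t. act \<gamma> (g t) i)"
  proof (cases "i < N")
    case True
    have "continuous_on S (\<lambda>t. g t (\<pi> i) + b i)"
      using continuous_on_product_then_coordinatewise[OF g(1)] by (intro continuous_intros)
    then show ?thesis
      by (rule continuous_on_eq) (use \<pi> True g in auto)
  next
    case False
    have "continuous_on S (\<lambda>t. 0 :: real)" by simp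
    then show ?thesis
      by (rule continuous_on_eq) (use act_closed[OF \<gamma>] False g in \<open>auto simp: topspace_Euclidean_space image_subset_iff\<close>)
  qed
qed

lemma lift_class_join:
  assumes x: "x \<in> E" and gd: "\<gamma> \<in> carrier \<Gamma>" "\<delta> \<in> carrier \<Gamma>"
    and p: "p \<in> lift_class x \<gamma>" and q: "q \<in> lift_class x \<delta>"
  shows "loop_join p q \<in> lift_class x (\<gamma> \<otimes> \<delta>)"
proof -
  obtain g h where g: "is_lift p 0 1 g" "g 0 = x" "g 1 = act \<gamma> x"
    and h: "is_lift q 0 1 h" "h 0 = x" "h 1 = act \<delta> x"
    using p q unfolding lift_class_def by blast
  \<comment> \<open>The second lift is translated by \<gamma> to start where the first ends. It then
    ends at \<open>act \<gamma> (act \<delta> x)\<close>, so loop composition matches the product in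
    this order.\<close>
  define k where "k t = (if t \<le> 1/2 then g (2 * t) else act \<gamma> (h (2 * t - 1)))" for t
  have "is_lift (loop_join p q) 0 1 k"
    unfolding is_lift_def
  proof (intro conjI ballI)
    have sets: "{t \<in> {0..1}. t \<le> 1/2} = {0..1/2::real}" "{t \<in> {0..1}. 1/2 \<le> t} = {1/2..1::real}" by auto
    have cont: "continuous_on {0..1} g" "continuous_on {0..1} h" using g(1) h(1) by (simp_all add: is_lift_def)
    have lin: "continuous_on {0..1/2} (\<lambda>t. 2 * t :: real)" "continuous_on {1/2..1} (\<lambda>t. 2 * t - 1 :: real)"
      by (intro continuous_intros)+
    have g2: "continuous_on {0..1/2} (\<lambda>t. g (2 * t))"
      by (rule continuous_on_compose2[OF cont(1) lin(1)]) auto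
    have "continuous_on {1/2..1} (\<lambda>t. h (2 * t - 1))"
      by (rule continuous_on_compose2[OF cont(2) lin(2)]) auto
    then have h2: "continuous_on {1/2..1} (\<lambda>t. act \<gamma> (h (2 * t - 1)))"
      by (rule act_continuous[OF gd(1)]) (use is_lift_E[OF h(1)] in auto)
    show "continuous_on {0..1} k"
      unfolding k_def
    proof (rule continuous_on_cases_le)
      show "continuous_on {t \<in> {0..1}. t \<le> 1/2} (\<lambda>t. g (2 * t))" unfolding sets by (rule g2)
      show "continuous_on {t \<in> {0..1}. 1/2 \<le> t} (\<lambda>t. act \<gamma> (h (2 * t - 1)))" unfolding sets by (rule h2)
      show "g (2 * t) = act \<gamma> (h (2 * t - 1))" if "t = 1/2" for t :: real
        unfolding that using g h by simp
    qed (rule continuous_on_id)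
    show "k ` {0..1} \<subseteq> E"
      using is_lift_E[OF g(1)] is_lift_E[OF h(1)] act_closed[OF gd(1)] by (auto simp: k_def)
    fix t :: real assume t: "t \<in> {0..1}"
    show "orb (k t) = loop_join p q t"
      using t is_lift_orb[OF g(1), of "2 * t"] is_lift_orb[OF h(1), of "2 * t - 1"] is_lift_E[OF h(1), of "2 * t - 1"]
        orb_act[OF gd(1), of "h (2 * t - 1)"] by (auto simp: k_def loop_join_def)
  qed
  moreover have "k 0 = x" "k 1 = act (\<gamma> \<otimes> \<delta>) x" using g h gd x by (simp_all add: k_def act_mult)
  ultimately show ?thesis unfolding lift_class_def by blast
qed

text \<open>The unit has its own clause because \<open>iso\<close> does not mention it, and
  transferring the group axioms to the fundamental group requires it.\<close>

theorem fundamental_group_iso: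
  assumes x: "x \<in> E"
  shows "lift_class x \<in> iso \<Gamma> (fundamental_group X (orb x))"
    and "\<one>\<^bsub>fundamental_group X (orb x)\<^esub> = lift_class x \<one>"
proof -
  let ?F = "fundamental_group X (orb x)"
  have cls: "loop_homotopy X (orb x) `` {f} = lift_class x \<gamma>" if "\<gamma> \<in> carrier \<Gamma>" "f \<in> lift_class x \<gamma>" for \<gamma> f
    using that by (rule loop_homotopy_lift_class[OF x])
  have carrier: "carrier ?F = lift_class x ` carrier \<Gamma>"
  proof
    show "carrier ?F \<subseteq> lift_class x ` carrier \<Gamma>"
    proof
      fix C assume "C \<in> carrier ?F"
      then obtain f where f: "f \<in> loops X (orb x)" "C = loop_homotopy X (orb x) `` {f}"
        by (auto simp: fundamental_group_def quotient_def)
      from x f(1) obtain \<gamma> where "\<gamma> \<in> carrier \<Gamma>" "f \<in> lift_class x \<gamma>" by (rule loops_lift_class)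
      then show "C \<in> lift_class x ` carrier \<Gamma>" using cls f(2) by blast
    qed
    show "lift_class x ` carrier \<Gamma> \<subseteq> carrier ?F"
    proof
      fix C assume "C \<in> lift_class x ` carrier \<Gamma>"
      then obtain \<gamma> where \<gamma>: "\<gamma> \<in> carrier \<Gamma>" "C = lift_class x \<gamma>" by blast
      then obtain f where f: "f \<in> lift_class x \<gamma>" using lift_class_nonempty[OF x] by blast
      then have "f \<in> loops X (orb x)" "C = loop_homotopy X (orb x) `` {f}"
        using lift_class_loops[OF x \<gamma>(1)] cls[OF \<gamma>(1) f] \<gamma>(2) by blast+
      then show "C \<in> carrier ?F" by (auto simp: fundamental_group_def quotient_def)
    qed
  qed
  have mult: "lift_class x (\<gamma> \<otimes> \<delta>) = lift_class x \<gamma> \<otimes>\<^bsub>?F\<^esub> lift_class x \<delta>"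
    if gd: "\<gamma> \<in> carrier \<Gamma>" "\<delta> \<in> carrier \<Gamma>" for \<gamma> \<delta>
  proof -
    have "loop_homotopy X (orb x) `` {loop_join p q} = lift_class x (\<gamma> \<otimes> \<delta>)"
      if "p \<in> lift_class x \<gamma>" "q \<in> lift_class x \<delta>" for p q
      using that gd lift_class_join[OF x gd] by (intro cls) auto
    then show ?thesis
      using lift_class_nonempty[OF x gd(1)] lift_class_nonempty[OF x gd(2)]
      by (simp add: fundamental_group_def cong: SUP_cong)
  qed
  have "inj_on (lift_class x) (carrier \<Gamma>)" using lift_class_inj[OF x] by (auto intro: inj_onI)
  then show "lift_class x \<in> iso \<Gamma> ?F"
    using carrier mult by (auto simp: iso_def hom_def bij_betw_def)
  have "is_lift (\<lambda>_. orb x) 0 1 (\<lambda>_. x)" using x by (auto simp: is_lift_def)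
  then have "(\<lambda>_. orb x) \<in> lift_class x \<one>" using act_one[OF x] by (auto simp: lift_class_def)
  then show "\<one>\<^bsub>?F\<^esub> = lift_class x \<one>" using cls[OF one_closed] by (simp add: fundamental_group_def)
qed

end

section \<open>The Bieberbach subgroup\<close>

text \<open>Each \<open>\<xi> i\<close> is an integer lift of a character with values in the
  integers modulo \<open>m\<close>; thus it is additive only up to multiples of \<open>m\<close>.
  Together they separate the elements of \<open>G\<close>.\<close>

locale braid_bieberbach = braid_linking Q n s \<Psi> + G: comm_group G
  for Q :: "('q, 'c) monoid_scheme" (structure) and n s \<Psi> and G :: "('g, 'h) monoid_scheme" +
  fixes m :: nat and \<rho> :: "'g \<Rightarrow> nat \<Rightarrow> nat" and \<xi> :: "nat \<Rightarrow> 'g \<Rightarrow> int"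
  assumes finite_G: "finite (carrier G)" and m_eq: "m = order G" and n_eq: "n = 2 * m + 1"
    and rho_permutes: "g \<in> carrier G \<Longrightarrow> \<rho> g permutes {1..m}"
    and rho_mult: "g \<in> carrier G \<Longrightarrow> h \<in> carrier G \<Longrightarrow> \<rho> (g \<otimes>\<^bsub>G\<^esub> h) = \<rho> g \<circ> \<rho> h"
    and rho_inj: "inj_on \<rho> (carrier G)"
    and xi_add: "i \<in> {1..m} \<Longrightarrow> g \<in> carrier G \<Longrightarrow> h \<in> carrier G \<Longrightarrow>
      int m dvd \<xi> i (g \<otimes>\<^bsub>G\<^esub> h) - \<xi> i g - \<xi> i h"
    and xi_separate: "g \<in> carrier G \<Longrightarrow> (\<And>i. i \<in> {1..m} \<Longrightarrow> int m dvd \<xi> i g) \<Longrightarrow> g = \<one>\<^bsub>G\<^esub>"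
begin

abbreviation lk :: "'q \<Rightarrow> nat set \<Rightarrow> int" where "lk x \<equiv> fst (\<Psi> x)"

lemma m_pos: "m > 0"
  using finite_G by (simp add: m_eq G.order_gt_0_iff_finite)

definition special :: "nat \<Rightarrow> nat set" where "special i = {m + i, n}"

lemma special_pairs: "i \<in> {1..m} \<Longrightarrow> special i \<in> pairs n"
  unfolding special_def by (auto simp: pairs_def n_eq)

lemma special_inj: "i \<in> {1..m} \<Longrightarrow> special j = special i \<longleftrightarrow> j = i"
  unfolding special_def by (auto simp: n_eq doubleton_eq_iff)

lemma rho_special: "g \<in> carrier G \<Longrightarrow> i \<in> {1..m} \<Longrightarrow> \<rho> g -` special i = special i"
proof -
  assume g: "g \<in> carrier G" and i: "i \<in> {1..m}"
  have "\<rho> g j = j" if "j > m" for j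
    using permutes_not_in[OF rho_permutes[OF g]] that by simp
  then have "\<rho> g ` special i = special i" using i m_pos unfolding special_def by (simp add: n_eq)
  then show ?thesis
    using inj_vimage_image_eq[OF permutes_inj[OF rho_permutes[OF g]], of "special i"] by simp
qed

lemma rho_one: "\<rho> \<one>\<^bsub>G\<^esub> = id"
proof -
  have "\<rho> \<one>\<^bsub>G\<^esub> \<circ> \<rho> \<one>\<^bsub>G\<^esub> = \<rho> \<one>\<^bsub>G\<^esub>" using rho_mult[of "\<one>\<^bsub>G\<^esub>" "\<one>\<^bsub>G\<^esub>"] by simp
  then show ?thesis
    using permutes_inv_o[OF rho_permutes[OF G.one_closed]] by (metis comp_assoc id_comp)
qed

lemma xi_one: "i \<in> {1..m} \<Longrightarrow> int m dvd \<xi> i \<one>\<^bsub>G\<^esub>"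
  using xi_add[of i "\<one>\<^bsub>G\<^esub>" "\<one>\<^bsub>G\<^esub>"] by simp

text \<open>Pure elements have even coordinates, which a congruence with an odd right-hand side
  would exclude; hence the doubled \<open>\<xi> i\<close> and the modulus
  \<open>2 * int m\<close>.\<close>

definition \<Gamma> :: "'q set" where
  "\<Gamma> = {x \<in> carrier Q. \<exists>g\<in>carrier G. perm x = \<rho> g \<and> (\<forall>i\<in>{1..m}. 2 * int m dvd lk x (special i) - 2 * \<xi> i g)}"

definition hol :: "'q \<Rightarrow> 'g" where "hol x = inv_into (carrier G) \<rho> (perm x)"

lemma hol_eq: "g \<in> carrier G \<Longrightarrow> perm x = \<rho> g \<Longrightarrow> hol x = g"
  using rho_inj by (simp add: hol_def)

lemma Gamma_iff: "x \<in> \<Gamma> \<longleftrightarrow> x \<in> carrier Q \<and> hol x \<in> carrier G \<and> perm x = \<rho> (hol x) \<and>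
    (\<forall>i\<in>{1..m}. 2 * int m dvd lk x (special i) - 2 * \<xi> i (hol x))"
  using hol_eq unfolding \<Gamma>_def by blast

text \<open>The permutations involved fix every special pair, so coordinates there simply add, in
  step with the characters modulo \<open>m\<close>.\<close>

lemma Gamma_mult:
  assumes "x \<in> \<Gamma>" "y \<in> \<Gamma>"
  shows "x \<otimes> y \<in> \<Gamma> \<and> hol (x \<otimes> y) = hol x \<otimes>\<^bsub>G\<^esub> hol y"
proof -
  have x: "x \<in> carrier Q" "hol x \<in> carrier G" "perm x = \<rho> (hol x)"
    and xc: "\<And>i. i \<in> {1..m} \<Longrightarrow> 2 * int m dvd lk x (special i) - 2 * \<xi> i (hol x)"
    using assms(1) unfolding Gamma_iff by blast+
  have y: "y \<in> carrier Q" "hol y \<in> carrier G" "perm y = \<rho> (hol y)"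
    and yc: "\<And>i. i \<in> {1..m} \<Longrightarrow> 2 * int m dvd lk y (special i) - 2 * \<xi> i (hol y)"
    using assms(2) unfolding Gamma_iff by blast+
  have "perm (x \<otimes> y) = \<rho> (hol x \<otimes>\<^bsub>G\<^esub> hol y)"
    using x y by (simp add: perm_mult rho_mult)
  then have hol: "hol (x \<otimes> y) = hol x \<otimes>\<^bsub>G\<^esub> hol y"
    using x y by (intro hol_eq) simp_all
  have "2 * int m dvd lk (x \<otimes> y) (special i) - 2 * \<xi> i (hol x \<otimes>\<^bsub>G\<^esub> hol y)" if i: "i \<in> {1..m}" for i
  proof -
    have "2 * int m dvd 2 * (\<xi> i (hol x \<otimes>\<^bsub>G\<^esub> hol y) - \<xi> i (hol x) - \<xi> i (hol y))"
      by (rule mult_dvd_mono[OF dvd_refl xi_add[OF i x(2) y(2)]])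
    from dvd_diff[OF dvd_add[OF xc[OF i] yc[OF i]] this]
    show ?thesis using x y i by (simp add: fst_Psi_mult rho_special algebra_simps)
  qed
  then show ?thesis using x y hol \<open>perm (x \<otimes> y) = _\<close> unfolding Gamma_iff by simp
qed

lemma Gamma_one: "\<one> \<in> \<Gamma>"
proof -
  have "hol \<one> = \<one>\<^bsub>G\<^esub>" by (rule hol_eq) (simp_all add: perm_one rho_one)
  moreover have "lk \<one> P = 0" for P using Psi.hom_one by (simp add: one_linking_group)
  ultimately show ?thesis using xi_one by (simp add: Gamma_iff perm_one rho_one)
qed

lemma subgroup_Gamma: "subgroup \<Gamma> Q"
proof (rule subgroupI)
  show "\<Gamma> \<subseteq> carrier Q" by (auto simp: \<Gamma>_def)
  show "\<Gamma> \<noteq> {}" using Gamma_one by blast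
  show "x \<otimes> y \<in> \<Gamma>" if "x \<in> \<Gamma>" "y \<in> \<Gamma>" for x y using Gamma_mult that by blast
  fix x assume "x \<in> \<Gamma>"
  then have x: "x \<in> carrier Q" "hol x \<in> carrier G" "perm x = \<rho> (hol x)"
    and xc: "\<And>i. i \<in> {1..m} \<Longrightarrow> 2 * int m dvd lk x (special i) - 2 * \<xi> i (hol x)"
    unfolding Gamma_iff by blast+
  let ?g = "inv\<^bsub>G\<^esub> hol x"
  have g: "?g \<in> carrier G" using x by simp
  have "\<rho> ?g \<circ> \<rho> (hol x) = id" "\<rho> (hol x) \<circ> \<rho> ?g = id"
    using rho_mult[OF g x(2)] rho_mult[OF x(2) g] x(2) rho_one by simp_all
  then have p: "perm (inv x) = \<rho> ?g" using x by (simp add: perm_inv inv_unique_comp)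
  have "2 * int m dvd lk (inv x) (special i) - 2 * \<xi> i ?g" if i: "i \<in> {1..m}" for i
  proof -
    have "lk (x \<otimes> inv x) (special i) = lk x (special i) + lk (inv x) (special i)"
      using x i by (simp only: fst_Psi_mult inv_closed rho_special)
    moreover have "lk (x \<otimes> inv x) (special i) = 0"
      using x Psi.hom_one by (simp add: one_linking_group)
    ultimately have eq: "lk (inv x) (special i) = - lk x (special i)" by simp
    have "2 * int m dvd 2 * (\<xi> i (hol x \<otimes>\<^bsub>G\<^esub> ?g) - \<xi> i (hol x) - \<xi> i ?g)"
      by (rule mult_dvd_mono[OF dvd_refl xi_add[OF i x(2) g]])
    moreover have "2 * int m dvd 2 * \<xi> i (hol x \<otimes>\<^bsub>G\<^esub> ?g)" using x(2) xi_one[OF i] by simp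
    ultimately have "2 * int m dvd 2 * (\<xi> i (hol x \<otimes>\<^bsub>G\<^esub> ?g) - \<xi> i (hol x) - \<xi> i ?g) - 2 * \<xi> i (hol x \<otimes>\<^bsub>G\<^esub> ?g) -
        (lk x (special i) - 2 * \<xi> i (hol x))"
      by (rule dvd_diff[OF dvd_diff xc[OF i]])
    moreover have "2 * (\<xi> i (hol x \<otimes>\<^bsub>G\<^esub> ?g) - \<xi> i (hol x) - \<xi> i ?g) - 2 * \<xi> i (hol x \<otimes>\<^bsub>G\<^esub> ?g) -
        (lk x (special i) - 2 * \<xi> i (hol x)) = lk (inv x) (special i) - 2 * \<xi> i ?g"
      unfolding eq by (simp add: algebra_simps)
    ultimately show ?thesis by (simp only:)
  qed
  then show "inv x \<in> \<Gamma>" using x(1) g p unfolding \<Gamma>_def by blast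
qed

abbreviation \<Gamma>_group :: "('q, 'c) monoid_scheme" where "\<Gamma>_group \<equiv> Q\<lparr>carrier := \<Gamma>\<rparr>"

lemma group_Gamma: "group \<Gamma>_group"
  by (rule subgroup_imp_group[OF subgroup_Gamma])

lemma Gamma_carrier: "x \<in> \<Gamma> \<Longrightarrow> x \<in> carrier Q"
  by (simp add: \<Gamma>_def)

lemma pow_Gamma: "x [^]\<^bsub>\<Gamma>_group\<^esub> (j :: nat) = x [^] j"
  by (rule nat_pow_consistent[symmetric])

lemma pow_closed_Gamma: "x \<in> \<Gamma> \<Longrightarrow> x [^] (j :: nat) \<in> \<Gamma>"
  using monoid.nat_pow_closed[OF group.is_monoid[OF group_Gamma], of x j] by (simp add: pow_Gamma)

lemma hol_epi: "hol \<in> epi \<Gamma>_group G"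
proof -
  have "hol \<in> hom \<Gamma>_group G"
    using Gamma_mult Gamma_iff by (auto simp: hom_def)
  moreover have "g \<in> hol ` \<Gamma>" if g: "g \<in> carrier G" for g
  proof -
    have "\<rho> g permutes {1..n}"
      using rho_permutes[OF g] by (rule permutes_subset) (simp add: n_eq)
    then obtain x where x: "x \<in> carrier Q" "perm x = \<rho> g"
      using exists_perm[of "\<rho> g" 1 n] generated by auto
    \<comment> \<open>The strings at \<open>m + i\<close> and \<open>n\<close> keep their positions,
      hence their order, and so cross an even number of times.\<close>
    have even: "even (lk x (special i))" if i: "i \<in> {1..m}" for i
    proof -
      have ne: "m + i \<noteq> n" using i by (simp add: n_eq)
      have "\<rho> g (m + i) = m + i" "\<rho> g n = n"
        using permutes_not_in[OF rho_permutes[OF g]] i m_pos by (simp_all add: n_eq)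
      then have "inv' (\<rho> g) (m + i) = m + i" "inv' (\<rho> g) n = n"
        using permutes_inv_eq[OF rho_permutes[OF g]] by blast+
      then show ?thesis using odd_linking_iff[OF x(1) ne] x(2) by (simp add: special_def)
    qed
    \<comment> \<open>The pure factor with coordinates \<open>2 * v\<close> turns an even coordinate
      at a special pair into exactly \<open>2 * \<xi> i g\<close>; other coordinates stay as they
      are.\<close>
    define v where "v P = (if P \<in> special ` {1..m} then \<xi> (THE i. special i = P) g - lk x P div 2 else 0)" for P
    have spec: "(THE j. special j = special i) = i" if "i \<in> {1..m}" for i
      using that by (intro the_equality) (auto simp: special_inj)
    have "v P = 0" if "P \<notin> pairs n" for P using special_pairs that by (auto simp: v_def)
    then obtain y where y: "y \<in> carrier Q" "\<Psi> y = (\<lambda>P. 2 * v P, id)"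
      using exists_pure(1)[of v] by blast
    have py: "perm y = id" using y by (simp add: perm_def)
    have "perm (y \<otimes> x) = \<rho> g" using x y py by (simp add: perm_mult)
    moreover have "lk (y \<otimes> x) (special i) = 2 * \<xi> i g" if i: "i \<in> {1..m}" for i
      using even[OF i] i x y py by (simp add: fst_Psi_mult_pure v_def spec)
    ultimately have "y \<otimes> x \<in> \<Gamma>" "hol (y \<otimes> x) = g"
      using x y g hol_eq by (auto simp: \<Gamma>_def)
    then show ?thesis by blast
  qed
  ultimately show ?thesis using Gamma_iff by (auto simp: epi_def)
qed

section \<open>The translation lattice and the holonomy\<close>

definition N :: nat where "N = n * (n - 1) div 2"

text \<open>An arbitrary numbering of the pairs, since \<open>int_lattice\<close> and
  \<open>Euclidean_space\<close> index coordinates by natural numbers.\<close>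

definition pr :: "nat \<Rightarrow> nat set" where "pr = (SOME h. bij_betw h {..<N} (pairs n))"

lemma pr_bij: "bij_betw pr {..<N} (pairs n)"
proof -
  have "\<exists>h. bij_betw h {..<N} (pairs n)"
    using ex_bij_betw_nat_finite[OF finite_pairs, of n] by (simp add: card_pairs atLeast0LessThan N_def)
  then show ?thesis unfolding pr_def by (rule someI_ex)
qed

definition idx :: "nat set \<Rightarrow> nat" where "idx = inv_into {..<N} pr"

lemma pr_pairs: "i < N \<Longrightarrow> pr i \<in> pairs n"
  using pr_bij by (auto simp: bij_betw_def)

lemma idx_less: "P \<in> pairs n \<Longrightarrow> idx P < N"
  using pr_bij inv_into_into[of P pr "{..<N}"] by (auto simp: idx_def bij_betw_def)

lemma pr_idx: "P \<in> pairs n \<Longrightarrow> pr (idx P) = P"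
  using pr_bij f_inv_into_f[of P pr "{..<N}"] by (auto simp: idx_def bij_betw_def)

lemma idx_pr: "i < N \<Longrightarrow> idx (pr i) = i"
  using pr_bij by (auto simp: idx_def bij_betw_def)

text \<open>The kernel of the holonomy consists of the \<open>2 v\<close> with \<open>v P\<close> divisible by \<open>scale P\<close>.\<close>

definition scale :: "nat set \<Rightarrow> int" where "scale P = (if P \<in> special ` {1..m} then int m else 1)"

lemma scale_pos: "scale P > 0" and scale_le: "scale P \<le> int m"
  using m_pos by (auto simp: scale_def)

definition lattice_vec :: "(nat \<Rightarrow> int) \<Rightarrow> nat set \<Rightarrow> int"
  where "lattice_vec u P = 2 * (if P \<in> pairs n then scale P * u (idx P) else 0)"

definition lattice :: "(nat \<Rightarrow> int) \<Rightarrow> 'q"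
  where "lattice u = inv_into (carrier Q) \<Psi> (lattice_vec u, id)"

lemma lattice: "lattice u \<in> carrier Q" "\<Psi> (lattice u) = (lattice_vec u, id)"
proof -
  have "\<exists>x\<in>carrier Q. \<Psi> x = (\<lambda>P. 2 * (if P \<in> pairs n then scale P * u (idx P) else 0), id)"
    by (rule exists_pure(1)) simp
  then have "(lattice_vec u, id) \<in> \<Psi> ` carrier Q"
    unfolding lattice_vec_def[abs_def] by (metis imageI)
  then show "lattice u \<in> carrier Q" "\<Psi> (lattice u) = (lattice_vec u, id)"
    unfolding lattice_def by (rule inv_into_into, rule f_inv_into_f)
qed

lemma perm_lattice: "perm (lattice u) = id"
  by (simp add: perm_def lattice)

lemma lk_lattice: "lk (lattice u) = lattice_vec u"
  by (simp add: lattice)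

lemma Psi_eqI:
  assumes "x \<in> carrier Q" "y \<in> carrier Q" "perm x = perm y" "\<And>P. lk x P = lk y P"
  shows "x = y"
proof -
  have "\<Psi> x = \<Psi> y" using assms by (simp add: prod_eq_iff perm_def fun_eq_iff)
  then show ?thesis using Psi_inj assms by (simp add: inj_on_def)
qed

lemma hol_pure: "perm x = id \<Longrightarrow> hol x = \<one>\<^bsub>G\<^esub>"
  by (rule hol_eq) (simp_all add: rho_one)

lemma lattice_Gamma: "lattice u \<in> \<Gamma>"
proof -
  have "2 * int m dvd lattice_vec u (special i) - 2 * \<xi> i \<one>\<^bsub>G\<^esub>" if i: "i \<in> {1..m}" for i
  proof (rule dvd_diff)
    show "2 * int m dvd lattice_vec u (special i)"
      using i special_pairs[OF i] by (simp add: lattice_vec_def scale_def)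
    show "2 * int m dvd 2 * \<xi> i \<one>\<^bsub>G\<^esub>" using xi_one[OF i] by simp
  qed
  then show ?thesis
    using lattice(1) by (simp add: Gamma_iff hol_pure perm_lattice lk_lattice rho_one)
qed

lemma lattice_mon: "lattice \<in> mon (int_lattice N) \<Gamma>_group"
proof -
  have "lattice \<in> hom (int_lattice N) \<Gamma>_group"
  proof (rule homI)
    fix u w :: "nat \<Rightarrow> int"
    have "lattice_vec (\<lambda>i\<in>{..<N}. u i + w i) P = lattice_vec u P + lattice_vec w P" for P
      using idx_less by (simp add: lattice_vec_def algebra_simps)
    then have "lattice (\<lambda>i\<in>{..<N}. u i + w i) = lattice u \<otimes> lattice w"
      by (intro Psi_eqI) (simp_all add: lattice(1) perm_mult perm_lattice fst_Psi_mult_pure lk_lattice)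
    then show "lattice (u \<otimes>\<^bsub>int_lattice N\<^esub> w) = lattice u \<otimes>\<^bsub>\<Gamma>_group\<^esub> lattice w" by simp
  qed (simp add: lattice_Gamma)
  moreover have "inj_on lattice (carrier (int_lattice N))"
  proof (rule inj_onI)
    fix u w assume uw: "u \<in> carrier (int_lattice N)" "w \<in> carrier (int_lattice N)" and eq: "lattice u = lattice w"
    show "u = w"
    proof (rule extensionalityI[of _ "{..<N}"])
      fix i assume i: "i \<in> {..<N}"
      have "lattice_vec u (pr i) = lattice_vec w (pr i)" using eq by (simp flip: lk_lattice)
      then show "u i = w i"
        using i scale_pos[of "pr i"] by (simp add: lattice_vec_def pr_pairs idx_pr)
    qed (use uw in \<open>auto simp: PiE_def\<close>)
  qed
  ultimately show ?thesis by (simp add: mon_def)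
qed

lemma lattice_image: "lattice ` carrier (int_lattice N) = kernel \<Gamma>_group G hol"
proof (intro equalityI subsetI)
  fix x assume "x \<in> lattice ` carrier (int_lattice N)"
  then show "x \<in> kernel \<Gamma>_group G hol"
    using lattice_Gamma by (auto simp: kernel_def hol_pure perm_lattice)
next
  fix x assume "x \<in> kernel \<Gamma>_group G hol"
  then have x: "x \<in> \<Gamma>" "hol x = \<one>\<^bsub>G\<^esub>" by (auto simp: kernel_def)
  then have xQ: "x \<in> carrier Q" "perm x = id" and xc: "\<And>i. i \<in> {1..m} \<Longrightarrow> 2 * int m dvd lk x (special i) - 2 * \<xi> i \<one>\<^bsub>G\<^esub>"
    unfolding Gamma_iff by (auto simp: rho_one)
  obtain v where v: "\<And>P. P \<notin> pairs n \<Longrightarrow> v P = 0" "\<Psi> x = (\<lambda>P. 2 * v P, id)"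
    using exists_pure(2)[OF xQ] by blast
  have dvd: "scale P dvd v P" for P
  proof (cases "P \<in> special ` {1..m}")
    case True
    then obtain i where i: "i \<in> {1..m}" "P = special i" by blast
    \<comment> \<open>\<open>\<xi> i\<close> is divisible by \<open>m\<close> at the unit, so the
      congruence that defines \<open>\<Gamma>\<close> reduces to divisibility of \<open>v\<close> at
      special pairs.\<close>
    have "2 * int m dvd 2 * v (special i) - 2 * \<xi> i \<one>\<^bsub>G\<^esub> + 2 * \<xi> i \<one>\<^bsub>G\<^esub>"
      using xc[OF i(1)] xi_one[OF i(1)] v(2) by (intro dvd_add) simp_all
    then have "2 * int m dvd 2 * v (special i)" by simp
    then show ?thesis using i by (simp add: scale_def)
  qed (simp add: scale_def)
  define u where "u = (\<lambda>i\<in>{..<N}. v (pr i) div scale (pr i))"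
  have "lattice_vec u P = lk x P" for P
    using v dvd[of P] idx_less[of P] pr_idx[of P] by (simp add: lattice_vec_def u_def)
  then have "x = lattice u"
    using xQ by (intro Psi_eqI) (simp_all add: lattice(1) perm_lattice lk_lattice)
  moreover have "u \<in> carrier (int_lattice N)" by (simp add: u_def)
  ultimately show "x \<in> lattice ` carrier (int_lattice N)" by blast
qed

text \<open>Commuting with the basis vector at \<open>P\<close> forces the permutation to fix the
  pair \<open>P\<close>. As \<open>n \<ge> 3\<close>, every point is the intersection of two pairs
  and so is fixed as well.\<close>

lemma Gamma_centraliser:
  assumes x: "x \<in> \<Gamma>" and comm: "\<And>u. u \<in> carrier (int_lattice N) \<Longrightarrow> x \<otimes> lattice u = lattice u \<otimes> x"
  shows "hol x = \<one>\<^bsub>G\<^esub>"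
proof -
  have xQ: "x \<in> carrier Q" by (rule Gamma_carrier[OF x])
  have p: "perm x permutes {1..n}" by (rule perm_permutes[OF xQ])
  have fix_pair: "perm x -` P = P" if P: "P \<in> pairs n" for P
  proof -
    define u where "u = (\<lambda>i\<in>{..<N}. if i = idx P then 1 else 0 :: int)"
    have "lk (x \<otimes> lattice u) P = lk (lattice u \<otimes> x) P"
      using comm[of u] by (simp add: u_def)
    then have eq: "lattice_vec u (perm x -` P) = lattice_vec u P"
      using xQ by (simp add: fst_Psi_mult lattice perm_lattice)
    have P': "perm x -` P \<in> pairs n" using pairs_vimage[OF p] P by simp
    have "lattice_vec u P \<noteq> 0"
      using P scale_pos[of P] idx_less[OF P] by (simp add: lattice_vec_def u_def)
    then have "idx (perm x -` P) = idx P"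
      using eq P' idx_less[OF P'] by (auto simp: lattice_vec_def u_def split: if_splits)
    then show ?thesis using pr_idx[OF P] pr_idx[OF P'] by metis
  qed
  have "perm x a = a" for a
  proof (cases "a \<in> {1..n}")
    case True
    have "3 \<le> n" using m_pos by (simp add: n_eq)
    then have "\<exists>b c. b \<in> {1..n} \<and> c \<in> {1..n} \<and> b \<noteq> a \<and> c \<noteq> a \<and> b \<noteq> c"
      by (cases "a = 1"; cases "a = 2") (rule exI[of _ 1] exI[of _ 2] exI[of _ 3], auto)+
    then obtain b c where bc: "b \<in> {1..n}" "c \<in> {1..n}" "b \<noteq> a" "c \<noteq> a" "b \<noteq> c" by blast
    have "{a, b} \<in> pairs n" "{a, c} \<in> pairs n" using bc True by (auto simp: pairs_def)
    from fix_pair[OF this(1)] fix_pair[OF this(2)]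
    have "perm x a \<in> {a, b}" "perm x a \<in> {a, c}" by blast+
    then show ?thesis using bc by auto
  qed (rule permutes_not_in[OF p])
  then show ?thesis by (intro hol_pure) (simp add: fun_eq_iff)
qed

lemma lk_pow:
  assumes "x \<in> carrier Q" "perm x -` P = P"
  shows "lk (x [^] (j :: nat)) P = int j * lk x P \<and> perm (x [^] j) -` P = P"
proof (induction j)
  case 0
  then show ?case using Psi.hom_one by (simp add: perm_one one_linking_group)
next
  case (Suc j)
  have "perm (x [^] j \<otimes> x) -` P = perm x -` (perm (x [^] j) -` P)"
    using assms(1) by (simp only: perm_mult nat_pow_closed vimage_comp)
  then show ?case using Suc assms by (simp add: fst_Psi_mult algebra_simps)
qed

lemma torsion_free_Gamma: "torsion_free \<Gamma>_group"
  unfolding torsion_free_def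
proof (intro ballI impI allI notI)
  fix x and j :: nat assume "x \<in> carrier \<Gamma>_group" "x \<noteq> \<one>\<^bsub>\<Gamma>_group\<^esub>" and j: "j > 0"
    and "x [^]\<^bsub>\<Gamma>_group\<^esub> j = \<one>\<^bsub>\<Gamma>_group\<^esub>"
  then have x: "x \<in> \<Gamma>" "x \<noteq> \<one>" and tor: "x [^] j = \<one>" by (simp_all add: pow_Gamma)
  have xQ: "x \<in> carrier Q" "hol x \<in> carrier G" "perm x = \<rho> (hol x)"
    and xc: "\<And>i. i \<in> {1..m} \<Longrightarrow> 2 * int m dvd lk x (special i) - 2 * \<xi> i (hol x)"
    using x(1) unfolding Gamma_iff by blast+
  have lk_one: "lk \<one> P = 0" for P using Psi.hom_one by (simp add: one_linking_group)
  \<comment> \<open>Used twice: at the special pairs it makes the holonomy trivial, and then every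
    pair is fixed, so all coordinates vanish.\<close>
  have lk0: "lk x P = 0" if "perm x -` P = P" for P
    using lk_pow[OF xQ(1) that, of j] tor lk_one j by simp
  have "hol x = \<one>\<^bsub>G\<^esub>"
  proof (rule xi_separate[OF xQ(2)])
    fix i assume i: "i \<in> {1..m}"
    have "lk x (special i) = 0" using lk0 rho_special[OF xQ(2) i] xQ(3) by simp
    then show "int m dvd \<xi> i (hol x)" using xc[OF i] by simp
  qed
  then have "perm x = id" using xQ(3) rho_one by simp
  then have "x = \<one>"
    using xQ lk0 lk_one by (intro Psi_eqI) (simp_all add: perm_one)
  then show False using x(2) by simp
qed

lemma bieberbach_Gamma: "bieberbach N \<Gamma>_group G"
proof -
  have "comm_group (int_lattice N)"
    by (rule group.group_comm_groupI) (auto simp: fun_eq_iff)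
  then have "\<exists>\<Theta>\<in>mon G (AutoGroup (int_lattice N)). \<forall>x\<in>carrier \<Gamma>_group. \<forall>v\<in>carrier (int_lattice N).
      lattice (\<Theta> (hol x) v) = x \<otimes>\<^bsub>\<Gamma>_group\<^esub> lattice v \<otimes>\<^bsub>\<Gamma>_group\<^esub> inv\<^bsub>\<Gamma>_group\<^esub> x"
    by (rule holonomy_representation[OF _ group_Gamma G.is_group lattice_mon hol_epi lattice_image])
      (use Gamma_centraliser in auto)
  then show ?thesis
    unfolding bieberbach_def crystallographic_def
    using group_Gamma G.is_group finite_G lattice_mon hol_epi lattice_image torsion_free_Gamma by blast
qed

text \<open>The product formula of the linking group with its vector argument extended to real
  coordinates, renumbered by \<open>pr\<close>. Coordinates from \<open>N\<close> on are 0, as in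
  \<open>Euclidean_space N\<close>.\<close>

definition act :: "'q \<Rightarrow> (nat \<Rightarrow> real) \<Rightarrow> nat \<Rightarrow> real"
  where "act x z = (\<lambda>i. if i < N then z (idx (perm x -` pr i)) + lk x (pr i) else 0)"

lemma act_affine_action: "affine_action \<Gamma>_group N act"
proof -
  interpret \<Gamma>: group \<Gamma>_group by (rule group_Gamma)
  show ?thesis
  proof unfold_locales
    fix x z assume "x \<in> carrier \<Gamma>_group"
    then have x: "x \<in> carrier Q" by (simp add: Gamma_carrier)
    have p: "perm x permutes {1..n}" by (rule perm_permutes[OF x])
    show "act x z \<in> topspace (Euclidean_space N)" by (simp add: act_def topspace_Euclidean_space)
    define \<pi> where "\<pi> i = (if i < N then idx (perm x -` pr i) else i)" for i
    have less: "\<pi> i < N" if "i < N" for i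
      using that pairs_vimage[OF p] by (simp add: \<pi>_def idx_less pr_pairs)
    have "inj_on \<pi> {..<N}"
    proof (rule inj_onI)
      fix i j assume ij: "i \<in> {..<N}" "j \<in> {..<N}" "\<pi> i = \<pi> j"
      then have "perm x -` pr i = perm x -` pr j"
        using pairs_vimage[OF p] pr_pairs pr_idx unfolding \<pi>_def by (metis lessThan_iff)
      then have "pr i = pr j" using surj_image_vimage_eq[OF permutes_surj[OF p]] by metis
      then show "i = j" using ij idx_pr by (metis lessThan_iff)
    qed
    moreover have "\<pi> ` {..<N} \<subseteq> {..<N}" using less by auto
    ultimately have "bij_betw \<pi> {..<N} {..<N}"
      by (simp add: bij_betw_def endo_inj_surj)
    then have "\<pi> permutes {..<N}" by (rule bij_imp_permutes) (simp add: \<pi>_def)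
    then show "\<exists>\<pi> b. \<pi> permutes {..<N} \<and> (\<forall>z\<in>topspace (Euclidean_space N). \<forall>i<N. act x z i = z (\<pi> i) + b i)"
      by (intro exI[of _ \<pi>] exI[of _ "\<lambda>i. real_of_int (lk x (pr i))"]) (simp add: act_def \<pi>_def)
  next
    fix z assume "z \<in> topspace (Euclidean_space N)"
    then show "act \<one>\<^bsub>\<Gamma>_group\<^esub> z = z"
      using Psi.hom_one by (auto simp: act_def perm_one one_linking_group idx_pr topspace_Euclidean_space fun_eq_iff)
  next
    fix x y z assume "x \<in> carrier \<Gamma>_group" "y \<in> carrier \<Gamma>_group"
    then have xy: "x \<in> carrier Q" "y \<in> carrier Q" by (simp_all add: Gamma_carrier)
    have P: "perm x -` pr i \<in> pairs n" if "i < N" for i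
      using pairs_vimage[OF perm_permutes[OF xy(1)]] pr_pairs[OF that] by simp
    show "act (x \<otimes>\<^bsub>\<Gamma>_group\<^esub> y) z = act x (act y z)"
      using xy P by (auto simp: act_def fst_Psi_mult perm_mult vimage_comp[symmetric] idx_less pr_idx fun_eq_iff)
  qed
qed

lemma pow_m_pure: "x \<in> \<Gamma> \<Longrightarrow> perm (x [^] m) = id"
proof -
  assume x: "x \<in> \<Gamma>"
  interpret hol: group_hom \<Gamma>_group G hol
    using hol_epi group_Gamma G.is_group by (simp add: group_hom_def group_hom_axioms_def epi_def)
  have "hol (x [^] m) = hol x [^]\<^bsub>G\<^esub> m"
    using hol.hom_nat_pow[of x m] x by (simp add: pow_Gamma)
  also have "\<dots> = \<one>\<^bsub>G\<^esub>" using G.pow_order_eq_1 x by (simp add: m_eq Gamma_iff)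
  finally show ?thesis using pow_closed_Gamma[OF x, of m] rho_one unfolding Gamma_iff by simp
qed

lemma flat_action_Gamma: "flat_action \<Gamma>_group N act (1 / real m) (2 * real m)"
proof -
  interpret A: affine_action \<Gamma>_group N act by (rule act_affine_action)
  show ?thesis
  proof (rule flat_action.intro[OF act_affine_action], unfold_locales)
    show "1 / real m > 0" using m_pos by simp
    fix x z assume "x \<in> carrier \<Gamma>_group" "x \<noteq> \<one>\<^bsub>\<Gamma>_group\<^esub>" and z: "z \<in> topspace (Euclidean_space N)"
    then have x: "x \<in> \<Gamma>" "x \<noteq> \<one>" by simp_all
    let ?y = "x [^] m"
    have y: "?y \<in> \<Gamma>" "?y \<in> carrier Q" "perm ?y = id" using x pow_closed_Gamma Gamma_carrier pow_m_pure by blast+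
    have "?y \<noteq> \<one>"
      using torsion_free_Gamma x m_pos unfolding torsion_free_def by (simp add: pow_Gamma)
    then obtain P where P: "lk ?y P \<noteq> 0"
      using Psi_eqI[OF y(2) one_closed] y(3) Psi.hom_one by (auto simp: perm_one one_linking_group)
    then have "P \<in> pairs n"
      using exists_pure(2)[OF y(2,3)] by (metis fst_conv mult_zero_right)
    then have i: "idx P < N" "pr (idx P) = P" by (simp_all add: idx_less pr_idx)
    have "act ?y z (idx P) = z (idx P) + lk ?y P" using i y(3) by (simp add: act_def idx_pr)
    then have "\<bar>z (idx P) - act ?y z (idx P)\<bar> \<ge> 1" using P by simp
    then have "1 \<le> l1_dist N z (act ?y z)" using abs_le_l1_dist[OF i(1), of z "act ?y z"] by linarith
    also have "\<dots> \<le> m * l1_dist N z (act x z)"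
      using A.displacement_pow[of x z m] x(1) z by (simp add: pow_Gamma)
    finally show "1 / real m \<le> l1_dist N z (act x z)" using m_pos by (simp add: field_simps)
  next
    fix z assume "z \<in> topspace (Euclidean_space N)"
    \<comment> \<open>Translations move coordinate \<open>i\<close> by multiples of
      \<open>2 * scale (pr i)\<close>, so each coordinate is reduced modulo this period, which is at
      most \<open>2 * m\<close>.\<close>
    define u where "u i = - \<lfloor>z i / (2 * real_of_int (scale (pr i)))\<rfloor>" for i
    have "\<bar>act (lattice u) z i\<bar> \<le> 2 * real m" if i: "i < N" for i
    proof -
      define c where "c = 2 * real_of_int (scale (pr i))"
      have c: "c > 0" "c \<le> 2 * real m"
        using scale_pos[of "pr i"] scale_le[of "pr i"] by (simp_all add: c_def)
      have "act (lattice u) z i = z i - c * \<lfloor>z i / c\<rfloor>"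
        using i by (simp add: act_def perm_lattice lk_lattice lattice_vec_def idx_pr pr_pairs u_def c_def)
      moreover have "c * \<lfloor>z i / c\<rfloor> \<le> z i" "z i < c * (\<lfloor>z i / c\<rfloor> + 1)"
        using floor_divide_lower[OF c(1), of "z i"] floor_divide_upper[OF c(1), of "z i"]
        by (simp_all add: mult.commute)
      ultimately show ?thesis using c by (simp add: algebra_simps abs_le_iff)
    qed
    then show "\<exists>x\<in>carrier \<Gamma>_group. \<forall>i<N. \<bar>act x z i\<bar> \<le> 2 * real m"
      using lattice_Gamma by auto
  qed
qed

lemma flat_manifold_Gamma:
  "\<exists>(X :: (nat \<Rightarrow> real) set topology) \<A> g. flat_manifold N X \<A> g \<and> flat_manifold_holonomy N X G \<and>
    (\<forall>x\<in>topspace X. fundamental_group X x \<cong> \<Gamma>_group)"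
proof -
  interpret F: flat_action \<Gamma>_group N act "1 / real m" "2 * real m" by (rule flat_action_Gamma)
  have "bieberbach N (fundamental_group F.X A) G \<and> fundamental_group F.X A \<cong> \<Gamma>_group" if A: "A \<in> topspace F.X" for A
  proof -
    obtain x where x: "x \<in> topspace (Euclidean_space N)" "A = F.orb x"
      using A unfolding F.orb_image_E[symmetric] by blast
    note iso = F.fundamental_group_iso[OF x(1), folded x(2)]
    \<comment> \<open>The image of a group under an isomorphism is a group once its unit is set to
      the image of the unit; \<open>iso(2)\<close> says that it already is.\<close>
    have "group ((fundamental_group F.X A)\<lparr>one := F.lift_class x \<one>\<^bsub>\<Gamma>_group\<^esub>\<rparr>)"
      by (rule group.iso_imp_img_group[OF group_Gamma iso(1)])
    then have "group (fundamental_group F.X A)" unfolding iso(2)[symmetric] by simp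
    from bieberbach_iso[OF bieberbach_Gamma this iso(1)] group.iso_sym[OF group_Gamma is_isoI[OF iso(1)]]
    show ?thesis ..
  qed
  then show ?thesis using F.flat_manifold_X unfolding flat_manifold_holonomy_def by blast
qed

end

theorem theorem1:
  fixes G :: "('g, 'b) monoid_scheme"
  assumes "comm_group G" and "finite (carrier G)"
  shows "\<exists>n \<Gamma>.
    n \<ge> 1 \<and>
    subgroup \<Gamma> (braid_quotient n) \<and>
    bieberbach (n * (n - 1) div 2) ((braid_quotient n)\<lparr>carrier := \<Gamma>\<rparr>) G \<and>
    mon G (sym_group n) \<noteq> {} \<and>
    (\<exists>(X :: (nat \<Rightarrow> real) set topology) \<A> g.
      flat_manifold (n * (n - 1) div 2) X \<A> g \<and>
      flat_manifold_holonomy (n * (n - 1) div 2) X G \<and>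
      (\<forall>x\<in>topspace X. fundamental_group X x \<cong> (braid_quotient n)\<lparr>carrier := \<Gamma>\<rparr>))"
proof -
  interpret G: comm_group G by fact
  let ?m = "order G" and ?n = "2 * order G + 1"
  have m: "?m > 0" using assms(2) by (simp add: G.order_gt_0_iff_finite)
  obtain \<rho> where \<rho>: "\<And>g. g \<in> carrier G \<Longrightarrow> \<rho> g permutes {1..?m}"
    "\<And>g h. g \<in> carrier G \<Longrightarrow> h \<in> carrier G \<Longrightarrow> \<rho> (g \<otimes>\<^bsub>G\<^esub> h) = \<rho> g \<circ> \<rho> h" "inj_on \<rho> (carrier G)"
    using G.cayley[OF assms(2)] by blast
  have "\<rho> g permutes {1..?n}" if "g \<in> carrier G" for g
    using \<rho>(1)[OF that] by (rule permutes_subset) simp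
  then have "\<rho> \<in> mon G (sym_group ?n)"
    using \<rho> by (simp add: mon_def hom_def sym_group_def)
  have "\<exists>\<xi> :: 'g \<Rightarrow> int. (\<forall>a\<in>carrier G. \<forall>b\<in>carrier G. int ?m dvd \<xi> (a \<otimes>\<^bsub>G\<^esub> b) - \<xi> a - \<xi> b) \<and>
      (g \<in> carrier G \<longrightarrow> g \<noteq> \<one>\<^bsub>G\<^esub> \<longrightarrow> \<not> int ?m dvd \<xi> g)" for g
  proof (cases "g \<in> carrier G \<and> g \<noteq> \<one>\<^bsub>G\<^esub>")
    case True
    then show ?thesis using G.characters_separate[OF assms(2)] by blast
  next
    case False
    then show ?thesis by (intro exI[of _ "\<lambda>_. 0"]) auto
  qed
  then obtain \<xi> :: "'g \<Rightarrow> 'g \<Rightarrow> int" where \<xi>: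
    "\<And>g a b. a \<in> carrier G \<Longrightarrow> b \<in> carrier G \<Longrightarrow> int ?m dvd \<xi> g (a \<otimes>\<^bsub>G\<^esub> b) - \<xi> g a - \<xi> g b"
    "\<And>g. g \<in> carrier G \<Longrightarrow> g \<noteq> \<one>\<^bsub>G\<^esub> \<Longrightarrow> \<not> int ?m dvd \<xi> g g"
    by metis
  \<comment> \<open>Enumerating \<open>G\<close> provides one character for each element, and the
    character chosen for \<open>g\<close> detects \<open>g\<close>.\<close>
  obtain e where e: "bij_betw e {1..?m} (carrier G)"
    using ex_bij_betw_nat_finite_1[OF assms(2)] by (auto simp: order_def)
  obtain s \<Psi> where s: "braid_linking (braid_quotient ?n) ?n s \<Psi>"
    using braid_quotient_linking[of ?n] m by auto
  interpret braid_linking "braid_quotient ?n" ?n s \<Psi> by (rule s)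
  interpret braid_bieberbach "braid_quotient ?n" ?n s \<Psi> G ?m \<rho> "\<lambda>i. \<xi> (e i)"
  proof unfold_locales
    show "finite (carrier G)" by fact
    fix g assume g: "g \<in> carrier G" and dvd: "\<And>i. i \<in> {1..?m} \<Longrightarrow> int ?m dvd \<xi> (e i) g"
    obtain i where "i \<in> {1..?m}" "g = e i" using bij_betw_imp_surj_on[OF e] g by blast
    then show "g = \<one>\<^bsub>G\<^esub>" using dvd[of i] \<xi>(2)[OF g] by auto
  qed (use \<rho> \<xi>(1) in auto)
  show ?thesis
    using subgroup_Gamma bieberbach_Gamma[unfolded N_def] \<open>\<rho> \<in> mon G (sym_group ?n)\<close> flat_manifold_Gamma[unfolded N_def]
    by (intro exI[of _ ?n] exI[of _ \<Gamma>]) auto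
qed

end
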